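(* Let $1<s<2$, let $N>2s$, and let $\Omega\subset\mathbb{R}^N$ be an open domain. Let $u\in\mathcal{D}^{s,2}(\mathbb{R}^N)$ be a nontrivial solution of $(-\Delta)^s u=0$ in $\Omega$. Assume also that $(-\Delta)^s u\in(\mathcal{D}^{s-1,2}(\mathbb{R}^N))^\star$, in the sense that the linear functional $$\varphi\mapsto\int_{\mathbb{R}^N}|\xi|^{2s}\,\widehat u(\xi)\,\overline{\widehat\varphi(\xi)}\,d\xi,\qquad \varphi\in C^\infty_c(\mathbb{R}^N),$$ is continuous with respect to the norm induced by $\mathcal{D}^{s-1,2}(\mathbb{R}^N)$. If there exists a measurable set $E\subset\Omega$ of positive measure such that $u\equiv0$ on $E$, then $u\equiv0$ in $\Omega$.
   Context: The Fourier transform is $\widehat u(\xi)=(2\pi)^{-N/2}\int_{\mathbb{R}^N}e^{-ix\cdot\xi}u(x)\,dx$. For $\gamma>0$ with $N>2\gamma$, $\mathcal{D}^{\gamma,2}(\mathbb{R}^N)$ is the completion of the space $C^\infty_c(\mathbb{R}^N)$ of real-valued smooth compactly supported functions with respect to the scalar product $(u,v)_{\mathcal{D}^{\gamma,2}(\mathbb{R}^N)}=\int_{\mathbb{R}^N}|\xi|^{2\gamma}\widehat u(\xi)\overline{\widehat v(\xi)}\,d\xi$; $(\mathcal{D}^{\gamma,2}(\mathbb{R}^N))^\star$ is its dual space. A solution of $(-\Delta)^su=0$ in $\Omega$ is a function $u\in\mathcal{D}^{s,2}(\mathbb{R}^N)$ such that $(u,\varphi)_{\mathcal{D}^{s,2}(\mathbb{R}^N)}=0$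 for all $\varphi\in C^\infty_c(\Omega)$. *)

theory Defs
  imports "HOL-Analysis.Analysis"
begin

text \<open>\<open>Ck k f\<close>: all partial derivatives of \<open>f\<close> of order at most \<open>k\<close> exist and are continuous.
  In the recursive clause \<open>f' b\<close> is the partial derivative in the direction \<open>b\<close>.\<close>

primrec Ck :: "nat \<Rightarrow> ('a::euclidean_space \<Rightarrow> real) \<Rightarrow> bool" where
  "Ck 0 f \<longleftrightarrow> continuous_on UNIV f"
| "Ck (Suc k) f \<longleftrightarrow>
     (\<exists>f'. (\<forall>x. (f has_derivative (\<lambda>h. \<Sum>b\<in>Basis. (h \<bullet> b) * f' b x)) (at x)) \<and>
           (\<forall>b\<in>Basis. Ck k (f' b)))"

definition test_functions :: "'a::euclidean_space set \<Rightarrow> ('a \<Rightarrow> real) set" where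
  "test_functions \<Omega> = {\<phi>. (\<forall>k. Ck k \<phi>) \<and> compact (closure {x. \<phi> x \<noteq> 0}) \<and>
                         closure {x. \<phi> x \<noteq> 0} \<subseteq> \<Omega>}"

definition fourier :: "('a::euclidean_space \<Rightarrow> real) \<Rightarrow> 'a \<Rightarrow> complex" where
  "fourier u \<xi> = complex_of_real ((2 * pi) powr (- (real DIM('a) / 2))) *
                   (LINT x|lebesgue. exp (- \<i> * complex_of_real (x \<bullet> \<xi>)) * complex_of_real (u x))"

definition test_inner ::
  "real \<Rightarrow> ('a::euclidean_space \<Rightarrow> real) \<Rightarrow> ('a \<Rightarrow> real) \<Rightarrow> complex" where
  "test_inner \<gamma> \<phi> \<psi> =
     (LINT \<xi>|lebesgue. complex_of_real (norm \<xi> powr (2 * \<gamma>)) * fourier \<phi> \<xi> * cnj (fourier \<psi> \<xi>))"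

definition test_norm :: "real \<Rightarrow> ('a::euclidean_space \<Rightarrow> real) \<Rightarrow> real" where
  "test_norm \<gamma> \<phi> = sqrt (Re (test_inner \<gamma> \<phi> \<phi>))"

text \<open>The completion is realised as a space of functions.  For \<open>N > 2 \<gamma>\<close> the Sobolev inequality
  embeds it into \<open>L\<^sup>p\<close> with \<open>p = 2 N / (N - 2 \<gamma>)\<close>, so the class of a Cauchy sequence of test
  functions is identified with the \<open>L\<^sup>p\<close> limit of that sequence.\<close>

definition D_approx ::
  "real \<Rightarrow> (nat \<Rightarrow> 'a::euclidean_space \<Rightarrow> real) \<Rightarrow> ('a \<Rightarrow> real) \<Rightarrow> bool" where
  "D_approx \<gamma> \<phi> u \<longleftrightarrow>
     (\<forall>n. \<phi> n \<in> test_functions UNIV) \<and>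
     (\<forall>e>0. \<exists>M. \<forall>m\<ge>M. \<forall>n\<ge>M. test_norm \<gamma> (\<lambda>x. \<phi> m x - \<phi> n x) < e) \<and>
     ((\<lambda>n. \<integral>\<^sup>+ x. ennreal (\<bar>\<phi> n x - u x\<bar> powr (2 * real DIM('a) / (real DIM('a) - 2 * \<gamma>))) \<partial>lebesgue)
        \<longlonglongrightarrow> 0)"

definition D_space :: "real \<Rightarrow> ('a::euclidean_space \<Rightarrow> real) set" where
  "D_space \<gamma> = {u \<in> borel_measurable lebesgue. \<exists>\<phi>. D_approx \<gamma> \<phi> u}"

text \<open>The Fourier transform on the completion is the continuous extension of \<open>fourier\<close>: the limit
  of \<open>fourier (\<phi> n)\<close> in \<open>L\<^sup>2\<close> with weight \<open>\<bar>\<xi>\<bar>\<^sup>2\<^sup>\<gamma>\<close>, for any approximating sequence \<open>\<phi>\<close>.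
  It is determined up to a null set, so the choice of representative does not affect integrals.\<close>

definition D_fourier :: "real \<Rightarrow> ('a::euclidean_space \<Rightarrow> real) \<Rightarrow> 'a \<Rightarrow> complex" where
  "D_fourier \<gamma> u = (SOME U. U \<in> borel_measurable lebesgue \<and>
     (\<exists>\<phi>. D_approx \<gamma> \<phi> u \<and>
       (\<lambda>n. \<integral>\<^sup>+ \<xi>. ennreal (norm \<xi> powr (2 * \<gamma>) * (cmod (fourier (\<phi> n) \<xi> - U \<xi>))\<^sup>2) \<partial>lebesgue)
         \<longlonglongrightarrow> 0))"

definition D_inner ::
  "real \<Rightarrow> ('a::euclidean_space \<Rightarrow> real) \<Rightarrow> ('a \<Rightarrow> real) \<Rightarrow> complex" where
  "D_inner \<gamma> u v =
     (LINT \<xi>|lebesgue. complex_of_real (norm \<xi> powr (2 * \<gamma>)) * D_fourier \<gamma> u \<xi> * cnj (D_fourier \<gamma> v \<xi>))"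

definition frac_harmonic :: "real \<Rightarrow> 'a::euclidean_space set \<Rightarrow> ('a \<Rightarrow> real) \<Rightarrow> bool" where
  "frac_harmonic s \<Omega> u \<longleftrightarrow> u \<in> D_space s \<and> (\<forall>\<phi>\<in>test_functions \<Omega>. D_inner s u \<phi> = 0)"

definition frac_laplacian_pairing ::
  "real \<Rightarrow> ('a::euclidean_space \<Rightarrow> real) \<Rightarrow> ('a \<Rightarrow> real) \<Rightarrow> complex" where
  "frac_laplacian_pairing s u \<phi> =
     (LINT \<xi>|lebesgue. complex_of_real (norm \<xi> powr (2 * s)) * D_fourier s u \<xi> * cnj (fourier \<phi> \<xi>))"

definition continuous_wrt_D_norm ::
  "real \<Rightarrow> (('a::euclidean_space \<Rightarrow> real) \<Rightarrow> complex) \<Rightarrow> bool" where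
  "continuous_wrt_D_norm \<gamma> F \<longleftrightarrow>
     (\<forall>\<phi>\<in>test_functions UNIV. \<forall>e>0. \<exists>d>0. \<forall>\<psi>\<in>test_functions UNIV.
        test_norm \<gamma> (\<lambda>x. \<psi> x - \<phi> x) < d \<longrightarrow> cmod (F \<psi> - F \<phi>) < e)"

end

theory Submission
  imports Defs "HOL-Probability.Probability" "HOL-Complex_Analysis.Complex_Analysis" "HOL-Real_Asymp.Real_Asymp"
begin

text \<open>
  The solution is real analytic in \<open>\<Omega>\<close>, and a real analytic function on a connected open set
  vanishes identically if it vanishes on a set of positive measure.

  Write \<open>Y\<close> for the Fourier transform of \<open>u\<close> (without the constant) and put
  \<open>v\<^sub>t(z) = \<integral> \<bar>\<xi>\<bar>\<^sup>2\<^sup>s Y(\<xi>) exp (i z \<bullet> \<xi> - t \<bar>\<xi>\<bar>\<^sup>2) d\<xi>\<close> for complex \<open>z\<close>, the heat flow of the distribution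
  \<open>(-\<Delta>)\<^sup>s u\<close>.  Since \<open>\<Gamma>(s) \<bar>\<xi>\<bar>\<^sup>-\<^sup>2\<^sup>s = \<integral>\<^sub>0\<^sup>\<infinity> t\<^sup>s\<^sup>-\<^sup>1 exp (- t \<bar>\<xi>\<bar>\<^sup>2) dt\<close>, the heat flow \<open>e\<^sup>\<epsilon>\<^sup>\<Delta> u\<close> is
  \<open>(1 / \<Gamma>(s)) \<integral>\<^sub>0\<^sup>\<infinity> t\<^sup>s\<^sup>-\<^sup>1 v\<^sub>t\<^sub>+\<^sub>\<epsilon> dt\<close>.  Because \<open>(-\<Delta>)\<^sup>s u\<close> vanishes in \<open>\<Omega>\<close>, the heat kernel in \<open>v\<^sub>t(z)\<close> may be
  multiplied by a cutoff vanishing near a point of \<open>\<Omega>\<close>; this keeps \<open>v\<^sub>t(z)\<close> bounded as \<open>t \<rightarrow> 0\<close> for complex \<open>z\<close>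
  near that point.  For large \<open>t\<close> the integral converges as \<open>N > 2 s\<close>.  So \<open>e\<^sup>\<epsilon>\<^sup>\<Delta> u\<close> extends to complex \<open>z\<close> with a
  bound independent of \<open>\<epsilon>\<close>, and by Montel's theorem its limit is holomorphic along every complex line.

  The zero set of such a function has, at almost every of its points, other zeros arbitrarily close by
  in each direction of a countable dense set; hence it contains lines in a dense set of directions through
  one point, and by continuity a whole ball.
\<close>

section \<open>Gaussians and the heat kernel\<close>

text \<open>The two conditions on \<open>s\<close> act at opposite ends of the frequency range.
  \<open>2 * s < N\<close> makes \<open>|\<xi>| powr (- 2 * s)\<close> locally integrable, so every
  Gaussian, even with the linear exponential factor of a complex point, lies in the dual of the
  weighted space containing \<open>Y\<close>, and pairings are controlled by Cauchy-Schwarz.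
  \<open>s < 2\<close> bounds the weight by \<open>1 + |\<xi>|^4\<close>, so the weighted norm of a
  transform is controlled by second differences, and two derivatives of the cutoff suffice. The
  cutoff works because the kernel at \<open>a + i b\<close> has modulus of order
  \<open>t powr (- N / 2) * exp ((|b|^2 - |y - a|^2) / (4 t))\<close>: away from \<open>x0\<close>
  and for small \<open>b\<close> the exponential beats every power of \<open>1 / t\<close>. A second
  obstacle is that \<open>u\<close> and its transform are only limits, in different topologies, and
  the transform is moreover picked by \<open>SOME\<close>. Both limits are compatible with pairing
  against a heat kernel, and this single test identifies them.\<close>

definition heat_kernel :: "real \<Rightarrow> 'a::euclidean_space \<Rightarrow> real" where
  "heat_kernel t x = (4 * pi * t) powr (- (real DIM('a) / 2)) * exp (- (norm x)\<^sup>2 / (4 * t))"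

text \<open>Rescaling by \<open>\<sigma>\<close> reduces this to the known characteristic function
  of the standard normal law.\<close>

lemma normal_density_char:
  assumes "\<sigma> > 0"
  shows "integrable lborel (\<lambda>x. complex_of_real (normal_density 0 \<sigma> x) * iexp (x * k))"
    and "(LINT x|lborel. complex_of_real (normal_density 0 \<sigma> x) * iexp (x * k))
           = complex_of_real (exp (- (\<sigma> * k)\<^sup>2 / 2))"
proof -
  show "integrable lborel (\<lambda>x. complex_of_real (normal_density 0 \<sigma> x) * iexp (x * k))"
    by (rule Bochner_Integration.integrable_bound[OF integrable_normal_density[OF assms, of 0]])
       (auto simp: norm_mult)
  have "(LINT x|lborel. complex_of_real (normal_density 0 \<sigma> x) * iexp (x * k)) =
     \<bar>\<sigma>\<bar> *\<^sub>R (LINT x|lborel. complex_of_real (normal_density 0 \<sigma> (0 + \<sigma> * x)) * iexp ((0 + \<sigma> * x) * k))"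
    by (rule lborel_integral_real_affine) (use assms in auto)
  also have "\<dots> = (LINT x|lborel. std_normal_density x *\<^sub>R iexp (\<sigma> * k * x))"
    unfolding integral_scaleR_right[symmetric]
  proof (rule Bochner_Integration.integral_cong[OF refl])
    fix x :: real
    have "\<sigma> * normal_density 0 \<sigma> (\<sigma> * x) = std_normal_density x"
      using assms by (simp add: normal_density_def real_sqrt_mult power_mult_distrib field_simps)
    then show "\<bar>\<sigma>\<bar> *\<^sub>R (complex_of_real (normal_density 0 \<sigma> (0 + \<sigma> * x)) * iexp ((0 + \<sigma> * x) * k))
        = std_normal_density x *\<^sub>R iexp (\<sigma> * k * x)"
      using assms by (simp add: scaleR_conv_of_real mult_ac flip: of_real_mult)
  qed
  also have "\<dots> = char std_normal_distribution (\<sigma> * k)"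
    unfolding char_def by (subst integral_density) auto
  also have "\<dots> = complex_of_real (exp (- (\<sigma> * k)\<^sup>2 / 2))"
    by (simp add: char_std_normal_distribution)
  finally show "(LINT x|lborel. complex_of_real (normal_density 0 \<sigma> x) * iexp (x * k))
           = complex_of_real (exp (- (\<sigma> * k)\<^sup>2 / 2))" .
qed

lemma norm_square_eq_sum:
  fixes x :: "'a::euclidean_space"
  shows "(norm x)\<^sup>2 = (\<Sum>b\<in>Basis. (x \<bullet> b)\<^sup>2)"
  unfolding power2_norm_eq_inner by (simp add: euclidean_inner[of x x] power2_eq_square)

text \<open>The heat kernel is the density of independent normal coordinates of variance
  \<open>2 * t\<close>; this form lets the Fourier integral split by coordinates.\<close>

lemma heat_kernel_prod:
  fixes x :: "'a::euclidean_space"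
  assumes "t > 0"
  shows "heat_kernel t x = (\<Prod>b\<in>Basis. normal_density 0 (sqrt (2 * t)) (x \<bullet> b))"
proof -
  have "normal_density 0 (sqrt (2*t)) y = (4 * pi * t) powr (-1/2) * exp (- y\<^sup>2 / (4 * t))" for y
    using assms by (simp add: normal_density_def powr_minus powr_half_sqrt field_simps)
  then have "(\<Prod>b\<in>Basis. normal_density 0 (sqrt (2 * t)) (x \<bullet> b))
     = ((4 * pi * t) powr (-1/2)) ^ DIM('a) * exp (\<Sum>b\<in>Basis. - (x \<bullet> b)\<^sup>2 / (4 * t))"
    by (simp add: prod.distrib exp_sum)
  also have "(\<Sum>b\<in>Basis. - (x \<bullet> b)\<^sup>2 / (4 * t)) = - (norm x)\<^sup>2 / (4 * t)"
    by (simp add: norm_square_eq_sum sum_negf flip: sum_divide_distrib)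
  also have "((4 * pi * t) powr (-1/2)) ^ DIM('a) = (4 * pi * t) powr (- (real DIM('a) / 2))"
    using assms by (simp add: powr_powr flip: powr_realpow)
  finally show ?thesis by (simp add: heat_kernel_def)
qed

lemma heat_kernel_char:
  fixes k :: "'a::euclidean_space"
  assumes t: "t > 0"
  shows "integrable lborel (\<lambda>x. complex_of_real (heat_kernel t x) * iexp (x \<bullet> k))"
    and "(LINT x|lborel. complex_of_real (heat_kernel t x) * iexp (x \<bullet> k)) = complex_of_real (exp (- t * (norm k)\<^sup>2))"
proof -
  interpret product_sigma_finite "\<lambda>_::'a. lborel :: real measure" ..
  let ?f = "\<lambda>b x. complex_of_real (normal_density 0 (sqrt (2*t)) x) * iexp (x * (k \<bullet> b))"
  let ?g = "\<lambda>x::'a. complex_of_real (heat_kernel t x) * iexp (x \<bullet> k)"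
  let ?P = "\<Pi>\<^sub>M b\<in>(Basis::'a set). (lborel :: real measure)"
  let ?T = "\<lambda>f. \<Sum>b\<in>Basis. f b *\<^sub>R b :: 'a"
  have s: "sqrt (2 * t) > 0" using t by simp
  have inner_T: "?T f \<bullet> b = f b" if "b \<in> Basis" for f b
    using that by (simp add: inner_sum_left inner_Basis if_distrib cong: if_cong)
  have eq: "?g (?T f) = (\<Prod>b\<in>Basis. ?f b (f b))" for f
  proof -
    have 1: "complex_of_real (?T f \<bullet> k) = (\<Sum>b\<in>Basis. complex_of_real (f b * (k \<bullet> b)))"
      unfolding of_real_sum[symmetric] by (simp only: inner_sum_left inner_scaleR_left inner_commute[of k])
    show ?thesis
      unfolding 1 sum_distrib_left exp_sum[OF finite_Basis] prod.distrib heat_kernel_prod[OF t]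
      by (simp add: inner_T del: inner_sum_left_Basis)
  qed
  have meas: "?g \<in> borel_measurable borel"
    unfolding heat_kernel_def by measurable
  have T: "?T \<in> measurable ?P borel" by measurable
  have intf: "integrable lborel (?f b)" for b
    by (rule normal_density_char[OF s])
  have "integrable ?P (\<lambda>f. \<Prod>b\<in>Basis. ?f b (f b))"
    by (rule product_integrable_prod) (auto intro!: intf simp del: of_real_mult)
  then have "integrable ?P (\<lambda>f. ?g (?T f))" unfolding eq .
  then show "integrable lborel ?g"
    by (subst lborel_eq) (simp only: integrable_distr_eq[OF T meas])
  have "(LINT x|lborel. ?g x) = (LINT f|?P. ?g (?T f))"
    by (subst lborel_eq) (rule integral_distr[OF T meas])
  also have "\<dots> = (\<Prod>b\<in>Basis. LINT x|lborel. ?f b x)"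
    unfolding eq by (rule product_integral_prod) (auto intro!: intf simp del: of_real_mult)
  also have "\<dots> = (\<Prod>b\<in>Basis. complex_of_real (exp (- (sqrt (2*t) * (k \<bullet> b))\<^sup>2 / 2)))"
    by (simp only: normal_density_char(2)[OF s])
  also have "\<dots> = complex_of_real (exp (\<Sum>b\<in>Basis. - t * (k \<bullet> b)\<^sup>2))"
    using t by (simp add: exp_sum power_mult_distrib flip: of_real_prod)
  also have "(\<Sum>b\<in>Basis. - t * (k \<bullet> b)\<^sup>2) = - t * (norm k)\<^sup>2"
    by (simp add: norm_square_eq_sum sum_distrib_left sum_negf)
  finally show "(LINT x|lborel. ?g x) = complex_of_real (exp (- t * (norm k)\<^sup>2))" .
qed

lemma heat_kernel_pos: "t > 0 \<Longrightarrow> heat_kernel t x > 0"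
  by (simp add: heat_kernel_def)

lemma heat_kernel_measurable [measurable]: "heat_kernel t \<in> borel_measurable borel"
  unfolding heat_kernel_def by measurable

lemma heat_kernel_minus: "heat_kernel t (x - y) = heat_kernel t (y - x)"
  by (simp add: heat_kernel_def norm_minus_commute)

lemma heat_kernel_integral:
  assumes "t > 0"
  shows "integrable lborel (heat_kernel t :: 'a::euclidean_space \<Rightarrow> real)"
    and "(LINT x|lborel. heat_kernel t (x::'a)) = 1"
proof -
  have "integrable lborel (\<lambda>x. complex_of_real (heat_kernel t (x::'a)))"
    using heat_kernel_char(1)[OF assms, of 0] by simp
  then show "integrable lborel (heat_kernel t :: 'a \<Rightarrow> real)"
    unfolding complex_of_real_integrable_eq .
  have "complex_of_real (LINT x|lborel. heat_kernel t (x::'a)) = 1"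
    using heat_kernel_char(2)[OF assms, of 0] by (simp add: integral_complex_of_real)
  then show "(LINT x|lborel. heat_kernel t (x::'a)) = 1"
    using of_real_eq_1_iff by blast
qed

text \<open>A centred Gaussian is a multiple of a heat kernel at time \<open>1 / (4 * c)\<close>, so
  its integrability and transform follow from the characteristic function above.\<close>

lemma exp_square_eq_heat_kernel:
  fixes x :: "'a::euclidean_space"
  assumes "c > 0"
  shows "exp (- c * (norm x)\<^sup>2) = (pi / c) powr (real DIM('a) / 2) * heat_kernel (1 / (4 * c)) x"
  using assms by (simp add: heat_kernel_def powr_minus field_simps)

lemma integrable_exp_square:
  assumes "c > 0"
  shows "integrable lborel (\<lambda>x::'a::euclidean_space. exp (- c * (norm x)\<^sup>2))"
  unfolding exp_square_eq_heat_kernel[OF assms]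
  using assms by (intro integrable_mult_right heat_kernel_integral) auto

text \<open>The one case of Fourier inversion that has to be computed: the Gaussian transforms back
  into the heat kernel. The factor \<open>(2 * pi) ^ N\<close> appears on writing
  \<open>pi / c\<close> as \<open>(2 * pi)\<^sup>2 / (4 * pi * c)\<close>.\<close>

lemma integral_exp_square_iexp:
  fixes x :: "'a::euclidean_space"
  assumes "c > 0"
  shows "(LINT \<xi>|lborel. complex_of_real (exp (- c * (norm \<xi>)\<^sup>2)) * iexp (\<xi> \<bullet> x))
     = complex_of_real ((2 * pi) ^ DIM('a) * heat_kernel c x)"
proof -
  have c: "1 / (4 * c) > 0" using assms by simp
  have "(LINT \<xi>|lborel. complex_of_real (exp (- c * (norm \<xi>)\<^sup>2)) * iexp (\<xi> \<bullet> x))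
      = complex_of_real ((pi / c) powr (real DIM('a) / 2)) *
        (LINT \<xi>|lborel. complex_of_real (heat_kernel (1 / (4 * c)) \<xi>) * iexp (\<xi> \<bullet> x))"
    unfolding exp_square_eq_heat_kernel[OF assms] of_real_mult mult.assoc by simp
  also have "\<dots> = complex_of_real ((pi / c) powr (real DIM('a) / 2) * exp (- (norm x)\<^sup>2 / (4 * c)))"
    unfolding heat_kernel_char(2)[OF c] by simp
  also have "(pi / c) powr (real DIM('a) / 2) = ((2 * pi)\<^sup>2 / (4 * pi * c)) powr (real DIM('a) / 2)"
    using assms by (intro arg_cong2[where f="(powr)"] refl) (simp add: divide_simps power2_eq_square)
  also have "\<dots> = (2 * pi) ^ DIM('a) * (4 * pi * c) powr (- (real DIM('a) / 2))"
  proof -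
    have "(2 * pi)\<^sup>2 = (2 * pi) powr real 2"
      by (rule powr_realpow[symmetric]) simp
    then have "((2 * pi)\<^sup>2) powr (real DIM('a) / 2) = (2 * pi) powr (real 2 * (real DIM('a) / 2))"
      by (simp only: powr_powr)
    also have "\<dots> = (2 * pi) powr (real DIM('a))"
      by simp
    also have "\<dots> = (2 * pi) ^ DIM('a)"
      by (rule powr_realpow) simp
    finally have "((2 * pi)\<^sup>2) powr (real DIM('a) / 2) = (2 * pi) ^ DIM('a)" .
    moreover have "((2 * pi)\<^sup>2 / (4 * pi * c)) powr (real DIM('a) / 2)
        = ((2 * pi)\<^sup>2) powr (real DIM('a) / 2) / (4 * pi * c) powr (real DIM('a) / 2)"
      by (simp only: powr_divide)
    ultimately show ?thesis
      by (simp only: powr_minus divide_inverse)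
  qed
  finally show ?thesis by (simp add: heat_kernel_def)
qed

lemma integral_exp_square:
  assumes "c > 0"
  shows "(LINT x|lborel. exp (- c * (norm (x::'a::euclidean_space))\<^sup>2)) = (pi / c) powr (real DIM('a) / 2)"
  unfolding exp_square_eq_heat_kernel[OF assms]
  using assms by (simp add: heat_kernel_integral)

section \<open>Fourier integrals and Plancherel's inequality\<close>

text \<open>Fatou's lemma, in the form that passes a uniform bound to an almost everywhere
  limit.\<close>

lemma nn_integral_le_of_tendsto:
  fixes f :: "nat \<Rightarrow> 'a \<Rightarrow> ennreal"
  assumes [measurable]: "\<And>n. f n \<in> borel_measurable M"
    and lim: "AE x in M. (\<lambda>n. f n x) \<longlonglongrightarrow> g x"
    and le: "eventually (\<lambda>n. (\<integral>\<^sup>+x. f n x \<partial>M) \<le> C) sequentially"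
  shows "(\<integral>\<^sup>+x. g x \<partial>M) \<le> C"
proof -
  have "(\<integral>\<^sup>+x. g x \<partial>M) = (\<integral>\<^sup>+x. liminf (\<lambda>n. f n x) \<partial>M)"
    using lim by (intro nn_integral_cong_AE) (auto elim!: eventually_mono simp: lim_imp_Liminf)
  also have "\<dots> \<le> liminf (\<lambda>n. \<integral>\<^sup>+x. f n x \<partial>M)"
    by (rule nn_integral_liminf) simp
  also have "\<dots> \<le> C"
    using Liminf_mono[OF le] by (simp add: Liminf_const)
  finally show ?thesis .
qed

lemma ennreal_norm_integral_le:
  fixes f :: "'a \<Rightarrow> 'b::{banach, second_countable_topology}"
  shows "ennreal (norm (integral\<^sup>L M f)) \<le> (\<integral>\<^sup>+x. ennreal (norm (f x)) \<partial>M)"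
  by (cases "integrable M f") (auto simp: integral_norm_bound_ennreal not_integrable_integral_eq)

lemma integrable_lborel_translation:
  fixes f :: "'a::euclidean_space \<Rightarrow> 'b::{banach, second_countable_topology}"
  assumes "integrable lborel f"
  shows "integrable lborel (\<lambda>x. f (c + x))"
proof -
  have [measurable]: "f \<in> borel_measurable borel"
    using borel_measurable_integrable[OF assms] by simp
  have "integrable (distr lborel borel ((+) c)) f"
    unfolding lborel_distr_plus by (rule assms)
  then show ?thesis
    by (subst (asm) integrable_distr_eq) auto
qed

lemma integral_lborel_translation:
  fixes f :: "'a::euclidean_space \<Rightarrow> 'b::{banach, second_countable_topology}"
  assumes [measurable]: "f \<in> borel_measurable borel"
  shows "(LINT x|lborel. f (c + x)) = (LINT x|lborel. f x)"
proof -
  have "(LINT x|lborel. f x) = (LINT x|distr lborel borel ((+) c). f x)"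
    unfolding lborel_distr_plus ..
  also have "\<dots> = (LINT x|lborel. f (c + x))"
    by (rule integral_distr) auto
  finally show ?thesis ..
qed

lemma nn_integral_lborel_translation:
  fixes f :: "'a::euclidean_space \<Rightarrow> ennreal"
  assumes [measurable]: "f \<in> borel_measurable borel"
  shows "(\<integral>\<^sup>+x. f (c + x) \<partial>lborel) = (\<integral>\<^sup>+x. f x \<partial>lborel)"
proof -
  have "(\<integral>\<^sup>+x. f x \<partial>lborel) = (\<integral>\<^sup>+x. f x \<partial>distr lborel borel ((+) c))"
    unfolding lborel_distr_plus ..
  also have "\<dots> = (\<integral>\<^sup>+x. f (c + x) \<partial>lborel)"
    by (rule nn_integral_distr) auto
  finally show ?thesis ..
qed

lemma nn_integral_heat_kernel:
  fixes y :: "'a::euclidean_space"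
  assumes "t > 0"
  shows "(\<integral>\<^sup>+x. ennreal (heat_kernel t (x - y)) \<partial>lborel) = 1"
    and "(\<integral>\<^sup>+x. ennreal (heat_kernel t (y - x)) \<partial>lborel) = 1"
proof -
  have "(\<integral>\<^sup>+x. ennreal (heat_kernel t (x - y)) \<partial>lborel) = (\<integral>\<^sup>+x. ennreal (heat_kernel t (- y + x)) \<partial>lborel)"
    by (simp add: algebra_simps)
  also have "\<dots> = (\<integral>\<^sup>+x. ennreal (heat_kernel t (x::'a)) \<partial>lborel)"
    by (rule nn_integral_lborel_translation) measurable
  also have "\<dots> = 1"
    using heat_kernel_integral[OF assms, where 'a='a] heat_kernel_pos[OF assms, where 'a='a]
    by (subst nn_integral_eq_integral) (auto intro: less_imp_le)
  finally show *: "(\<integral>\<^sup>+x. ennreal (heat_kernel t (x - y)) \<partial>lborel) = 1" .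
  then show "(\<integral>\<^sup>+x. ennreal (heat_kernel t (y - x)) \<partial>lborel) = 1"
    by (subst heat_kernel_minus)
qed

lemma ennreal_power2_le_imp_le:
  assumes "X\<^sup>2 \<le> (ennreal r)\<^sup>2"
  shows "X \<le> ennreal r"
proof (cases X)
  case (real x)
  have "x \<le> r" if "r \<ge> 0"
    using assms real that by (auto simp: ennreal_power intro: power2_le_imp_le)
  moreover have "x = 0" if "r < 0"
    using assms real that by (auto simp: ennreal_power ennreal_neg)
  ultimately show ?thesis
    using real by (cases "r \<ge> 0") (auto intro: ennreal_leI)
next
  case top
  have "(ennreal r)\<^sup>2 < top"
    by (simp add: power2_eq_square ennreal_mult_less_top)
  then show ?thesis
    using assms top by (simp add: power2_eq_square)
qed

lemma cnj_measurable [measurable]: "cnj \<in> borel_measurable borel"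
  by (intro borel_measurable_continuous_onI continuous_intros)

text \<open>The bounds are real numbers \<open>A\<close> and \<open>B\<close>, so finiteness is
  built in and integrability of the product comes with the estimate.\<close>

lemma Cauchy_Schwarz_integrable:
  fixes f g :: "'a \<Rightarrow> complex"
  assumes [measurable]: "f \<in> borel_measurable M" "g \<in> borel_measurable M"
    and f: "(\<integral>\<^sup>+x. ennreal ((cmod (f x))\<^sup>2) \<partial>M) \<le> ennreal A" "A \<ge> 0"
    and g: "(\<integral>\<^sup>+x. ennreal ((cmod (g x))\<^sup>2) \<partial>M) \<le> ennreal B" "B \<ge> 0"
  shows "integrable M (\<lambda>x. f x * g x)"
    and "(\<integral>\<^sup>+x. ennreal (cmod (f x * g x)) \<partial>M) \<le> ennreal (sqrt (A * B))"
    and "cmod (LINT x|M. f x * g x) \<le> sqrt (A * B)"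
proof -
  have "(\<integral>\<^sup>+x. ennreal (cmod (f x)) * ennreal (cmod (g x)) \<partial>M)\<^sup>2
     \<le> (\<integral>\<^sup>+x. ennreal (cmod (f x)) ^ 2 \<partial>M) * (\<integral>\<^sup>+x. ennreal (cmod (g x)) ^ 2 \<partial>M)"
    by (rule Cauchy_Schwarz_nn_integral) auto
  also have "\<dots> \<le> ennreal A * ennreal B"
    using f g by (intro mult_mono) (auto simp: ennreal_power)
  also have "\<dots> = ennreal (sqrt (A * B)) ^ 2"
    using f g by (simp add: ennreal_power ennreal_mult)
  finally have "(\<integral>\<^sup>+x. ennreal (cmod (f x)) * ennreal (cmod (g x)) \<partial>M) \<le> ennreal (sqrt (A * B))"
    by (rule ennreal_power2_le_imp_le)
  then show *: "(\<integral>\<^sup>+x. ennreal (cmod (f x * g x)) \<partial>M) \<le> ennreal (sqrt (A * B))"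
    by (simp add: norm_mult ennreal_mult)
  then show int: "integrable M (\<lambda>x. f x * g x)"
    by (intro integrableI_bounded) (auto intro: le_less_trans)
  have "ennreal (cmod (LINT x|M. f x * g x)) \<le> (\<integral>\<^sup>+x. ennreal (cmod (f x * g x)) \<partial>M)"
    by (rule integral_norm_bound_ennreal[OF int])
  with * have "ennreal (cmod (LINT x|M. f x * g x)) \<le> ennreal (sqrt (A * B))"
    by (rule order.trans[rotated])
  then show "cmod (LINT x|M. f x * g x) \<le> sqrt (A * B)"
    using f g by (subst (asm) ennreal_le_iff) auto
qed

text \<open>The sign is that of a characteristic function and there is no normalising factor, so the
  Gaussian computations apply verbatim. For real \<open>u\<close>, \<open>fourier u\<close> is a
  constant multiple of the conjugate.\<close>

definition FT :: "('a::euclidean_space \<Rightarrow> complex) \<Rightarrow> 'a \<Rightarrow> complex" where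
  "FT w \<xi> = (LINT x|lborel. w x * iexp (x \<bullet> \<xi>))"

lemma FT_measurable [measurable]:
  assumes [measurable]: "w \<in> borel_measurable borel"
  shows "FT w \<in> borel_measurable borel"
  unfolding FT_def by measurable

lemma norm_FT_le: "cmod (FT w \<xi>) \<le> (LINT x|lborel. cmod (w x))"
  unfolding FT_def using integral_norm_bound[of lborel "\<lambda>x. w x * iexp (x \<bullet> \<xi>)"]
  by (simp add: norm_mult)

lemma integrable_mult_iexp:
  fixes w :: "'a::euclidean_space \<Rightarrow> complex"
  assumes "integrable lborel w"
  shows "integrable lborel (\<lambda>x. w x * iexp (x \<bullet> \<xi>))"
proof -
  have [measurable]: "w \<in> borel_measurable borel"
    using borel_measurable_integrable[OF assms] by simp
  show ?thesis
    by (rule Bochner_Integration.integrable_bound[OF assms]) (auto simp: norm_mult)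
qed

text \<open>The multiplication formula: Fubini for an integrand whose modulus is a product of two
  integrable functions.\<close>

lemma integral_FT_mult:
  fixes w g :: "'a::euclidean_space \<Rightarrow> complex"
  assumes w: "integrable lborel w" and g: "integrable lborel g"
  shows "(LINT \<xi>|lborel. FT w \<xi> * g \<xi>) = (LINT x|lborel. w x * FT g x)"
proof -
  have [measurable]: "w \<in> borel_measurable borel" "g \<in> borel_measurable borel"
    using borel_measurable_integrable[OF w] borel_measurable_integrable[OF g] by simp_all
  have "integrable (lborel \<Otimes>\<^sub>M lborel) (\<lambda>(x, \<xi>). w x * (g \<xi> * iexp (\<xi> \<bullet> x)))"
  proof (rule lborel_pair.Fubini_integrable)
    show "integrable lborel (\<lambda>x. LINT \<xi>|lborel. norm (case (x, \<xi>) of (x, \<xi>) \<Rightarrow> w x * (g \<xi> * iexp (\<xi> \<bullet> x))))"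
      using w by (simp add: norm_mult)
    show "AE x in lborel. integrable lborel (\<lambda>\<xi>. case (x, \<xi>) of (x, \<xi>) \<Rightarrow> w x * (g \<xi> * iexp (\<xi> \<bullet> x)))"
      using integrable_mult_iexp[OF g] by (intro AE_I2) auto
  qed measurable
  from lborel_pair.Fubini_integral[OF this]
  have "(LINT \<xi>|lborel. LINT x|lborel. w x * (g \<xi> * iexp (\<xi> \<bullet> x))) = (LINT x|lborel. LINT \<xi>|lborel. w x * (g \<xi> * iexp (\<xi> \<bullet> x)))" .
  also have "(LINT x|lborel. LINT \<xi>|lborel. w x * (g \<xi> * iexp (\<xi> \<bullet> x))) = (LINT x|lborel. w x * FT g x)"
    unfolding FT_def by simp
  also have "(LINT \<xi>|lborel. LINT x|lborel. w x * (g \<xi> * iexp (\<xi> \<bullet> x))) = (LINT \<xi>|lborel. (LINT x|lborel. (w x * iexp (x \<bullet> \<xi>)) * g \<xi>))"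
    by (simp add: inner_commute mult_ac)
  also have "\<dots> = (LINT \<xi>|lborel. FT w \<xi> * g \<xi>)"
    unfolding FT_def by simp
  finally show ?thesis .
qed

text \<open>With the multiplication formula, pairing \<open>FT w\<close> with this modulated
  Gaussian evaluates a heat convolution of \<open>w\<close> at \<open>- y\<close>.\<close>

lemma FT_gaussian_shift:
  fixes x :: "'a::euclidean_space"
  assumes "c > 0"
  shows "FT (\<lambda>\<xi>. complex_of_real (exp (- c * (norm \<xi>)\<^sup>2)) * iexp (\<xi> \<bullet> y)) x
     = complex_of_real ((2 * pi) ^ DIM('a) * heat_kernel c (x + y))"
proof -
  have "FT (\<lambda>\<xi>. complex_of_real (exp (- c * (norm \<xi>)\<^sup>2)) * iexp (\<xi> \<bullet> y)) x =
     (LINT \<xi>|lborel. complex_of_real (exp (- c * (norm \<xi>)\<^sup>2)) * iexp (\<xi> \<bullet> (x + y)))"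
    unfolding FT_def
    by (intro Bochner_Integration.integral_cong refl)
       (simp add: mult.assoc inner_add_right ring_distribs flip: exp_add add: add.commute)
  then show ?thesis
    by (simp only: integral_exp_square_iexp[OF assms])
qed

lemma integrable_gaussian_iexp:
  assumes "c > 0"
  shows "integrable lborel (\<lambda>\<xi>::'a::euclidean_space. complex_of_real (exp (- c * (norm \<xi>)\<^sup>2)) * iexp (\<xi> \<bullet> y))"
  by (intro integrable_mult_iexp) (simp only: complex_of_real_integrable_eq integrable_exp_square[OF assms])

text \<open>Schur's test: \<open>|w x| * |w y|\<close> is at most the mean of the two squares, and
  the kernel has mass one in each variable separately.\<close>

lemma nn_integral_convolution_le:
  fixes w :: "'a::euclidean_space \<Rightarrow> complex"
  assumes [measurable]: "w \<in> borel_measurable borel" and t: "t > 0"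
  shows "(\<integral>\<^sup>+x. \<integral>\<^sup>+y. ennreal (cmod (w x) * cmod (w y) * heat_kernel t (y - x)) \<partial>lborel \<partial>lborel)
     \<le> (\<integral>\<^sup>+x. ennreal ((cmod (w x))\<^sup>2) \<partial>lborel)"
proof -
  let ?h = "heat_kernel t :: 'a \<Rightarrow> real"
  have h: "?h x \<ge> 0" for x using heat_kernel_pos[OF t, of x] by simp
  let ?a = "\<lambda>x y. ennreal ((cmod (w x))\<^sup>2 / 2) * ennreal (?h (y - x))"
  let ?b = "\<lambda>x y. ennreal ((cmod (w y))\<^sup>2 / 2) * ennreal (?h (y - x))"
  have distr: "ennreal ((p + r) * q) = ennreal p * ennreal q + ennreal r * ennreal q"
    if "p \<ge> 0" "q \<ge> 0" "r \<ge> 0" for p q r :: real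
    using that by (simp add: distrib_right ennreal_mult)
  have pt: "ennreal (cmod (w x) * cmod (w y) * ?h (y - x)) \<le> ?a x y + ?b x y" for x y
  proof -
    have "0 \<le> (cmod (w x) - cmod (w y))\<^sup>2" by simp
    then have "cmod (w x) * cmod (w y) \<le> (cmod (w x))\<^sup>2 / 2 + (cmod (w y))\<^sup>2 / 2"
      by (simp add: power2_eq_square algebra_simps)
    then have "cmod (w x) * cmod (w y) * ?h (y - x) \<le> ((cmod (w x))\<^sup>2 / 2 + (cmod (w y))\<^sup>2 / 2) * ?h (y - x)"
      using h by (intro mult_right_mono) auto
    also have "ennreal \<dots> = ?a x y + ?b x y"
      by (rule distr) (use h in auto)
    finally show ?thesis by (simp add: ennreal_leI)
  qed
  have "(\<integral>\<^sup>+x. \<integral>\<^sup>+y. ennreal (cmod (w x) * cmod (w y) * ?h (y - x)) \<partial>lborel \<partial>lborel)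
     \<le> (\<integral>\<^sup>+x. \<integral>\<^sup>+y. ?a x y + ?b x y \<partial>lborel \<partial>lborel)"
    by (intro nn_integral_mono pt)
  also have "\<dots> = (\<integral>\<^sup>+x. \<integral>\<^sup>+y. ?a x y \<partial>lborel \<partial>lborel) + (\<integral>\<^sup>+x. \<integral>\<^sup>+y. ?b x y \<partial>lborel \<partial>lborel)"
    by (simp add: nn_integral_add)
  also have "(\<integral>\<^sup>+x. \<integral>\<^sup>+y. ?b x y \<partial>lborel \<partial>lborel) = (\<integral>\<^sup>+y. \<integral>\<^sup>+x. ?b x y \<partial>lborel \<partial>lborel)"
    by (rule lborel_pair.Fubini') measurable
  also have "(\<integral>\<^sup>+y. \<integral>\<^sup>+x. ?b x y \<partial>lborel \<partial>lborel) = (\<integral>\<^sup>+y. ennreal ((cmod (w y))\<^sup>2 / 2) \<partial>lborel)"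
    by (simp add: nn_integral_cmult nn_integral_heat_kernel[OF t])
  also have "(\<integral>\<^sup>+x. \<integral>\<^sup>+y. ?a x y \<partial>lborel \<partial>lborel) = (\<integral>\<^sup>+y. ennreal ((cmod (w y))\<^sup>2 / 2) \<partial>lborel)"
    by (simp add: nn_integral_cmult nn_integral_heat_kernel[OF t])
  also have "(\<integral>\<^sup>+y. ennreal ((cmod (w y))\<^sup>2 / 2) \<partial>lborel) + (\<integral>\<^sup>+y. ennreal ((cmod (w y))\<^sup>2 / 2) \<partial>lborel)
      = (\<integral>\<^sup>+x. ennreal ((cmod (w x))\<^sup>2) \<partial>lborel)"
    by (subst nn_integral_add[symmetric]) (auto simp flip: ennreal_plus)
  finally show ?thesis .
qed

text \<open>The inequality is enough for all later estimates. A factor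
  \<open>exp (- c * |\<xi>|^2)\<close> makes \<open>|FT w|^2\<close> integrable; two uses of the
  multiplication formula turn its integral into a double integral of \<open>w x\<close>,
  \<open>w y\<close> and a heat kernel, where Schur's test gives a bound free of \<open>c\<close>.
  Fatou then removes the factor.\<close>

lemma plancherel_le:
  fixes w :: "'a::euclidean_space \<Rightarrow> complex"
  assumes w: "integrable lborel w"
  shows "(\<integral>\<^sup>+\<xi>. ennreal ((cmod (FT w \<xi>))\<^sup>2) \<partial>lborel) \<le> ennreal ((2 * pi) ^ DIM('a)) * (\<integral>\<^sup>+x. ennreal ((cmod (w x))\<^sup>2) \<partial>lborel)"
proof -
  have [measurable]: "w \<in> borel_measurable borel"
    using borel_measurable_integrable[OF w] by simp
  define I where "I = (LINT x|lborel. cmod (w x))"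
  define K where "K = (2 * pi) ^ DIM('a)"
  have K: "K > 0" by (simp add: K_def)
  let ?e = "\<lambda>c \<xi>. exp (- c * (norm (\<xi>::'a))\<^sup>2)"
  have bound: "(\<integral>\<^sup>+\<xi>. ennreal ((cmod (FT w \<xi>))\<^sup>2 * ?e c \<xi>) \<partial>lborel)
      \<le> ennreal K * (\<integral>\<^sup>+x. ennreal ((cmod (w x))\<^sup>2) \<partial>lborel)" if c: "c > 0" for c
  proof -
    let ?g = "\<lambda>\<xi>. cnj (FT w \<xi>) * complex_of_real (?e c \<xi>)"
    have g: "integrable lborel ?g"
    proof (rule Bochner_Integration.integrable_bound)
      show "integrable lborel (\<lambda>\<xi>. I * ?e c \<xi>)"
        by (intro integrable_mult_right integrable_exp_square c)
      show "AE \<xi> in lborel. norm (?g \<xi>) \<le> norm (I * ?e c \<xi>)"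
        using norm_FT_le[of w] by (auto simp: norm_mult I_def abs_mult intro!: mult_right_mono AE_I2 order.trans[OF _ abs_ge_self])
    qed measurable
    \<comment> \<open>Conjugation turns \<open>cnj (FT w)\<close> back into \<open>FT w\<close> and
      reverses the sign of the modulation by \<open>x\<close>, so the multiplication formula applies
      a second time.\<close>
    have FTg: "FT ?g x = cnj (LINT y|lborel. w y * complex_of_real (K * heat_kernel c (y - x)))" for x
    proof -
      have "cnj (FT ?g x) = (LINT \<xi>|lborel. cnj (?g \<xi> * iexp (\<xi> \<bullet> x)))"
        unfolding FT_def[of ?g] by (rule Bochner_Integration.integral_cnj[symmetric])
      also have "\<dots> = (LINT \<xi>|lborel. FT w \<xi> * (complex_of_real (?e c \<xi>) * iexp (\<xi> \<bullet> (- x))))"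
        by (intro Bochner_Integration.integral_cong refl) (simp add: exp_cnj)
      also have "\<dots> = (LINT y|lborel. w y * complex_of_real (K * heat_kernel c (y - x)))"
        by (subst integral_FT_mult[OF w integrable_gaussian_iexp[OF c]])
           (simp only: FT_gaussian_shift[OF c] K_def add_uminus_conv_diff)
      finally have "cnj (cnj (FT ?g x)) = cnj (LINT y|lborel. w y * complex_of_real (K * heat_kernel c (y - x)))"
        by (rule arg_cong)
      then show ?thesis by (simp only: complex_cnj_cnj)
    qed
    have "(\<integral>\<^sup>+\<xi>. ennreal ((cmod (FT w \<xi>))\<^sup>2 * ?e c \<xi>) \<partial>lborel) = (\<integral>\<^sup>+\<xi>. ennreal (cmod (FT w \<xi> * ?g \<xi>)) \<partial>lborel)"
      by (intro nn_integral_cong) (simp add: norm_mult power2_eq_square mult_ac)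
    have eq: "FT w \<xi> * ?g \<xi> = complex_of_real ((cmod (FT w \<xi>))\<^sup>2 * ?e c \<xi>)" for \<xi>
      by (simp add: complex_norm_square mult_ac del: of_real_power)
    have int: "integrable lborel (\<lambda>\<xi>. (cmod (FT w \<xi>))\<^sup>2 * ?e c \<xi>)"
    proof (rule Bochner_Integration.integrable_bound)
      show "integrable lborel (\<lambda>\<xi>. I\<^sup>2 * ?e c \<xi>)"
        by (intro integrable_mult_right integrable_exp_square c)
      show "AE \<xi> in lborel. norm ((cmod (FT w \<xi>))\<^sup>2 * ?e c \<xi>) \<le> norm (I\<^sup>2 * ?e c \<xi>)"
        using norm_FT_le[of w] by (auto simp: I_def abs_mult intro!: mult_right_mono AE_I2 power_mono)
    qed measurable
    have "(\<integral>\<^sup>+\<xi>. ennreal ((cmod (FT w \<xi>))\<^sup>2 * ?e c \<xi>) \<partial>lborel) = ennreal (LINT \<xi>|lborel. (cmod (FT w \<xi>))\<^sup>2 * ?e c \<xi>)"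
      by (rule nn_integral_eq_integral[OF int]) simp
    also have "(LINT \<xi>|lborel. (cmod (FT w \<xi>))\<^sup>2 * ?e c \<xi>) \<le> cmod (LINT \<xi>|lborel. FT w \<xi> * ?g \<xi>)"
      unfolding eq integral_complex_of_real by simp
    also have "(LINT \<xi>|lborel. FT w \<xi> * ?g \<xi>) = (LINT x|lborel. w x * FT ?g x)"
      by (rule integral_FT_mult[OF w g])
    also have "ennreal (cmod (LINT x|lborel. w x * FT ?g x)) \<le> (\<integral>\<^sup>+x. ennreal (cmod (w x * FT ?g x)) \<partial>lborel)"
      by (rule ennreal_norm_integral_le)
    also have "\<dots> \<le> (\<integral>\<^sup>+x. \<integral>\<^sup>+y. ennreal K * ennreal (cmod (w x) * cmod (w y) * heat_kernel c (y - x)) \<partial>lborel \<partial>lborel)"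
    proof (intro nn_integral_mono)
      fix x
      let ?k = "\<lambda>y. w y * complex_of_real (K * heat_kernel c (y - x))"
      have "ennreal (cmod (LINT y|lborel. ?k y)) \<le> (\<integral>\<^sup>+y. ennreal (cmod (?k y)) \<partial>lborel)"
        by (rule ennreal_norm_integral_le)
      then have "ennreal (cmod (w x)) * ennreal (cmod (LINT y|lborel. ?k y)) \<le> ennreal (cmod (w x)) * (\<integral>\<^sup>+y. ennreal (cmod (?k y)) \<partial>lborel)"
        by (rule mult_left_mono) simp
      also have "\<dots> = (\<integral>\<^sup>+y. ennreal (cmod (w x)) * ennreal (cmod (?k y)) \<partial>lborel)"
        by (simp add: nn_integral_cmult)
      also have "\<dots> = (\<integral>\<^sup>+y. ennreal K * ennreal (cmod (w x) * cmod (w y) * heat_kernel c (y - x)) \<partial>lborel)"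
      proof (intro nn_integral_cong)
        fix y
        have "0 \<le> heat_kernel c (y - x)" using heat_kernel_pos[OF c, of "y - x"] by simp
        then show "ennreal (cmod (w x)) * ennreal (cmod (?k y)) = ennreal K * ennreal (cmod (w x) * cmod (w y) * heat_kernel c (y - x))"
          using K by (simp add: norm_mult ennreal_mult mult_ac)
      qed
      finally show "ennreal (cmod (w x * FT ?g x)) \<le> (\<integral>\<^sup>+y. ennreal K * ennreal (cmod (w x) * cmod (w y) * heat_kernel c (y - x)) \<partial>lborel)"
        unfolding FTg norm_mult complex_mod_cnj by (simp add: ennreal_mult)
    qed
    also have "\<dots> = ennreal K * (\<integral>\<^sup>+x. \<integral>\<^sup>+y. ennreal (cmod (w x) * cmod (w y) * heat_kernel c (y - x)) \<partial>lborel \<partial>lborel)"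
      by (simp add: nn_integral_cmult)
    also have "\<dots> \<le> ennreal K * (\<integral>\<^sup>+x. ennreal ((cmod (w x))\<^sup>2) \<partial>lborel)"
      by (intro mult_left_mono nn_integral_convolution_le c) auto
    finally show ?thesis by (simp add: ennreal_leI)
  qed
  show ?thesis
    unfolding K_def[symmetric]
  proof (rule nn_integral_le_of_tendsto)
    show "eventually (\<lambda>n. (\<integral>\<^sup>+\<xi>. ennreal ((cmod (FT w \<xi>))\<^sup>2 * ?e (1 / real (Suc n)) \<xi>) \<partial>lborel)
      \<le> ennreal K * (\<integral>\<^sup>+x. ennreal ((cmod (w x))\<^sup>2) \<partial>lborel)) sequentially"
      by (intro always_eventually allI bound) simp
    show "AE \<xi> in lborel. (\<lambda>n. ennreal ((cmod (FT w \<xi>))\<^sup>2 * ?e (1 / real (Suc n)) \<xi>)) \<longlonglongrightarrow> ennreal ((cmod (FT w \<xi>))\<^sup>2)"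
    proof (intro AE_I2 tendsto_ennrealI)
      fix \<xi> :: 'a
      have "(\<lambda>n. (cmod (FT w \<xi>))\<^sup>2 * ?e (1 / real (Suc n)) \<xi>) \<longlonglongrightarrow> (cmod (FT w \<xi>))\<^sup>2 * exp (- 0 * (norm \<xi>)\<^sup>2)"
        by (intro tendsto_intros LIMSEQ_Suc[OF lim_1_over_n])
      then show "(\<lambda>n. (cmod (FT w \<xi>))\<^sup>2 * ?e (1 / real (Suc n)) \<xi>) \<longlonglongrightarrow> (cmod (FT w \<xi>))\<^sup>2"
        by simp
    qed
  qed measurable
qed

section \<open>Second differences and the weighted norm of a transform\<close>

lemma FT_translation:
  fixes w :: "'a::euclidean_space \<Rightarrow> complex"
  assumes [measurable]: "w \<in> borel_measurable borel"
  shows "FT (\<lambda>x. w (c + x)) \<xi> = iexp (- (c \<bullet> \<xi>)) * FT w \<xi>"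
proof -
  have "FT w \<xi> = (LINT x|lborel. w (c + x) * iexp ((c + x) \<bullet> \<xi>))"
    unfolding FT_def by (rule integral_lborel_translation[symmetric]) measurable
  also have "\<dots> = (LINT x|lborel. iexp (c \<bullet> \<xi>) * (w (c + x) * iexp (x \<bullet> \<xi>)))"
    by (intro Bochner_Integration.integral_cong refl) (simp add: inner_add_left ring_distribs exp_add mult_ac)
  also have "\<dots> = iexp (c \<bullet> \<xi>) * FT (\<lambda>x. w (c + x)) \<xi>"
    unfolding FT_def by simp
  finally have "iexp (- (c \<bullet> \<xi>)) * FT w \<xi> = (iexp (- (c \<bullet> \<xi>)) * iexp (c \<bullet> \<xi>)) * FT (\<lambda>x. w (c + x)) \<xi>"
    by (simp only: mult.assoc)
  also have "iexp (- (c \<bullet> \<xi>)) * iexp (c \<bullet> \<xi>) = 1"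
    by (simp flip: exp_add)
  finally show ?thesis by simp
qed

text \<open>The second difference quotient along \<open>b\<close> has transform \<open>(2 * cos
  (\<tau> * (b \<bullet> \<xi>)) - 2) / \<tau>\<^sup>2 * FT w \<xi>\<close>, which tends to
  \<open>- (b \<bullet> \<xi>)\<^sup>2 * FT w \<xi>\<close>. Plancherel bounds it through
  \<open>Q\<close> uniformly in \<open>\<tau>\<close>, and Fatou passes to the limit. Neither
  derivatives of \<open>w\<close> nor integration by parts occur.\<close>

lemma FT_second_difference_bound:
  fixes w :: "'a::euclidean_space \<Rightarrow> complex" and Q :: "'a \<Rightarrow> real"
  assumes w: "integrable lborel w" and [measurable]: "Q \<in> borel_measurable borel"
    and diff: "\<And>x \<tau>. 0 < \<tau> \<Longrightarrow> \<tau> \<le> 1 \<Longrightarrow> cmod (w (\<tau> *\<^sub>R b + x) + w (- \<tau> *\<^sub>R b + x) - 2 * w x) \<le> \<tau>\<^sup>2 * Q x"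
  shows "(\<integral>\<^sup>+\<xi>. ennreal ((b \<bullet> \<xi>) ^ 4 * (cmod (FT w \<xi>))\<^sup>2) \<partial>lborel) \<le> ennreal ((2 * pi) ^ DIM('a)) * (\<integral>\<^sup>+x. ennreal ((Q x)\<^sup>2) \<partial>lborel)"
proof -
  have [measurable]: "w \<in> borel_measurable borel"
    using borel_measurable_integrable[OF w] by simp
  define D where "D \<tau> x = complex_of_real (1 / \<tau>\<^sup>2) * (w (\<tau> *\<^sub>R b + x) + w (- \<tau> *\<^sub>R b + x) - 2 * w x)" for \<tau> x
  have intD: "integrable lborel (D \<tau>)" for \<tau>
    unfolding D_def
    by (intro integrable_mult_right Bochner_Integration.integrable_diff Bochner_Integration.integrable_add
        integrable_lborel_translation w)
  then have [measurable]: "D \<tau> \<in> borel_measurable borel" for \<tau>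
    using borel_measurable_integrable[OF intD] by simp
  have FTD: "FT (D \<tau>) \<xi> = complex_of_real ((2 * cos (\<tau> * (b \<bullet> \<xi>)) - 2) / \<tau>\<^sup>2) * FT w \<xi>" for \<tau> \<xi>
  proof -
    let ?i = "\<lambda>x. iexp (x \<bullet> \<xi>)"
    have 1: "integrable lborel (\<lambda>x. w (c + x) * ?i x)" for c
      by (intro integrable_mult_iexp integrable_lborel_translation w)
    have 2: "integrable lborel (\<lambda>x. w x * ?i x)"
      by (intro integrable_mult_iexp w)
    have "FT (D \<tau>) \<xi> = (LINT x|lborel. complex_of_real (1 / \<tau>\<^sup>2) * (w (\<tau> *\<^sub>R b + x) * ?i x + w (- \<tau> *\<^sub>R b + x) * ?i x - 2 * (w x * ?i x)))"
      unfolding FT_def D_def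
      by (intro Bochner_Integration.integral_cong refl) (simp add: algebra_simps)
    also have "\<dots> = complex_of_real (1 / \<tau>\<^sup>2) * (FT (\<lambda>x. w (\<tau> *\<^sub>R b + x)) \<xi> + FT (\<lambda>x. w (- \<tau> *\<^sub>R b + x)) \<xi> - 2 * FT w \<xi>)"
      unfolding FT_def
      by (simp only: Bochner_Integration.integral_mult_right_zero Bochner_Integration.integral_diff Bochner_Integration.integral_add
          1 2 integrable_mult_right Bochner_Integration.integrable_add)
    also have "\<dots> = complex_of_real (1 / \<tau>\<^sup>2) * ((iexp (- (\<tau> * (b \<bullet> \<xi>))) + iexp (\<tau> * (b \<bullet> \<xi>)) - 2) * FT w \<xi>)"
      by (subst (1 2) FT_translation) (simp_all add: ring_distribs)
    also have "iexp (- (\<tau> * (b \<bullet> \<xi>))) + iexp (\<tau> * (b \<bullet> \<xi>)) = complex_of_real (2 * cos (\<tau> * (b \<bullet> \<xi>)))"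
      unfolding cis_conv_exp[symmetric] by (simp add: complex_eq_iff)
    finally show ?thesis by (simp add: field_simps)
  qed
  show ?thesis
  proof (rule nn_integral_le_of_tendsto)
    show "eventually (\<lambda>n. (\<integral>\<^sup>+\<xi>. ennreal ((cmod (FT (D (1 / real (Suc n))) \<xi>))\<^sup>2) \<partial>lborel)
      \<le> ennreal ((2 * pi) ^ DIM('a)) * (\<integral>\<^sup>+x. ennreal ((Q x)\<^sup>2) \<partial>lborel)) sequentially"
    proof (intro always_eventually allI)
      fix n
      let ?t = "1 / real (Suc n)"
      have t: "?t > 0" "?t \<le> 1" by auto
      have D: "cmod (D ?t x) \<le> Q x" for x
      proof -
        define r where "r = ?t"
        have r: "r > 0" "r \<le> 1" using t unfolding r_def by auto
        have "cmod (D r x) = 1 / r\<^sup>2 * cmod (w (r *\<^sub>R b + x) + w (- r *\<^sub>R b + x) - 2 * w x)"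
          by (simp only: D_def norm_mult norm_of_real abs_divide abs_one abs_power2)
        also have "\<dots> \<le> 1 / r\<^sup>2 * (r\<^sup>2 * Q x)"
          by (intro mult_left_mono diff r) simp
        also have "\<dots> = Q x" using r by simp
        finally show ?thesis unfolding r_def .
      qed
      have "(\<integral>\<^sup>+\<xi>. ennreal ((cmod (FT (D ?t) \<xi>))\<^sup>2) \<partial>lborel)
        \<le> ennreal ((2 * pi) ^ DIM('a)) * (\<integral>\<^sup>+x. ennreal ((cmod (D ?t x))\<^sup>2) \<partial>lborel)"
        by (rule plancherel_le[OF intD])
      also have "\<dots> \<le> ennreal ((2 * pi) ^ DIM('a)) * (\<integral>\<^sup>+x. ennreal ((Q x)\<^sup>2) \<partial>lborel)"
        using D by (intro mult_left_mono nn_integral_mono ennreal_leI power_mono) auto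
      finally show "(\<integral>\<^sup>+\<xi>. ennreal ((cmod (FT (D ?t) \<xi>))\<^sup>2) \<partial>lborel)
        \<le> ennreal ((2 * pi) ^ DIM('a)) * (\<integral>\<^sup>+x. ennreal ((Q x)\<^sup>2) \<partial>lborel)" .
    qed
    show "AE \<xi> in lborel. (\<lambda>n. ennreal ((cmod (FT (D (1 / real (Suc n))) \<xi>))\<^sup>2)) \<longlonglongrightarrow> ennreal ((b \<bullet> \<xi>) ^ 4 * (cmod (FT w \<xi>))\<^sup>2)"
    proof (intro AE_I2 tendsto_ennrealI)
      fix \<xi> :: 'a
      define k where "k = b \<bullet> \<xi>"
      \<comment> \<open>For \<open>k \<noteq> 0\<close> the limit
        \<open>(2 * cos x - 2) / x\<^sup>2 \<rightarrow> - 1\<close> is composed with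
        \<open>x = k / (n + 1)\<close>, which avoids \<open>0\<close>.\<close>
      have lim: "(\<lambda>n. ((2 * cos (1 / real (Suc n) * k) - 2) / (1 / real (Suc n))\<^sup>2)\<^sup>2) \<longlonglongrightarrow> k ^ 4"
      proof (cases "k = 0")
        case False
        have "((\<lambda>x::real. (2 * cos x - 2) / x\<^sup>2) \<longlongrightarrow> - 1) (at 0)"
          by real_asymp
        moreover have "filterlim (\<lambda>n. 1 / real (Suc n) * k) (at 0) sequentially"
          unfolding filterlim_at
          using False tendsto_mult_right[OF LIMSEQ_Suc[OF lim_1_over_n], of k] by simp
        ultimately have "(\<lambda>n. (2 * cos (1 / real (Suc n) * k) - 2) / (1 / real (Suc n) * k)\<^sup>2) \<longlonglongrightarrow> - 1"
          by (rule filterlim_compose)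
        then have "(\<lambda>n. (k\<^sup>2 * ((2 * cos (1 / real (Suc n) * k) - 2) / (1 / real (Suc n) * k)\<^sup>2))\<^sup>2) \<longlonglongrightarrow> (k\<^sup>2 * - 1)\<^sup>2"
          by (intro tendsto_intros)
        moreover have "k\<^sup>2 * ((2 * cos (1 / real (Suc n) * k) - 2) / (1 / real (Suc n) * k)\<^sup>2)
           = (2 * cos (1 / real (Suc n) * k) - 2) / (1 / real (Suc n))\<^sup>2" for n
          unfolding power_mult_distrib using False by simp
        ultimately show ?thesis by simp
      qed simp
      have "(cmod (FT (D (1 / real (Suc n))) \<xi>))\<^sup>2
         = ((2 * cos (1 / real (Suc n) * k) - 2) / (1 / real (Suc n))\<^sup>2)\<^sup>2 * (cmod (FT w \<xi>))\<^sup>2" for n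
        unfolding FTD norm_mult norm_of_real power_mult_distrib power2_abs k_def ..
      then show "(\<lambda>n. (cmod (FT (D (1 / real (Suc n))) \<xi>))\<^sup>2) \<longlonglongrightarrow> (b \<bullet> \<xi>) ^ 4 * (cmod (FT w \<xi>))\<^sup>2"
        by (simp only: k_def[symmetric]) (intro tendsto_mult lim tendsto_const)
    qed
  qed measurable
qed

text \<open>Here \<open>s < 2\<close> enters: large frequencies are bounded by
  \<open>|\<xi>|^4\<close>, the square of a sum of \<open>N\<close> terms, hence at most
  \<open>N\<close> times the sum of their squares.\<close>

lemma norm_powr_le_sum:
  fixes \<xi> :: "'a::euclidean_space"
  assumes "0 < s" "s < 2"
  shows "norm \<xi> powr (2 * s) \<le> 1 + DIM('a) * (\<Sum>b\<in>Basis. (b \<bullet> \<xi>) ^ 4)"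
proof -
  have "norm \<xi> powr (2 * s) \<le> 1 + norm \<xi> ^ 4"
  proof (cases "norm \<xi> \<le> 1")
    case True
    then have "norm \<xi> powr (2 * s) \<le> 1"
      using assms powr_mono'[of 0 "2 * s" "norm \<xi>"] by (cases "\<xi> = 0") auto
    then show ?thesis by (simp add: add_increasing2)
  next
    case False
    then have "norm \<xi> powr (2 * s) \<le> norm \<xi> powr (real 4)"
      using assms by (intro powr_mono) auto
    also have "\<dots> = norm \<xi> ^ 4"
      using False by (subst powr_realpow) auto
    finally show ?thesis by simp
  qed
  also have "norm \<xi> ^ 4 = (\<Sum>b\<in>Basis. (b \<bullet> \<xi>)\<^sup>2)\<^sup>2"
  proof -
    have "norm \<xi> ^ 4 = ((norm \<xi>)\<^sup>2)\<^sup>2"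
      by (metis power_mult num_double numeral_times_numeral)
    then show ?thesis
      by (simp only: norm_square_eq_sum inner_commute)
  qed
  also have "\<dots> \<le> (\<Sum>b\<in>Basis. ((b \<bullet> \<xi>)\<^sup>2)\<^sup>2) * DIM('a)"
    by (rule sum_squared_le_sum_of_squares)
  finally show ?thesis by (simp add: mult.commute flip: power_mult)
qed

text \<open>In \<open>1 + N\<^sup>2\<close> the \<open>1\<close> is Plancherel for \<open>w\<close>
  itself; one factor \<open>N\<close> comes from the bound on the weight, the other from the number
  of coordinate directions.\<close>

lemma weighted_FT_bound:
  fixes w :: "'a::euclidean_space \<Rightarrow> complex" and Q :: "'a \<Rightarrow> real"
  assumes s: "0 < s" "s < 2"
    and w: "integrable lborel w" and [measurable]: "Q \<in> borel_measurable borel"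
    and le: "\<And>x. cmod (w x) \<le> Q x"
    and diff: "\<And>b x \<tau>. b \<in> Basis \<Longrightarrow> 0 < \<tau> \<Longrightarrow> \<tau> \<le> 1 \<Longrightarrow>
       cmod (w (\<tau> *\<^sub>R b + x) + w (- \<tau> *\<^sub>R b + x) - 2 * w x) \<le> \<tau>\<^sup>2 * Q x"
  shows "(\<integral>\<^sup>+\<xi>. ennreal (norm \<xi> powr (2 * s) * (cmod (FT w \<xi>))\<^sup>2) \<partial>lborel)
     \<le> ennreal ((2 * pi) ^ DIM('a) * (1 + (real DIM('a))\<^sup>2)) * (\<integral>\<^sup>+x. ennreal ((Q x)\<^sup>2) \<partial>lborel)"
proof -
  have [measurable]: "w \<in> borel_measurable borel"
    using borel_measurable_integrable[OF w] by simp
  define K where "K = (2 * pi) ^ DIM('a)"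
  define I where "I = (\<integral>\<^sup>+x. ennreal ((Q x)\<^sup>2) \<partial>lborel)"
  define N where "N = real DIM('a)"
  have K: "K > 0" "N > 0" by (auto simp: K_def N_def)
  have "(\<integral>\<^sup>+\<xi>. ennreal (norm \<xi> powr (2 * s) * (cmod (FT w \<xi>))\<^sup>2) \<partial>lborel)
    \<le> (\<integral>\<^sup>+\<xi>. ennreal ((cmod (FT w \<xi>))\<^sup>2) + ennreal N * (\<Sum>b\<in>Basis. ennreal ((b \<bullet> \<xi>) ^ 4 * (cmod (FT w \<xi>))\<^sup>2)) \<partial>lborel)"
  proof (intro nn_integral_mono)
    fix \<xi> :: 'a
    have "norm \<xi> powr (2 * s) * (cmod (FT w \<xi>))\<^sup>2 \<le> (1 + N * (\<Sum>b\<in>Basis. (b \<bullet> \<xi>) ^ 4)) * (cmod (FT w \<xi>))\<^sup>2"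
      unfolding N_def by (intro mult_right_mono norm_powr_le_sum s) auto
    also have "\<dots> = (cmod (FT w \<xi>))\<^sup>2 + N * (\<Sum>b\<in>Basis. (b \<bullet> \<xi>) ^ 4 * (cmod (FT w \<xi>))\<^sup>2)"
      by (simp add: algebra_simps sum_distrib_left)
    also have "ennreal \<dots> = ennreal ((cmod (FT w \<xi>))\<^sup>2) + ennreal N * (\<Sum>b\<in>Basis. ennreal ((b \<bullet> \<xi>) ^ 4 * (cmod (FT w \<xi>))\<^sup>2))"
    proof -
      have "(\<Sum>b\<in>Basis. ennreal ((b \<bullet> \<xi>) ^ 4 * (cmod (FT w \<xi>))\<^sup>2)) = ennreal (\<Sum>b\<in>Basis. (b \<bullet> \<xi>) ^ 4 * (cmod (FT w \<xi>))\<^sup>2)"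
        by (rule sum_ennreal) simp
      moreover have "0 \<le> (\<Sum>b\<in>Basis. (b \<bullet> \<xi>) ^ 4 * (cmod (FT w \<xi>))\<^sup>2)"
        by (intro sum_nonneg) simp
      ultimately show ?thesis
        using K by (simp only: ennreal_plus ennreal_mult less_imp_le zero_le_power2 mult_nonneg_nonneg)
    qed
    finally show "ennreal (norm \<xi> powr (2 * s) * (cmod (FT w \<xi>))\<^sup>2)
       \<le> ennreal ((cmod (FT w \<xi>))\<^sup>2) + ennreal N * (\<Sum>b\<in>Basis. ennreal ((b \<bullet> \<xi>) ^ 4 * (cmod (FT w \<xi>))\<^sup>2))"
      by (simp add: ennreal_leI)
  qed
  also have "\<dots> = (\<integral>\<^sup>+\<xi>. ennreal ((cmod (FT w \<xi>))\<^sup>2) \<partial>lborel)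
     + ennreal N * (\<Sum>b\<in>Basis. \<integral>\<^sup>+\<xi>. ennreal ((b \<bullet> \<xi>) ^ 4 * (cmod (FT w \<xi>))\<^sup>2) \<partial>lborel)"
    by (simp add: nn_integral_add nn_integral_cmult nn_integral_sum del: sum_ennreal)
  also have "\<dots> \<le> ennreal K * I + ennreal N * (\<Sum>b\<in>(Basis::'a set). ennreal K * I)"
  proof (intro add_mono mult_left_mono sum_mono)
    have "(\<integral>\<^sup>+\<xi>. ennreal ((cmod (FT w \<xi>))\<^sup>2) \<partial>lborel) \<le> ennreal K * (\<integral>\<^sup>+x. ennreal ((cmod (w x))\<^sup>2) \<partial>lborel)"
      unfolding K_def by (rule plancherel_le[OF w])
    also have "\<dots> \<le> ennreal K * I"
      unfolding I_def using le by (intro mult_left_mono nn_integral_mono ennreal_leI power_mono) auto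
    finally show "(\<integral>\<^sup>+\<xi>. ennreal ((cmod (FT w \<xi>))\<^sup>2) \<partial>lborel) \<le> ennreal K * I" .
    show "(\<integral>\<^sup>+\<xi>. ennreal ((b \<bullet> \<xi>) ^ 4 * (cmod (FT w \<xi>))\<^sup>2) \<partial>lborel) \<le> ennreal K * I" if "b \<in> Basis" for b
      unfolding K_def I_def by (rule FT_second_difference_bound[OF w _ diff[OF that]]) auto
  qed auto
  also have "\<dots> = ennreal (K * (1 + N\<^sup>2)) * I"
  proof -
    have "(\<Sum>b\<in>(Basis::'a set). ennreal K * I) = ennreal N * (ennreal K * I)"
      by (simp add: N_def ennreal_of_nat_eq_real_of_nat)
    then have "ennreal K * I + ennreal N * (\<Sum>b\<in>(Basis::'a set). ennreal K * I) = (ennreal K + ennreal N * (ennreal N * ennreal K)) * I"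
      by (simp add: distrib_right distrib_left mult_ac)
    also have "ennreal K + ennreal N * (ennreal N * ennreal K) = ennreal (K * (1 + N\<^sup>2))"
      using K by (simp add: ennreal_mult[symmetric] ennreal_plus[symmetric] power2_eq_square algebra_simps del: ennreal_plus)
    finally show ?thesis .
  qed
  finally show ?thesis unfolding K_def I_def N_def .
qed

section \<open>Gamma integrals and the singular weight at low frequencies\<close>

lemma nn_integral_powr_exp:
  assumes s: "s > 0" and r: "r > 0"
  shows "(\<integral>\<^sup>+t. ennreal (indicator {0..} t * t powr (s - 1) * exp (- t * r)) \<partial>lborel) = ennreal (Gamma s * r powr (- s))"
proof -
  have "ennreal (Gamma s) = (\<integral>\<^sup>+t. ennreal (indicator {0..} t * t powr (s - 1) / exp t) \<partial>lborel)"
    by (rule Gamma_conv_nn_integral_real[OF s])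
  also have "\<dots> = ennreal \<bar>r\<bar> * (\<integral>\<^sup>+t. ennreal (indicator {0..} (0 + r * t) * (0 + r * t) powr (s - 1) / exp (0 + r * t)) \<partial>lborel)"
    by (rule nn_integral_real_affine) (use r in auto)
  also have "(\<lambda>t. ennreal (indicator {0..} (0 + r * t) * (0 + r * t) powr (s - 1) / exp (0 + r * t)))
     = (\<lambda>t. ennreal (r powr (s - 1)) * ennreal (indicator {0..} t * t powr (s - 1) * exp (- t * r)))"
  proof
    fix t :: real
    have "indicator {0..} (0 + r * t) * (0 + r * t) powr (s - 1) / exp (0 + r * t) = r powr (s - 1) * (indicator {0..} t * t powr (s - 1) * exp (- t * r))"
      using r by (auto simp: indicator_def zero_le_mult_iff powr_mult exp_minus field_simps)
    then show "ennreal (indicator {0..} (0 + r * t) * (0 + r * t) powr (s - 1) / exp (0 + r * t)) = ennreal (r powr (s - 1)) * ennreal (indicator {0..} t * t powr (s - 1) * exp (- t * r))"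
      by (simp add: ennreal_mult)
  qed
  also have "ennreal \<bar>r\<bar> * (\<integral>\<^sup>+t. ennreal (r powr (s - 1)) * ennreal (indicator {0..} t * t powr (s - 1) * exp (- t * r)) \<partial>lborel)
    = ennreal (r powr s) * (\<integral>\<^sup>+t. ennreal (indicator {0..} t * t powr (s - 1) * exp (- t * r)) \<partial>lborel)"
  proof -
    have "ennreal \<bar>r\<bar> * ennreal (r powr (s - 1)) = ennreal (r powr s)"
      using r by (simp add: powr_diff flip: ennreal_mult)
    then show ?thesis by (simp add: nn_integral_cmult mult.assoc[symmetric])
  qed
  finally have *: "ennreal (Gamma s) = ennreal (r powr s) * (\<integral>\<^sup>+t. ennreal (indicator {0..} t * t powr (s - 1) * exp (- t * r)) \<partial>lborel)" .
  have "ennreal (Gamma s * r powr (- s)) = ennreal (r powr (- s)) * ennreal (Gamma s)"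
    using s by (simp add: ennreal_mult Gamma_real_pos less_imp_le mult.commute)
  also have "\<dots> = ennreal (r powr (- s) * r powr s) * (\<integral>\<^sup>+t. ennreal (indicator {0..} t * t powr (s - 1) * exp (- t * r)) \<partial>lborel)"
    unfolding * by (simp add: ennreal_mult mult.assoc)
  also have "r powr (- s) * r powr s = 1"
    using r by (simp flip: powr_add)
  finally show ?thesis by simp
qed

text \<open>Writing \<open>|\<xi>| powr (- 2 * s)\<close> as a Gamma integral avoids polar
  coordinates. After Fubini the frequency integral is \<open>(pi / (t + c)) powr (N / 2)\<close>;
  what remains behaves like \<open>t powr (s - 1)\<close> at zero and
  \<open>t powr (s - 1 - N / 2)\<close> at infinity, integrable because \<open>0 < s\<close> and
  \<open>2 * s < N\<close>.\<close>

lemma nn_integral_singular_gaussian: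
  assumes s: "0 < s" "2 * s < real DIM('a)" and c: "c > 0"
  shows "(\<integral>\<^sup>+\<xi>. ennreal (norm (\<xi>::'a::euclidean_space) powr (- 2 * s) * exp (- c * (norm \<xi>)\<^sup>2)) \<partial>lborel) < \<infinity>"
proof -
  define N where "N = real DIM('a)"
  let ?i = "\<lambda>t. indicator {0..} t * t powr (s - 1) :: real"
  let ?A = "\<lambda>t. indicator {0..1} t * t powr (s - 1) :: real"
  let ?B = "\<lambda>t. indicator {1..} t * t powr (s - 1 - N / 2) :: real"
  have G: "Gamma s > 0" using s by (simp add: Gamma_real_pos)
  have A: "(\<integral>\<^sup>+t. ennreal (?A t) \<partial>lborel) < \<infinity>"
    using nn_integral_has_integral_lebesgue[OF _ has_integral_powr_from_0[of "s - 1" 1]] s by simp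
  have B: "(\<integral>\<^sup>+t. ennreal (?B t) \<partial>lborel) < \<infinity>"
    using nn_integral_has_integral_lebesgue[OF _ has_integral_powr_to_inf[of "s - 1 - N / 2" 1]] s by (simp add: N_def)
  have "ennreal (Gamma s) * (\<integral>\<^sup>+\<xi>. ennreal (norm (\<xi>::'a) powr (- 2 * s) * exp (- c * (norm \<xi>)\<^sup>2)) \<partial>lborel)
     = (\<integral>\<^sup>+\<xi>. ennreal (Gamma s) * ennreal (norm (\<xi>::'a) powr (- 2 * s) * exp (- c * (norm \<xi>)\<^sup>2)) \<partial>lborel)"
    by (simp add: nn_integral_cmult)
  also have "\<dots> \<le> (\<integral>\<^sup>+\<xi>. \<integral>\<^sup>+t. ennreal (?i t * exp (- (t + c) * (norm (\<xi>::'a))\<^sup>2)) \<partial>lborel \<partial>lborel)"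
  proof (rule nn_integral_mono)
    fix \<xi> :: 'a
    show "ennreal (Gamma s) * ennreal (norm \<xi> powr (- 2 * s) * exp (- c * (norm \<xi>)\<^sup>2)) \<le> (\<integral>\<^sup>+t. ennreal (?i t * exp (- (t + c) * (norm \<xi>)\<^sup>2)) \<partial>lborel)"
    \<comment> \<open>At the origin the left side is zero because \<open>0 powr _\<close> is
      zero.\<close>
    proof (cases "\<xi> = 0")
      case False
      have "norm \<xi> powr (- 2 * s) = ((norm \<xi>)\<^sup>2) powr (- s)"
      proof -
        have "(norm \<xi>)\<^sup>2 = norm \<xi> powr real 2"
          using False by (intro powr_realpow[symmetric]) simp
        then have "((norm \<xi>)\<^sup>2) powr (- s) = norm \<xi> powr (real 2 * - s)"
          by (simp only: powr_powr)
        then show ?thesis by simp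
      qed
      then have "ennreal (Gamma s) * ennreal (norm \<xi> powr (- 2 * s) * exp (- c * (norm \<xi>)\<^sup>2))
          = ennreal (exp (- c * (norm \<xi>)\<^sup>2)) * ennreal (Gamma s * ((norm \<xi>)\<^sup>2) powr (- s))"
        using G by (simp add: ennreal_mult[symmetric] mult_ac)
      also have "\<dots> = ennreal (exp (- c * (norm \<xi>)\<^sup>2)) * (\<integral>\<^sup>+t. ennreal (?i t * exp (- t * (norm \<xi>)\<^sup>2)) \<partial>lborel)"
        using False s by (subst nn_integral_powr_exp) auto
      also have "\<dots> = (\<integral>\<^sup>+t. ennreal (exp (- c * (norm \<xi>)\<^sup>2)) * ennreal (?i t * exp (- t * (norm \<xi>)\<^sup>2)) \<partial>lborel)"
        by (rule nn_integral_cmult[symmetric]) measurable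
      also have "\<dots> = (\<integral>\<^sup>+t. ennreal (?i t * exp (- (t + c) * (norm \<xi>)\<^sup>2)) \<partial>lborel)"
      proof (intro nn_integral_cong)
        fix t :: real
        have "exp (- (t + c) * (norm \<xi>)\<^sup>2) = exp (- c * (norm \<xi>)\<^sup>2) * exp (- t * (norm \<xi>)\<^sup>2)"
          by (simp add: algebra_simps flip: exp_add)
        then show "ennreal (exp (- c * (norm \<xi>)\<^sup>2)) * ennreal (?i t * exp (- t * (norm \<xi>)\<^sup>2)) = ennreal (?i t * exp (- (t + c) * (norm \<xi>)\<^sup>2))"
          by (simp only: mult_ac ennreal_mult[symmetric] exp_ge_zero zero_le_mult_iff indicator_pos_le powr_ge_zero simp_thms)
      qed
      finally show ?thesis by simp
    qed simp
  qed
  also have "\<dots> = (\<integral>\<^sup>+t. \<integral>\<^sup>+\<xi>. ennreal (?i t * exp (- (t + c) * (norm (\<xi>::'a))\<^sup>2)) \<partial>lborel \<partial>lborel)"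
    by (rule lborel_pair.Fubini') measurable
  also have "\<dots> \<le> (\<integral>\<^sup>+t. ennreal ((pi / c) powr (N / 2)) * ennreal (?A t) + ennreal (pi powr (N / 2)) * ennreal (?B t) \<partial>lborel)"
  proof (rule nn_integral_mono)
    fix t :: real
    show "(\<integral>\<^sup>+\<xi>. ennreal (?i t * exp (- (t + c) * (norm (\<xi>::'a))\<^sup>2)) \<partial>lborel)
      \<le> ennreal ((pi / c) powr (N / 2)) * ennreal (?A t) + ennreal (pi powr (N / 2)) * ennreal (?B t)"
    proof (cases "t \<ge> 0")
      case True
      have tc: "t + c > 0" using True c by simp
      have "(\<integral>\<^sup>+\<xi>. ennreal (?i t * exp (- (t + c) * (norm (\<xi>::'a))\<^sup>2)) \<partial>lborel) = ennreal (?i t) * (\<integral>\<^sup>+\<xi>. ennreal (exp (- (t + c) * (norm (\<xi>::'a))\<^sup>2)) \<partial>lborel)"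
        by (simp add: ennreal_mult nn_integral_cmult)
      also have "(\<integral>\<^sup>+\<xi>. ennreal (exp (- (t + c) * (norm (\<xi>::'a))\<^sup>2)) \<partial>lborel) = ennreal ((pi / (t + c)) powr (N / 2))"
        by (subst nn_integral_eq_integral[OF integrable_exp_square[OF tc]])
           (simp_all only: integral_exp_square[OF tc] N_def exp_ge_zero AE_I2)
      also have "ennreal (?i t) * \<dots> = ennreal (t powr (s - 1) * (pi / (t + c)) powr (N / 2))"
        using True by (simp add: ennreal_mult)
      also have "\<dots> \<le> ennreal ((pi / c) powr (N / 2) * ?A t + pi powr (N / 2) * ?B t)"
      proof (rule ennreal_leI)
        show "t powr (s - 1) * (pi / (t + c)) powr (N / 2) \<le> (pi / c) powr (N / 2) * ?A t + pi powr (N / 2) * ?B t"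
        proof (cases "t \<le> 1")
          case True
          have "(pi / (t + c)) powr (N / 2) \<le> (pi / c) powr (N / 2)"
            using \<open>t \<ge> 0\<close> c by (intro powr_mono2) (auto simp: N_def field_simps)
          then have "t powr (s - 1) * (pi / (t + c)) powr (N / 2) \<le> t powr (s - 1) * (pi / c) powr (N / 2)"
            by (rule mult_left_mono) simp
          then show ?thesis using True \<open>t \<ge> 0\<close>
            by (auto simp: indicator_def mult.commute intro: order.trans)
        next
          case False
          have "(pi / (t + c)) powr (N / 2) \<le> (pi / t) powr (N / 2)"
            using False c by (intro powr_mono2) (auto simp: N_def field_simps)
          also have "\<dots> = pi powr (N / 2) * t powr (- (N / 2))"
            by (simp only: powr_divide powr_minus) (simp only: divide_inverse)
          finally have "t powr (s - 1) * (pi / (t + c)) powr (N / 2) \<le> t powr (s - 1) * (pi powr (N / 2) * t powr (- (N / 2)))"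
            by (rule mult_left_mono) simp
          also have "\<dots> = pi powr (N / 2) * t powr (s - 1 - N / 2)"
            using False powr_add[of t "s - 1" "- (N / 2)"] by simp
          finally show ?thesis using False by (simp add: indicator_def)
        qed
      qed
      also have "\<dots> = ennreal ((pi / c) powr (N / 2)) * ennreal (?A t) + ennreal (pi powr (N / 2)) * ennreal (?B t)"
        by (simp add: ennreal_mult)
      finally show ?thesis .
    qed simp
  qed
  also have "\<dots> = ennreal ((pi / c) powr (N / 2)) * (\<integral>\<^sup>+t. ennreal (?A t) \<partial>lborel) + ennreal (pi powr (N / 2)) * (\<integral>\<^sup>+t. ennreal (?B t) \<partial>lborel)"
    by (simp add: nn_integral_add nn_integral_cmult)
  also have "\<dots> < \<infinity>"
    using A B by (simp add: ennreal_mult_less_top)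
  finally show ?thesis
    using G by (auto simp: ennreal_mult_less_top)
qed

section \<open>Approximate identities and uniqueness of the Fourier transform\<close>

text \<open>Half of the exponent is spent on the decay factor; the other half is a heat kernel at
  time \<open>2 * t\<close>, whose mass is one. The power of two corrects the normalisation.\<close>

lemma heat_kernel_tail:
  fixes z :: "'a::euclidean_space"
  assumes t: "t > 0" and z: "norm z \<ge> \<delta>" and \<delta>: "\<delta> > 0"
  shows "heat_kernel t z \<le> 2 powr (real DIM('a) / 2) * exp (- \<delta>\<^sup>2 / (8 * t)) * heat_kernel (2 * t) z"
proof -
  have "\<delta>\<^sup>2 \<le> (norm z)\<^sup>2"
    using z \<delta> by (intro power_mono) auto
  then have "- (norm z)\<^sup>2 / (4 * t) \<le> - \<delta>\<^sup>2 / (8 * t) + - (norm z)\<^sup>2 / (8 * t)"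
    using t by (simp add: divide_simps)
  then have "exp (- (norm z)\<^sup>2 / (4 * t)) \<le> exp (- \<delta>\<^sup>2 / (8 * t)) * exp (- (norm z)\<^sup>2 / (8 * t))"
    by (simp only: exp_add[symmetric] exp_le_cancel_iff)
  then have "heat_kernel t z \<le> (4 * pi * t) powr (- (real DIM('a) / 2)) * (exp (- \<delta>\<^sup>2 / (8 * t)) * exp (- (norm z)\<^sup>2 / (8 * t)))"
    unfolding heat_kernel_def by (rule mult_left_mono) simp
  also have "(4 * pi * t) powr (- (real DIM('a) / 2)) = 2 powr (real DIM('a) / 2) * (4 * pi * (2 * t)) powr (- (real DIM('a) / 2))"
  proof -
    have "(4 * pi * (2 * t)) powr (- (real DIM('a) / 2)) = 2 powr (- (real DIM('a) / 2)) * (4 * pi * t) powr (- (real DIM('a) / 2))"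
      using t by (subst powr_mult[symmetric]) (auto simp: mult_ac)
    then show ?thesis by (simp add: powr_minus)
  qed
  finally show ?thesis
    by (simp add: heat_kernel_def mult_ac)
qed

lemma heat_kernel_translate:
  fixes x :: "'a::euclidean_space"
  assumes "t > 0"
  shows "integrable lborel (\<lambda>y. heat_kernel t (y - x))" "(LINT y|lborel. heat_kernel t (y - x)) = 1"
proof -
  have "integrable lborel (\<lambda>y. heat_kernel t (- x + y))"
    by (intro integrable_lborel_translation heat_kernel_integral assms)
  then show "integrable lborel (\<lambda>y. heat_kernel t (y - x))" by simp
  have "(LINT y|lborel. heat_kernel t (- x + y)) = (LINT y|lborel. heat_kernel t (y::'a))"
    by (rule integral_lborel_translation) measurable
  then show "(LINT y|lborel. heat_kernel t (y - x)) = 1"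
    using heat_kernel_integral(2)[OF assms, where 'a='a] by simp
qed

text \<open>Continuity is asked for only at the point \<open>x\<close>, so that the result applies
  to the indicator of a box off its frontier as well as to test functions.\<close>

lemma heat_convolution_tendsto:
  fixes h :: "'a::euclidean_space \<Rightarrow> real"
  assumes [measurable]: "h \<in> borel_measurable borel" and M: "\<And>y. \<bar>h y\<bar> \<le> M" and cont: "isCont h x"
  shows "(\<lambda>n. LINT y|lborel. heat_kernel (1 / real (Suc n)) (y - x) * h y) \<longlonglongrightarrow> h x"
proof (rule LIMSEQ_I)
  fix e :: real assume e: "e > 0"
  obtain \<delta> where \<delta>: "\<delta> > 0" "\<And>y. norm (y - x) < \<delta> \<Longrightarrow> \<bar>h y - h x\<bar> < e / 2"
    using cont[unfolded continuous_at_eps_delta] e half_gt_zero[OF e] by (fastforce simp: dist_norm)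
  \<comment> \<open>\<open>2 * M\<close> bounds \<open>|h y - h x|\<close>, and the power of two is
    the one from the tail estimate of the kernel.\<close>
  define C where "C = 2 * M * 2 powr (real DIM('a) / 2)"
  have M0: "M \<ge> 0" using M[of x] by simp
  have "(\<lambda>n. C * exp (- \<delta>\<^sup>2 / (8 * (1 / real (Suc n))))) \<longlonglongrightarrow> 0"
  proof (cases "C > 0")
    case True
    then show ?thesis using \<delta>(1) by real_asymp
  next
    case False
    then have "C = 0" using M0 by (simp add: C_def zero_less_mult_iff)
    then show ?thesis by simp
  qed
  then obtain n0 where n0: "\<And>n. n \<ge> n0 \<Longrightarrow> \<bar>C * exp (- \<delta>\<^sup>2 / (8 * (1 / real (Suc n))))\<bar> < e / 2"
    using e by (metis (no_types, lifting) LIMSEQ_D diff_zero half_gt_zero real_norm_def)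
  have "norm ((LINT y|lborel. heat_kernel (1 / real (Suc n)) (y - x) * h y) - h x) < e" if "n \<ge> n0" for n
  proof -
    define t where "t = 1 / real (Suc n)"
    have t: "t > 0" by (simp add: t_def)
    let ?H = "\<lambda>y. heat_kernel t (y - x)"
    have H0: "?H y \<ge> 0" "heat_kernel (2 * t) (y - x) \<ge> 0" for y
      using heat_kernel_pos[OF t, of "y - x"] heat_kernel_pos[of "2 * t" "y - x"] t by auto
    note int = heat_kernel_translate[of _ x]
    have t2: "2 * t > 0" using t by simp
    have int_h: "integrable lborel (\<lambda>y. ?H y * h y)"
    proof (rule Bochner_Integration.integrable_bound)
      show "integrable lborel (\<lambda>y. M * ?H y)" by (intro integrable_mult_right int t)
      show "AE y in lborel. norm (?H y * h y) \<le> norm (M * ?H y)"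
        using M M0 H0 by (intro AE_I2) (auto simp: abs_mult mult.commute[of M] intro!: mult_left_mono)
    qed measurable
    have "(LINT y|lborel. ?H y * h y) - h x = (LINT y|lborel. ?H y * h y) - (LINT y|lborel. ?H y * h x)"
      by (simp add: int[OF t])
    also have "\<dots> = (LINT y|lborel. ?H y * (h y - h x))"
      unfolding right_diff_distrib
      by (rule Bochner_Integration.integral_diff[symmetric]) (use int_h int[OF t] in auto)
    finally have eq: "(LINT y|lborel. ?H y * h y) - h x = (LINT y|lborel. ?H y * (h y - h x))" .
    have "norm (LINT y|lborel. ?H y * (h y - h x)) \<le> (LINT y|lborel. e / 2 * ?H y + C * exp (- \<delta>\<^sup>2 / (8 * t)) * heat_kernel (2 * t) (y - x))"
    proof (rule Bochner_Integration.integral_norm_bound_integral)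
      show "integrable lborel (\<lambda>y. ?H y * (h y - h x))"
        unfolding right_diff_distrib using int_h int[OF t] by auto
      show "integrable lborel (\<lambda>y. e / 2 * ?H y + C * exp (- \<delta>\<^sup>2 / (8 * t)) * heat_kernel (2 * t) (y - x))"
        by (intro Bochner_Integration.integrable_add integrable_mult_right int t t2)
      fix y
      show "norm (?H y * (h y - h x)) \<le> e / 2 * ?H y + C * exp (- \<delta>\<^sup>2 / (8 * t)) * heat_kernel (2 * t) (y - x)"
      proof (cases "norm (y - x) < \<delta>")
        case True
        have "norm (?H y * (h y - h x)) \<le> ?H y * (e / 2)"
        proof -
          have "norm (?H y * (h y - h x)) = ?H y * \<bar>h y - h x\<bar>" using H0[of y] by (simp add: abs_mult)
          also have "\<dots> \<le> ?H y * (e / 2)" by (intro mult_left_mono less_imp_le \<delta>(2) True H0)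
          finally show ?thesis .
        qed
        moreover have "0 \<le> C * exp (- \<delta>\<^sup>2 / (8 * t)) * heat_kernel (2 * t) (y - x)"
          using M0 H0[of y] by (intro mult_nonneg_nonneg) (auto simp: C_def)
        ultimately show ?thesis by (simp add: mult.commute)
      next
        case False
        have "\<bar>h y - h x\<bar> \<le> 2 * M" using M[of x] M[of y] by linarith
        then have "norm (?H y * (h y - h x)) \<le> ?H y * (2 * M)"
          using H0[of y] by (auto simp: abs_mult intro!: mult_left_mono)
        also have "\<dots> \<le> (2 powr (real DIM('a) / 2) * exp (- \<delta>\<^sup>2 / (8 * t)) * heat_kernel (2 * t) (y - x)) * (2 * M)"
          using False \<delta>(1) M0 by (intro mult_right_mono heat_kernel_tail t) auto
        also have "\<dots> = C * exp (- \<delta>\<^sup>2 / (8 * t)) * heat_kernel (2 * t) (y - x)"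
          by (simp add: C_def mult_ac)
        finally show ?thesis using e H0[of y] by (smt (verit) mult_nonneg_nonneg divide_nonneg_nonneg)
      qed
    qed
    also have "\<dots> = e / 2 + C * exp (- \<delta>\<^sup>2 / (8 * t))"
      using int[OF t] int[OF t2] by simp
    also have "\<dots> < e"
      using n0[OF that] unfolding t_def[symmetric] by linarith
    finally show ?thesis unfolding t_def[symmetric] eq .
  qed
  then show "\<exists>n0. \<forall>n\<ge>n0. norm ((LINT y|lborel. heat_kernel (1 / real (Suc n)) (y - x) * h y) - h x) < e"
    by blast
qed

section \<open>Injectivity of the Fourier transform on integrable functions\<close>

lemma AE_lborel_if_not_negligible:
  assumes "negligible N" "\<And>x. x \<notin> N \<Longrightarrow> P x"
  shows "AE x in lborel. P (x::'a::euclidean_space)"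
proof -
  have "N \<in> null_sets lebesgue"
    using assms(1) by (simp add: negligible_iff_null_sets)
  then have "AE x in lebesgue. P x"
    using assms(2) by (intro AE_I'[of N]) auto
  then show ?thesis by (simp add: AE_completion_iff)
qed

text \<open>Lebesgue differentiation: off a null set \<open>f x\<close> is the limit of averages
  over cubes with corner \<open>x\<close>.\<close>

lemma AE_zero_if_box_integrals_zero:
  fixes f :: "'a::euclidean_space \<Rightarrow> complex"
  assumes f: "integrable lborel f"
    and zero: "\<And>a b. (LINT x|lborel. f x * complex_of_real (indicator (cbox a b) x)) = 0"
  shows "AE x in lborel. f x = 0"
proof -
  have int: "set_integrable lborel (cbox a b) f" for a b
    unfolding set_integrable_def
    by (rule Bochner_Integration.integrable_bound[OF f]) (use borel_measurable_integrable[OF f] in \<open>auto simp: indicator_def\<close>)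
  have I: "integral (cbox a b) f = 0" for a b
  proof -
    have "integral (cbox a b) f = (LINT x:cbox a b|lborel. f x)"
      using set_borel_integral_eq_integral(2)[OF int] by simp
    also have "\<dots> = (LINT x|lborel. f x * complex_of_real (indicator (cbox a b) x))"
      unfolding set_lebesgue_integral_def
      by (intro Bochner_Integration.integral_cong refl) (simp add: scaleR_conv_of_real mult.commute)
    finally show ?thesis using zero by simp
  qed
  have "f integrable_on cbox a b" for a b
    using set_borel_integral_eq_integral(1)[OF int] .
  then obtain N where N: "negligible N"
    "\<And>x e. \<lbrakk>x \<notin> N; 0 < e\<rbrakk> \<Longrightarrow> \<exists>d>0. \<forall>h. 0 < h \<and> h < d \<longrightarrow>
       norm (integral (cbox x (x + h *\<^sub>R One)) f /\<^sub>R h ^ DIM('a) - f x) < e"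
    using integrable_ccontinuous_explicit[of f] by blast
  show ?thesis
  proof (rule AE_lborel_if_not_negligible[OF N(1)])
    fix x assume x: "x \<notin> N"
    have "norm (f x) < e" if e: "e > 0" for e
    proof -
      obtain d where "d > 0" "\<forall>h. 0 < h \<and> h < d \<longrightarrow> norm (integral (cbox x (x + h *\<^sub>R One)) f /\<^sub>R h ^ DIM('a) - f x) < e"
        using N(2)[OF x e] by blast
      then show ?thesis using I by (auto dest!: spec[of _ "d / 2"])
    qed
    then show "f x = 0" by (metis less_irrefl zero_less_norm_iff)
  qed
qed

text \<open>By the multiplication formula \<open>f\<close> is orthogonal to all translated heat
  kernels, hence to their integrals over a box. These form the heat flow of the indicator of the
  box, bounded by one and convergent off its frontier, so dominated convergence makes the box
  integrals of \<open>f\<close> vanish.\<close>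

lemma FT_eq_zero_imp_AE_zero:
  fixes f :: "'a::euclidean_space \<Rightarrow> complex"
  assumes f: "integrable lborel f" and zero: "\<And>x. FT f x = 0"
  shows "AE x in lborel. f x = 0"
proof (rule AE_zero_if_box_integrals_zero[OF f])
  have [measurable]: "f \<in> borel_measurable borel"
    using borel_measurable_integrable[OF f] by simp
  fix a b :: 'a
  let ?B = "cbox a b"
  define h where "h n x = (LINT y|lborel. heat_kernel (1 / real (Suc n)) (y - x) * indicator ?B y)" for n and x :: 'a
  have conv0: "(LINT x|lborel. f x * complex_of_real (heat_kernel c (x - y))) = 0" if "c > 0" for c y
  proof -
    have "0 = (LINT x|lborel. f x * FT (\<lambda>\<xi>. complex_of_real (exp (- c * (norm \<xi>)\<^sup>2)) * iexp (\<xi> \<bullet> (- y))) x)"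
      by (subst integral_FT_mult[symmetric, OF f integrable_gaussian_iexp[OF that]]) (simp add: zero)
    also have "\<dots> = (LINT x|lborel. complex_of_real ((2 * pi) ^ DIM('a)) * (f x * complex_of_real (heat_kernel c (x - y))))"
      unfolding FT_gaussian_shift[OF that] by (intro Bochner_Integration.integral_cong refl) (simp add: mult_ac)
    also have "\<dots> = complex_of_real ((2 * pi) ^ DIM('a)) * (LINT x|lborel. f x * complex_of_real (heat_kernel c (x - y)))"
      by (rule Bochner_Integration.integral_mult_right_zero)
    finally show ?thesis by simp
  qed
  note int1 = heat_kernel_translate[where 'a='a]
  have h_meas [measurable]: "h n \<in> borel_measurable borel" for n
    unfolding h_def by measurable
  have int2: "integrable lborel (\<lambda>y. heat_kernel c (y - x) * indicator ?B y)" if "c > 0" for c and x :: 'a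
    by (rule Bochner_Integration.integrable_bound[OF int1(1)[OF that, of x]]) (auto simp: indicator_def)
  have h01: "0 \<le> h n x" "h n x \<le> 1" for n x
  proof -
    have c: "1 / real (Suc n) > 0" by simp
    show "0 \<le> h n x" unfolding h_def
      by (intro integral_nonneg_AE AE_I2 mult_nonneg_nonneg less_imp_le[OF heat_kernel_pos] c) auto
    have "h n x \<le> (LINT y|lborel. heat_kernel (1 / real (Suc n)) (y - x))"
      unfolding h_def using less_imp_le[OF heat_kernel_pos[OF c, where 'a='a]]
      by (intro integral_mono int1(1) int2 c) (auto simp: indicator_def)
    then show "h n x \<le> 1" using int1(2)[OF c] by simp
  qed
  have hn0: "(LINT x|lborel. f x * complex_of_real (h n x)) = 0" for n
  proof -
    define c where "c = 1 / real (Suc n)"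
    have c: "c > 0" by (simp add: c_def)
    have "integrable (lborel \<Otimes>\<^sub>M lborel) (\<lambda>(x, y). f x * complex_of_real (heat_kernel c (y - x) * indicator ?B y))"
    proof (rule lborel_pair.Fubini_integrable)
      show "AE x in lborel. integrable lborel (\<lambda>y. case (x, y) of (x, y) \<Rightarrow> f x * complex_of_real (heat_kernel c (y - x) * indicator ?B y))"
        unfolding prod.case by (intro AE_I2 integrable_mult_right integrable_of_real int2 c)
      have "(LINT y|lborel. norm (case (x, y) of (x, y) \<Rightarrow> f x * complex_of_real (heat_kernel c (y - x) * indicator ?B y))) = norm (f x) * h n x" for x
      proof -
        have "(LINT y|lborel. norm (case (x, y) of (x, y) \<Rightarrow> f x * complex_of_real (heat_kernel c (y - x) * indicator ?B y)))
           = (LINT y|lborel. norm (f x) * (heat_kernel c (y - x) * indicator ?B y))"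
          using heat_kernel_pos[OF c, where 'a='a] by (intro Bochner_Integration.integral_cong refl) (simp add: norm_mult abs_mult abs_of_pos)
        then show ?thesis by (simp add: h_def c_def)
      qed
      then show "integrable lborel (\<lambda>x. LINT y|lborel. norm (case (x, y) of (x, y) \<Rightarrow> f x * complex_of_real (heat_kernel c (y - x) * indicator ?B y)))"
        using h01 by (simp only:) (rule Bochner_Integration.integrable_bound[OF f], auto simp: abs_mult mult_left_le)
    qed measurable
    from lborel_pair.Fubini_integral[OF this]
    have "(LINT x|lborel. LINT y|lborel. f x * complex_of_real (heat_kernel c (y - x) * indicator ?B y))
       = (LINT y|lborel. LINT x|lborel. f x * complex_of_real (heat_kernel c (y - x) * indicator ?B y))" ..
    also have "\<dots> = (LINT y|lborel. (LINT x|lborel. f x * complex_of_real (heat_kernel c (x - y))) * complex_of_real (indicator ?B y))"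
      by (subst heat_kernel_minus) (simp add: mult.assoc[symmetric])
    also have "\<dots> = 0" by (simp add: conv0[OF c])
    finally show ?thesis
      by (simp only: Bochner_Integration.integral_mult_right_zero integral_complex_of_real h_def c_def)
  qed
  have "(\<lambda>n. LINT x|lborel. f x * complex_of_real (h n x)) \<longlonglongrightarrow> (LINT x|lborel. f x * complex_of_real (indicator ?B x))"
  proof (rule integral_dominated_convergence)
    show "integrable lborel (\<lambda>x. norm (f x))" using f by simp
    show "AE x in lborel. norm (f x * complex_of_real (h n x)) \<le> norm (f x)" for n
      using h01 by (intro AE_I2) (simp add: norm_mult mult_left_le)
    show "AE x in lborel. (\<lambda>n. f x * complex_of_real (h n x)) \<longlonglongrightarrow> f x * complex_of_real (indicator ?B x)"
    proof (rule AE_lborel_if_not_negligible[OF negligible_convex_frontier[of ?B]])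
      fix x assume "x \<notin> frontier ?B"
      then have "isCont (indicator ?B :: 'a \<Rightarrow> real) x" by (simp add: isCont_indicator)
      then have "(\<lambda>n. h n x) \<longlonglongrightarrow> indicator ?B x"
        unfolding h_def by (intro heat_convolution_tendsto[where M=1]) (auto split: split_indicator)
      then show "(\<lambda>n. f x * complex_of_real (h n x)) \<longlonglongrightarrow> f x * complex_of_real (indicator ?B x)"
        by (intro tendsto_intros)
    qed simp
  qed measurable
  then show "(LINT x|lborel. f x * complex_of_real (indicator ?B x)) = 0"
    unfolding hn0 by (simp add: LIMSEQ_const_iff)
qed

section \<open>Smooth functions and cutoffs\<close>

lemma Ck_SucI:
  assumes "\<And>x. (f has_derivative (\<lambda>h. \<Sum>b\<in>Basis. (h \<bullet> b) * f' b x)) (at x)"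
    and "\<And>b. b \<in> Basis \<Longrightarrow> Ck k (f' b)"
  shows "Ck (Suc k) f"
  unfolding Ck.simps(2) by (intro exI[of _ f'] conjI allI ballI assms)

lemma Ck_imp_continuous: "Ck k f \<Longrightarrow> continuous_on UNIV f"
proof (cases k)
  case (Suc n)
  assume "Ck k f"
  then have Ckf: "Ck (Suc n) f" by (simp only: Suc)
  obtain f' where f'c: "(\<forall>x. (f has_derivative (\<lambda>h. \<Sum>b\<in>Basis. (h \<bullet> b) * f' b x)) (at x)) \<and> (\<forall>b\<in>Basis. Ck n (f' b))"
    by (rule exE[OF Ckf[unfolded Ck.simps(2)]])
  note f' = f'c[THEN conjunct1, THEN spec] f'c[THEN conjunct2, THEN bspec]
  show ?thesis
    by (intro continuous_at_imp_continuous_on ballI has_derivative_continuous) (rule f'(1))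
qed simp

lemma Ck_SucD: "Ck (Suc k) f \<Longrightarrow> Ck k f"
proof (induction k arbitrary: f)
  case 0
  show ?case unfolding Ck.simps(1) by (rule Ck_imp_continuous[OF 0])
next
  case (Suc k)
  obtain f' where f'c: "(\<forall>x. (f has_derivative (\<lambda>h. \<Sum>b\<in>Basis. (h \<bullet> b) * f' b x)) (at x)) \<and> (\<forall>b\<in>Basis. Ck (Suc k) (f' b))"
    by (rule exE[OF Suc.prems[unfolded Ck.simps(2)[of "Suc k"]]])
  note f' = f'c[THEN conjunct1, THEN spec] f'c[THEN conjunct2, THEN bspec]
  show ?case
    by (rule Ck_SucI[OF f'(1)]) (rule Suc.IH[OF f'(2)])
qed

lemma Ck_const [simp, intro]: "Ck k (\<lambda>x. c)"
proof (induction k arbitrary: c)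
  case (Suc k)
  then show ?case by (intro Ck_SucI[where f'="\<lambda>_ _. 0"]) auto
qed simp

lemma Ck_affine: "Ck k (\<lambda>x. x \<bullet> c + d)"
proof (cases k)
  case (Suc n)
  have "h \<bullet> c = (\<Sum>b\<in>Basis. (h \<bullet> b) * (c \<bullet> b))" for h
    by (rule euclidean_inner)
  moreover have "((\<lambda>x. x \<bullet> c + d) has_derivative (\<lambda>h. h \<bullet> c)) (at x)" for x
    by (auto intro!: derivative_eq_intros)
  ultimately show ?thesis
    unfolding Suc by (intro Ck_SucI[where f'="\<lambda>b _. c \<bullet> b"]) auto
qed (auto intro!: continuous_intros)

lemma Ck_add:
  assumes "Ck k f" "Ck k g"
  shows "Ck k (\<lambda>x. f x + g x)"
  using assms
proof (induction k arbitrary: f g)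
  case 0
  then show ?case by (auto intro: continuous_on_add)
next
  case (Suc k)
  obtain f' where f'c: "(\<forall>x. (f has_derivative (\<lambda>h. \<Sum>b\<in>Basis. (h \<bullet> b) * f' b x)) (at x)) \<and> (\<forall>b\<in>Basis. Ck k (f' b))"
    by (rule exE[OF Suc.prems(1)[unfolded Ck.simps(2)]])
  note f' = f'c[THEN conjunct1, THEN spec] f'c[THEN conjunct2, THEN bspec]
  obtain g' where g'c: "(\<forall>x. (g has_derivative (\<lambda>h. \<Sum>b\<in>Basis. (h \<bullet> b) * g' b x)) (at x)) \<and> (\<forall>b\<in>Basis. Ck k (g' b))"
    by (rule exE[OF Suc.prems(2)[unfolded Ck.simps(2)]])
  note g' = g'c[THEN conjunct1, THEN spec] g'c[THEN conjunct2, THEN bspec]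
  show ?case
  proof (rule Ck_SucI)
    show "((\<lambda>x. f x + g x) has_derivative (\<lambda>h. \<Sum>b\<in>Basis. (h \<bullet> b) * (f' b x + g' b x))) (at x)" for x
      using has_derivative_add[OF f'(1) g'(1), of x] by (simp add: distrib_left sum.distrib)
    show "Ck k (\<lambda>x. f' b x + g' b x)" if "b \<in> Basis" for b
      by (rule Suc.IH[OF f'(2)[OF that] g'(2)[OF that]])
  qed
qed

lemma Ck_mult:
  assumes "Ck k f" "Ck k g"
  shows "Ck k (\<lambda>x. f x * g x)"
  using assms
proof (induction k arbitrary: f g)
  case 0
  then show ?case by (auto intro: continuous_on_mult)
next
  case (Suc k)
  obtain f' where f'c: "(\<forall>x. (f has_derivative (\<lambda>h. \<Sum>b\<in>Basis. (h \<bullet> b) * f' b x)) (at x)) \<and> (\<forall>b\<in>Basis. Ck k (f' b))"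
    by (rule exE[OF Suc.prems(1)[unfolded Ck.simps(2)]])
  note f' = f'c[THEN conjunct1, THEN spec] f'c[THEN conjunct2, THEN bspec]
  obtain g' where g'c: "(\<forall>x. (g has_derivative (\<lambda>h. \<Sum>b\<in>Basis. (h \<bullet> b) * g' b x)) (at x)) \<and> (\<forall>b\<in>Basis. Ck k (g' b))"
    by (rule exE[OF Suc.prems(2)[unfolded Ck.simps(2)]])
  note g' = g'c[THEN conjunct1, THEN spec] g'c[THEN conjunct2, THEN bspec]
  show ?case
  proof (rule Ck_SucI)
    show "((\<lambda>x. f x * g x) has_derivative (\<lambda>h. \<Sum>b\<in>Basis. (h \<bullet> b) * (f x * g' b x + f' b x * g x))) (at x)" for x
      using has_derivative_mult[OF f'(1) g'(1), of x]
      by (simp add: distrib_left sum.distrib sum_distrib_left sum_distrib_right mult_ac)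
    show "Ck k (\<lambda>x. f x * g' b x + f' b x * g x)" if "b \<in> Basis" for b
      by (rule Ck_add[OF Suc.IH[OF Ck_SucD[OF Suc.prems(1)] g'(2)[OF that]] Suc.IH[OF f'(2)[OF that] Ck_SucD[OF Suc.prems(2)]]])
  qed
qed

lemma Ck_cmult: "Ck k f \<Longrightarrow> Ck k (\<lambda>x. c * f x)"
  by (rule Ck_mult[OF Ck_const])

lemma Ck_diff:
  assumes "Ck k f" "Ck k g"
  shows "Ck k (\<lambda>x. f x - g x)"
proof -
  have "Ck k (\<lambda>x. f x + - 1 * g x)"
    by (rule Ck_add[OF assms(1) Ck_cmult[OF assms(2)]])
  then show ?thesis by simp
qed

lemma Ck_sum: "finite I \<Longrightarrow> (\<And>i. i \<in> I \<Longrightarrow> Ck k (f i)) \<Longrightarrow> Ck k (\<lambda>x. \<Sum>i\<in>I. f i x)"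
proof (induction I rule: finite_induct)
  case (insert i I)
  show ?case
    unfolding sum.insert[OF insert.hyps] by (intro Ck_add insert.IH insert.prems) auto
qed (simp only: sum.empty Ck_const)

lemma Ck_inverse:
  assumes "Ck k f" "\<And>x. f x \<noteq> 0"
  shows "Ck k (\<lambda>x. inverse (f x))"
  using assms(1)
proof (induction k)
  case 0
  then show ?case using assms(2) by (auto intro: continuous_on_inverse)
next
  case (Suc k)
  obtain f' where f'c: "(\<forall>x. (f has_derivative (\<lambda>h. \<Sum>b\<in>Basis. (h \<bullet> b) * f' b x)) (at x)) \<and> (\<forall>b\<in>Basis. Ck k (f' b))"
    by (rule exE[OF Suc.prems(1)[unfolded Ck.simps(2)]])
  note f' = f'c[THEN conjunct1, THEN spec] f'c[THEN conjunct2, THEN bspec]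
  have inv: "Ck k (\<lambda>x. inverse (f x))"
    by (rule Suc.IH[OF Ck_SucD[OF Suc.prems]])
  show ?case
  proof (rule Ck_SucI)
    show "((\<lambda>x. inverse (f x)) has_derivative (\<lambda>h. \<Sum>b\<in>Basis. (h \<bullet> b) * (- 1 * (inverse (f x) * (f' b x * inverse (f x)))))) (at x)" for x
      using Deriv.has_derivative_inverse[OF assms(2) f'(1), of x]
      by (simp add: sum_distrib_left sum_distrib_right sum_negf mult_ac)
    show "Ck k (\<lambda>x. - 1 * (inverse (f x) * (f' b x * inverse (f x))))" if "b \<in> Basis" for b
      by (rule Ck_cmult[OF Ck_mult[OF inv Ck_mult[OF f'(2)[OF that] inv]]])
  qed
qed

lemma Ck_compose:
  fixes g :: "real \<Rightarrow> real"
  assumes "Ck k g" "Ck k q"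
  shows "Ck k (\<lambda>x. g (q x))"
  using assms
proof (induction k arbitrary: g q)
  case 0
  then show ?case using continuous_on_compose2[of UNIV g UNIV q] by auto
next
  case (Suc k)
  obtain g' where g'c: "(\<forall>x. (g has_derivative (\<lambda>h. \<Sum>b\<in>Basis. (h \<bullet> b) * g' b x)) (at x)) \<and> (\<forall>b\<in>Basis. Ck k (g' b))"
    by (rule exE[OF Suc.prems(1)[unfolded Ck.simps(2)]])
  note g' = g'c[THEN conjunct1, THEN spec] g'c[THEN conjunct2, THEN bspec]
  obtain q' where q'c: "(\<forall>x. (q has_derivative (\<lambda>h. \<Sum>b\<in>Basis. (h \<bullet> b) * q' b x)) (at x)) \<and> (\<forall>b\<in>Basis. Ck k (q' b))"
    by (rule exE[OF Suc.prems(2)[unfolded Ck.simps(2)]])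
  note q' = q'c[THEN conjunct1, THEN spec] q'c[THEN conjunct2, THEN bspec]
  show ?case
  proof (rule Ck_SucI)
    show "((\<lambda>x. g (q x)) has_derivative (\<lambda>h. \<Sum>b\<in>Basis. (h \<bullet> b) * (g' 1 (q x) * q' b x))) (at x)" for x
      using has_derivative_compose[OF q'(1) g'(1), of x]
      by (simp add: sum_distrib_left sum_distrib_right mult_ac)
    show "Ck k (\<lambda>x. g' 1 (q x) * q' b x)" if "b \<in> Basis" for b
    proof (rule Ck_mult[OF _ q'(2)[OF that]])
      \<comment> \<open>\<open>1\<close> is the only basis vector of the reals.\<close>
      have "Ck k (g' 1)" by (rule g'(2)) simp
      then show "Ck k (\<lambda>x. g' 1 (q x))"
        by (rule Suc.IH[OF _ Ck_SucD[OF Suc.prems(2)]])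
    qed
  qed
qed

section \<open>Concrete smooth functions and the cutoff\<close>

lemma Ck_Suc_real:
  fixes g :: "real \<Rightarrow> real"
  assumes "\<And>x. (g has_real_derivative g' x) (at x)" "Ck k g'"
  shows "Ck (Suc k) g"
proof (rule Ck_SucI)
  fix x
  have "(\<lambda>h. \<Sum>b\<in>Basis. (h \<bullet> b) * g' x) = (*) (g' x)"
    by (simp add: fun_eq_iff mult.commute)
  then show "(g has_derivative (\<lambda>h. \<Sum>b\<in>Basis. (h \<bullet> b) * g' x)) (at x)"
    using assms(1) by (simp only: has_field_derivative_def)
qed (rule assms(2))

lemma Ck_exp: "Ck k (exp :: real \<Rightarrow> real)"
proof (induction k)
  case (Suc k)
  then show ?case by (intro Ck_Suc_real[where g'=exp]) (auto intro: DERIV_exp)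
qed (auto intro: continuous_intros)

lemma Ck_sin_cos: "Ck k (sin :: real \<Rightarrow> real) \<and> Ck k (cos :: real \<Rightarrow> real)"
proof (induction k)
  case (Suc k)
  then have "Ck (Suc k) (sin :: real \<Rightarrow> real)"
    by (intro Ck_Suc_real[where g'=cos]) (auto intro: DERIV_sin)
  moreover have "Ck (Suc k) (cos :: real \<Rightarrow> real)"
    using Suc by (intro Ck_Suc_real[where g'="\<lambda>x. - 1 * sin x"] Ck_cmult) (auto intro!: derivative_eq_intros)
  ultimately show ?case ..
qed (auto intro: continuous_intros)

text \<open>A whole family indexed by polynomials, because it is closed under differentiation;
  smoothness then is one induction for all \<open>p\<close> at once.\<close>

definition flat :: "real poly \<Rightarrow> real \<Rightarrow> real" where
  "flat p t = (if t \<le> 0 then 0 else poly p (1 / t) * exp (- 1 / t))"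

lemma poly_mult_exp_minus_tendsto_0:
  fixes p :: "real poly"
  shows "((\<lambda>y. poly p y * exp (- y)) \<longlongrightarrow> 0) at_top"
proof -
  have "((\<lambda>y. \<Sum>i\<le>degree p. coeff p i * (y ^ i / exp y)) \<longlongrightarrow> (\<Sum>i\<le>degree p. coeff p i * 0)) at_top"
    by (intro tendsto_intros tendsto_power_div_exp_0)
  then show ?thesis
    by (simp add: poly_altdef sum_distrib_right exp_minus divide_inverse mult.assoc)
qed

text \<open>With \<open>y = 1 / t\<close> the derivative of \<open>p y * exp (- y)\<close> in
  \<open>t\<close> is \<open>y\<^sup>2 * (p y - p' y) * exp (- y)\<close>, which explains the
  polynomial. At \<open>0\<close> both one-sided difference quotients tend to zero, the right one
  because the exponential beats every polynomial.\<close>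

lemma flat_has_derivative:
  "(flat p has_real_derivative flat ([:0, 0, 1:] * (p - pderiv p)) t) (at t)"
proof -
  consider "t < 0" | "t = 0" | "t > 0" by linarith
  then show ?thesis
  proof cases
    case 1
    have "((\<lambda>_. 0) has_real_derivative 0) (at t)" by simp
    then have "(flat p has_real_derivative 0) (at t)"
      by (rule DERIV_cong_ev[THEN iffD1, rotated -1])
         (use 1 in \<open>auto simp: flat_def eventually_nhds intro!: exI[of _ "{..<0}"]\<close>)
    then show ?thesis using 1 by (simp add: flat_def)
  next
    case 3
    have "((\<lambda>t. poly p (1 / t) * exp (- 1 / t)) has_real_derivative
       (poly (pderiv p) (1 / t) * (- 1 / t\<^sup>2) * exp (- 1 / t) + poly p (1 / t) * (exp (- 1 / t) * (1 / t\<^sup>2)))) (at t)"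
      using 3 by (auto intro!: derivative_eq_intros poly_DERIV[THEN DERIV_chain2] simp: power2_eq_square)
    then have "(flat p has_real_derivative
       (poly (pderiv p) (1 / t) * (- 1 / t\<^sup>2) * exp (- 1 / t) + poly p (1 / t) * (exp (- 1 / t) * (1 / t\<^sup>2)))) (at t)"
      by (rule DERIV_cong_ev[THEN iffD1, rotated -1])
         (use 3 in \<open>auto simp: flat_def eventually_nhds intro!: exI[of _ "{0<..}"]\<close>)
    then show ?thesis using 3 by (simp add: flat_def power2_eq_square field_simps)
  next
    case 2
    have left: "((\<lambda>y. (flat p y - flat p 0) / (y - 0)) \<longlongrightarrow> 0) (at_left 0)"
      by (rule tendsto_eventually) (auto simp: flat_def eventually_at_filter)
    have "((\<lambda>y. poly ([:0, 1:] * p) y * exp (- y)) \<longlongrightarrow> 0) at_top"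
      by (rule poly_mult_exp_minus_tendsto_0)
    then have "((\<lambda>t. poly ([:0, 1:] * p) (inverse t) * exp (- inverse t)) \<longlongrightarrow> 0) (at_right 0)"
      by (rule filterlim_compose) (rule filterlim_inverse_at_top_right)
    then have right: "((\<lambda>y. (flat p y - flat p 0) / (y - 0)) \<longlongrightarrow> 0) (at_right 0)"
      by (rule Lim_transform_eventually) (auto simp: flat_def eventually_at_filter divide_inverse)
    show ?thesis
      unfolding 2 has_field_derivative_iff using filterlim_split_at[OF left right] by (simp add: flat_def)
  qed
qed

lemma Ck_flat: "Ck k (flat p)"
proof (induction k arbitrary: p)
  case 0
  show ?case
    unfolding Ck.simps(1) by (rule DERIV_continuous_on) (rule DERIV_subset[OF flat_has_derivative subset_UNIV])
next
  case (Suc k)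
  then show ?case by (intro Ck_Suc_real[OF flat_has_derivative])
qed

text \<open>The quotient \<open>\<psi> (2 - q) / (\<psi> (2 - q) + \<psi> (q - 1))\<close> is one
  for \<open>q \<le> 1\<close> and zero for \<open>q \<ge> 2\<close>; its denominator is positive
  since \<open>2 - q\<close> and \<open>q - 1\<close> add up to one. Taking the scaled squared
  distance for \<open>q\<close> keeps it polynomial, hence smooth at the centre.\<close>

lemma smooth_cutoff:
  fixes x0 :: "'a::euclidean_space"
  assumes "\<rho> > 0"
  obtains \<eta> :: "'a \<Rightarrow> real" where "\<And>k. Ck k \<eta>" "\<And>x. dist x0 x \<le> \<rho> \<Longrightarrow> \<eta> x = 1" "\<And>x. dist x0 x \<ge> 2 * \<rho> \<Longrightarrow> \<eta> x = 0"
proof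
  define \<psi> where "\<psi> = flat [:1:]"
  define c where "c t = \<psi> (2 - t) * inverse (\<psi> (2 - t) + \<psi> (t - 1))" for t
  define q where "q x = (\<Sum>b\<in>Basis. (x \<bullet> b + - (x0 \<bullet> b)) * (x \<bullet> b + - (x0 \<bullet> b))) * (1 / \<rho>\<^sup>2)" for x :: 'a
  define \<eta> where "\<eta> x = c (q x)" for x
  have \<psi>: "\<psi> t = 0" if "t \<le> 0" for t using that by (simp add: \<psi>_def flat_def)
  have \<psi>': "\<psi> t > 0" if "t > 0" for t using that by (simp add: \<psi>_def flat_def)
  have \<psi>'': "\<psi> t \<ge> 0" for t by (simp add: \<psi>_def flat_def)
  have pos: "\<psi> (2 - t) + \<psi> (t - 1) > 0" for t
    using \<psi>''[of "2 - t"] \<psi>''[of "t - 1"] \<psi>'[of "2 - t"] \<psi>'[of "t - 1"] by (cases "t < 2") (auto intro: add_pos_nonneg add_nonneg_pos)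
  have lin: "Ck k (\<lambda>t::real. t - 1)" "Ck k (\<lambda>t::real. 2 - t)" for k
    using Ck_affine[of k "1::real" "-1"] Ck_affine[of k "-1::real" 2] by simp_all
  have Ck_c: "Ck k c" for k
    unfolding c_def \<psi>_def
    by (intro Ck_mult Ck_inverse Ck_add Ck_compose[OF Ck_flat] lin) (use pos in \<open>simp add: \<psi>_def less_imp_neq[symmetric]\<close>)
  have Ck_q: "Ck k q" for k
    unfolding q_def by (intro Ck_mult Ck_sum Ck_affine Ck_const) auto
  show "Ck k \<eta>" for k
    unfolding \<eta>_def by (rule Ck_compose[OF Ck_c Ck_q])
  have q: "q x = (dist x0 x)\<^sup>2 / \<rho>\<^sup>2" for x
  proof -
    have "(dist x0 x)\<^sup>2 = (\<Sum>b\<in>Basis. (x0 \<bullet> b - x \<bullet> b)\<^sup>2)"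
      by (simp add: dist_norm norm_square_eq_sum inner_diff_left)
    also have "\<dots> = (\<Sum>b\<in>Basis. (x \<bullet> b + - (x0 \<bullet> b)) * (x \<bullet> b + - (x0 \<bullet> b)))"
      by (intro sum.cong refl) (simp add: power2_eq_square algebra_simps)
    finally show ?thesis by (simp add: q_def)
  qed
  show "\<eta> x = 1" if "dist x0 x \<le> \<rho>" for x
  proof -
    have "(dist x0 x)\<^sup>2 \<le> \<rho>\<^sup>2" using that by (intro power_mono) auto
    then have "q x \<le> 1" using assms by (simp add: q)
    then show ?thesis using \<psi>'[of "2 - q x"] by (simp add: \<eta>_def c_def \<psi>)
  qed
  show "\<eta> x = 0" if "dist x0 x \<ge> 2 * \<rho>" for x
  proof -
    have "(2 * \<rho>)\<^sup>2 \<le> (dist x0 x)\<^sup>2" using that assms by (intro power_mono) auto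
    then have "4 \<le> q x" using assms by (simp add: q pos_le_divide_eq)
    then have "q x \<ge> 2" by simp
    then show ?thesis by (simp add: \<eta>_def c_def \<psi>)
  qed
qed

section \<open>Restriction to lines and second differences\<close>

lemma Ck_directional_derivative:
  fixes f :: "'a::euclidean_space \<Rightarrow> real"
  assumes "\<And>x. (f has_derivative (\<lambda>h. \<Sum>b\<in>Basis. (h \<bullet> b) * f' b x)) (at x)" and b: "b \<in> Basis"
  shows "((\<lambda>t. f (t *\<^sub>R b + x)) has_real_derivative f' b (t *\<^sub>R b + x)) (at t)"
proof -
  have "((\<lambda>t. f (t *\<^sub>R b + x)) has_derivative (\<lambda>h. \<Sum>c\<in>Basis. ((h *\<^sub>R b) \<bullet> c) * f' c (t *\<^sub>R b + x))) (at t)"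
    by (rule has_derivative_compose[OF _ assms(1)]) (auto intro!: derivative_eq_intros)
  moreover have "(\<Sum>c\<in>Basis. ((h *\<^sub>R b) \<bullet> c) * f' c (t *\<^sub>R b + x)) = f' b (t *\<^sub>R b + x) * h" for h
  proof -
    have "(\<Sum>c\<in>Basis. ((h *\<^sub>R b) \<bullet> c) * f' c (t *\<^sub>R b + x)) = (\<Sum>c\<in>Basis. if c = b then h * f' c (t *\<^sub>R b + x) else 0)"
      using b by (intro sum.cong refl) (auto simp: inner_Basis)
    then show ?thesis using b by (simp add: mult.commute)
  qed
  ultimately show ?thesis by (simp add: has_field_derivative_def)
qed

text \<open>The mean value inequality is used twice: for \<open>f'\<close> between
  \<open>- t\<close> and \<open>t\<close>, giving
  \<open>|f' t - f' (- t)| \<le> 2 * \<tau> * M\<close>, and then for \<open>f t + f (- t)\<close>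
  on \<open>{0..\<tau>}\<close>.\<close>

lemma second_difference_bound:
  fixes f :: "real \<Rightarrow> complex"
  assumes f: "\<And>t. \<bar>t\<bar> \<le> 1 \<Longrightarrow> (f has_vector_derivative f' t) (at t)"
    and f': "\<And>t. \<bar>t\<bar> \<le> 1 \<Longrightarrow> (f' has_vector_derivative f'' t) (at t)"
    and M: "\<And>t. \<bar>t\<bar> \<le> 1 \<Longrightarrow> cmod (f'' t) \<le> M" and \<tau>: "0 < \<tau>" "\<tau> \<le> 1"
  shows "cmod (f \<tau> + f (- \<tau>) - 2 * f 0) \<le> \<tau>\<^sup>2 * (2 * M)"
proof -
  have M0: "M \<ge> 0" using M[of 0] norm_ge_zero[of "f'' 0"] by linarith
  have 1: "cmod (f' t - f' (- t)) \<le> M * (2 * \<tau>)" if "t \<in> {0..\<tau>}" for t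
  proof -
    have "cmod (f' t - f' (- t)) \<le> M * norm (t - (- t))"
    proof (rule differentiable_bound)
      show "convex {-1..1::real}" by simp
      fix x :: real assume x: "x \<in> {-1..1}"
      show "(f' has_derivative (\<lambda>h. h *\<^sub>R f'' x)) (at x within {-1..1})"
        using f'[of x] x by (auto simp: has_vector_derivative_def intro: has_derivative_at_withinI)
      show "onorm (\<lambda>h. h *\<^sub>R f'' x) \<le> M"
        using M[of x] x M0 by (intro onorm_le) (auto simp: mult.commute[of M] intro!: mult_left_mono)
    qed (use that \<tau> in auto)
    also have "\<dots> \<le> M * (2 * \<tau>)" using that M0 by (intro mult_left_mono) auto
    finally show ?thesis .
  qed
  let ?D = "\<lambda>t. f t + f (- t) - 2 * f 0"
  have "cmod (?D \<tau> - ?D 0) \<le> (M * (2 * \<tau>)) * norm (\<tau> - 0)"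
  proof (rule differentiable_bound)
    show "convex {0..\<tau>}" by simp
    fix x :: real assume x: "x \<in> {0..\<tau>}"
    have "(f has_vector_derivative f' x) (at x)" using f[of x] x \<tau> by auto
    moreover have "((\<lambda>t. f (- t)) has_vector_derivative ((- 1) *\<^sub>R f' (- x))) (at x)"
    proof -
      have "(uminus has_vector_derivative - 1) (at x)"
        by (auto intro!: derivative_eq_intros simp flip: has_real_derivative_iff_has_vector_derivative)
      moreover have "(f has_vector_derivative f' (- x)) (at (- x))"
        using f[of "- x"] x \<tau> by auto
      ultimately show ?thesis
        using vector_diff_chain_at[of uminus "-1" x f "f' (- x)"] by (simp add: o_def)
    qed
    ultimately have "(?D has_vector_derivative (f' x + (- 1) *\<^sub>R f' (- x) - 0)) (at x)"
      by (intro has_vector_derivative_diff has_vector_derivative_add has_vector_derivative_const)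
    then show "(?D has_derivative (\<lambda>h. h *\<^sub>R (f' x - f' (- x)))) (at x within {0..\<tau>})"
      by (auto simp: has_vector_derivative_def intro: has_derivative_at_withinI)
    show "onorm (\<lambda>h. h *\<^sub>R (f' x - f' (- x))) \<le> M * (2 * \<tau>)"
      using 1[OF x] by (intro onorm_le) (auto simp: mult.commute[of _ "\<bar>_\<bar>"] intro!: mult_left_mono)
  qed (use \<tau> in auto)
  then show ?thesis using \<tau> by (simp add: power2_eq_square mult_ac)
qed

section \<open>Test functions and the weighted norm\<close>

lemma bounded_if_compact_support:
  fixes g :: "'a::euclidean_space \<Rightarrow> real"
  assumes "continuous_on UNIV g" "\<And>x. norm x > R \<Longrightarrow> g x = 0"
  shows "\<exists>C. \<forall>x. \<bar>g x\<bar> \<le> C"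
proof -
  have "compact (g ` cball 0 R)"
    by (rule compact_continuous_image) (use assms(1) in \<open>auto intro: continuous_on_subset\<close>)
  then obtain C where C: "\<And>y. y \<in> g ` cball 0 R \<Longrightarrow> norm y \<le> C"
    using compact_imp_bounded bounded_iff by metis
  have "\<bar>g x\<bar> \<le> max C 0" for x
  proof (cases "norm x \<le> R")
    case True
    then show ?thesis using C[of "g x"] by (simp add: le_max_iff_disj)
  next
    case False
    then show ?thesis using assms(2)[of x] by simp
  qed
  then show ?thesis by blast
qed

text \<open>Carries the open region where a function is constant, such as the outside of its support
  or the plateau of a cutoff, over to its derivatives.\<close>

lemma directional_derivative_zero:
  fixes f g :: "'a::euclidean_space \<Rightarrow> real"
  assumes D: "\<And>x t. ((\<lambda>t. f (t *\<^sub>R b + x)) has_real_derivative g (t *\<^sub>R b + x)) (at t)"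
    and S: "open S" and const: "\<And>x. x \<in> S \<Longrightarrow> f x = c" and x: "x \<in> S"
  shows "g x = 0"
proof -
  have "open ((\<lambda>t. t *\<^sub>R b + x) -` S)"
    by (intro open_vimage S continuous_intros)
  then have "eventually (\<lambda>t. t *\<^sub>R b + x \<in> S) (nhds 0)"
    using x by (auto simp: eventually_nhds intro!: exI[of _ "(\<lambda>t. t *\<^sub>R b + x) -` S"])
  then have ev: "eventually (\<lambda>t. f (t *\<^sub>R b + x) = c) (nhds 0)"
    by (rule eventually_mono) (rule const)
  have "((\<lambda>t. f (t *\<^sub>R b + x)) has_real_derivative 0) (at 0)"
    by (rule DERIV_cong_ev[THEN iffD2, OF refl ev refl]) simp
  from DERIV_unique[OF this D[of x 0]] show ?thesis by simp
qed

text \<open>One constant \<open>C\<close> serves all directions since there are finitely many. Only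
  pure second derivatives occur because second differences are taken along basis vectors.\<close>

lemma Ck_2_compact_support:
  fixes f :: "'a::euclidean_space \<Rightarrow> real"
  assumes f: "Ck 2 f" and zero: "\<And>x. norm x > R \<Longrightarrow> f x = 0"
  obtains C g1 g2 where "\<And>x. \<bar>f x\<bar> \<le> C"
    "\<And>b x t. b \<in> Basis \<Longrightarrow> ((\<lambda>t. f (t *\<^sub>R b + x)) has_real_derivative g1 b (t *\<^sub>R b + x)) (at t)"
    "\<And>b x t. b \<in> Basis \<Longrightarrow> ((\<lambda>t. g1 b (t *\<^sub>R b + x)) has_real_derivative g2 b (t *\<^sub>R b + x)) (at t)"
    "\<And>b x. b \<in> Basis \<Longrightarrow> \<bar>g1 b x\<bar> \<le> C" "\<And>b x. b \<in> Basis \<Longrightarrow> \<bar>g2 b x\<bar> \<le> C"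
    "\<And>b x. b \<in> Basis \<Longrightarrow> norm x > R \<Longrightarrow> g2 b x = 0"
proof -
  have f2: "Ck (Suc (Suc 0)) f" using f by (simp only: numeral_2_eq_2)
  obtain f' where f'c: "(\<forall>x. (f has_derivative (\<lambda>h. \<Sum>b\<in>Basis. (h \<bullet> b) * f' b x)) (at x)) \<and> (\<forall>b\<in>Basis. Ck (Suc 0) (f' b))"
    by (rule exE[OF f2[unfolded Ck.simps(2)[of "Suc 0"]]])
  note f' = f'c[THEN conjunct1, THEN spec] f'c[THEN conjunct2, THEN bspec]
  have "\<forall>b\<in>Basis. \<exists>f''. (\<forall>x. (f' b has_derivative (\<lambda>h. \<Sum>c\<in>Basis. (h \<bullet> c) * f'' c x)) (at x)) \<and> (\<forall>c\<in>Basis. Ck 0 (f'' c))"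
    by (rule ballI) (rule f'(2)[unfolded Ck.simps(2)])
  then obtain f'' where f''c: "\<forall>b\<in>Basis. (\<forall>x. (f' b has_derivative (\<lambda>h. \<Sum>c\<in>Basis. (h \<bullet> c) * f'' b c x)) (at x)) \<and> (\<forall>c\<in>Basis. Ck 0 (f'' b c))"
    by (rule bchoice[THEN exE])
  note f'' = f''c[THEN bspec, THEN conjunct1, THEN spec] f''c[THEN bspec, THEN conjunct2, THEN bspec]
  have D1: "((\<lambda>t. f (t *\<^sub>R b + x)) has_real_derivative f' b (t *\<^sub>R b + x)) (at t)" if "b \<in> Basis" for b x t
    by (rule Ck_directional_derivative[OF f'(1) that])
  have D2: "((\<lambda>t. f' b (t *\<^sub>R b + x)) has_real_derivative f'' b b (t *\<^sub>R b + x)) (at t)" if "b \<in> Basis" for b x t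
    by (rule Ck_directional_derivative[OF f''(1)[OF that] that])
  have S: "open {x::'a. norm x > R}"
    by (intro open_Collect_less continuous_intros)
  have z1: "f' b x = 0" if "b \<in> Basis" "norm x > R" for b x
    by (rule directional_derivative_zero[OF D1[OF that(1)] S, of 0]) (use zero that in auto)
  have z2: "f'' b b x = 0" if "b \<in> Basis" "norm x > R" for b x
    by (rule directional_derivative_zero[OF D2[OF that(1)] S, of 0]) (use z1 that in auto)
  obtain C0 where C0: "\<forall>x. \<bar>f x\<bar> \<le> C0"
    using bounded_if_compact_support[OF Ck_imp_continuous[OF f] zero] by blast
  have "\<forall>b\<in>Basis. \<exists>C. \<forall>x. \<bar>f' b x\<bar> \<le> C"
    by (intro ballI bounded_if_compact_support[OF Ck_imp_continuous[OF f'(2)] z1])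
  then obtain C1 where C1: "\<forall>b\<in>Basis. \<forall>x. \<bar>f' b x\<bar> \<le> C1 b" by (rule bchoice[THEN exE])
  have "\<forall>b\<in>Basis. \<exists>C. \<forall>x. \<bar>f'' b b x\<bar> \<le> C"
    by (intro ballI bounded_if_compact_support[OF Ck_imp_continuous[OF f''(2)] z2])
  then obtain C2 where C2: "\<forall>b\<in>Basis. \<forall>x. \<bar>f'' b b x\<bar> \<le> C2 b" by (rule bchoice[THEN exE])
  define C where "C = Max ({C0} \<union> C1 ` Basis \<union> C2 ` Basis)"
  have C: "C0 \<le> C" "b \<in> Basis \<Longrightarrow> C1 b \<le> C" "b \<in> Basis \<Longrightarrow> C2 b \<le> C" for b
    unfolding C_def by (intro Max_ge; force)+
  show thesis
  proof (rule that)
    show "\<bar>f x\<bar> \<le> C" for x using C0 C(1) order.trans by blast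
    show "\<bar>f' b x\<bar> \<le> C" if "b \<in> Basis" for b x using C1 C(2) that order.trans by blast
    show "\<bar>f'' b b x\<bar> \<le> C" if "b \<in> Basis" for b x using C2 C(3) that order.trans by blast
  qed (fact D1 D2 z2)+
qed

lemma test_functions_iff:
  "\<phi> \<in> test_functions \<Omega> \<longleftrightarrow> (\<forall>k. Ck k \<phi>) \<and> bounded {x. \<phi> x \<noteq> 0} \<and> closure {x. \<phi> x \<noteq> 0} \<subseteq> \<Omega>"
  unfolding test_functions_def by auto

lemma test_functions_UNIV_iff:
  "\<phi> \<in> test_functions UNIV \<longleftrightarrow> (\<forall>k. Ck k \<phi>) \<and> (\<exists>R. \<forall>x. norm x > R \<longrightarrow> \<phi> x = 0)"
proof -
  have "bounded {x. \<phi> x \<noteq> 0} \<longleftrightarrow> (\<exists>R. \<forall>x. norm x > R \<longrightarrow> \<phi> x = 0)"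
    unfolding bounded_iff by (simp add: not_le) (metis not_le)
  then show ?thesis by (simp add: test_functions_iff)
qed

lemma test_functions_mono: "\<phi> \<in> test_functions \<Omega> \<Longrightarrow> \<phi> \<in> test_functions UNIV"
  by (simp add: test_functions_iff)

lemma test_functions_diff:
  assumes "\<phi> \<in> test_functions UNIV" "\<psi> \<in> test_functions UNIV"
  shows "(\<lambda>x. \<phi> x - \<psi> x) \<in> test_functions UNIV"
proof -
  obtain R1 R2 where "\<forall>x. norm x > R1 \<longrightarrow> \<phi> x = 0" "\<forall>x. norm x > R2 \<longrightarrow> \<psi> x = 0"
    using assms unfolding test_functions_UNIV_iff by blast
  then have "\<forall>x. norm x > max R1 R2 \<longrightarrow> \<phi> x - \<psi> x = 0" by simp
  then show ?thesis
    using assms unfolding test_functions_UNIV_iff by (blast intro: Ck_diff)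
qed

lemma test_function_continuous: "\<phi> \<in> test_functions \<Omega> \<Longrightarrow> continuous_on UNIV \<phi>"
  unfolding test_functions_def using Ck_imp_continuous by blast

lemma test_function_measurable: "\<phi> \<in> test_functions \<Omega> \<Longrightarrow> \<phi> \<in> borel_measurable borel"
  by (intro borel_measurable_continuous_onI test_function_continuous)

lemma test_function_bounded: "\<phi> \<in> test_functions \<Omega> \<Longrightarrow> \<exists>C. \<forall>x. \<bar>\<phi> x\<bar> \<le> C"
  using test_functions_mono[of \<phi> \<Omega>] bounded_if_compact_support[OF test_function_continuous[of \<phi> \<Omega>]]
  unfolding test_functions_UNIV_iff by blast

lemma nn_integral_indicator_cball_finite:
  "(\<integral>\<^sup>+x. ennreal (c * indicator (cball a R) (x::'a::euclidean_space)) \<partial>lborel) < \<infinity>"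
proof -
  have "(\<integral>\<^sup>+x. ennreal (c * indicator (cball a R) (x::'a)) \<partial>lborel) = (\<integral>\<^sup>+x. ennreal c * indicator (cball a R) (x::'a) \<partial>lborel)"
    by (intro nn_integral_cong) (auto split: split_indicator)
  also have "\<dots> = ennreal c * emeasure lborel (cball a R)"
    by (rule nn_integral_cmult_indicator) simp
  also have "\<dots> < \<infinity>"
    using emeasure_bounded_finite[OF bounded_cball[of a R]] by (simp add: ennreal_mult_less_top)
  finally show ?thesis .
qed

lemma test_function_integrable:
  fixes \<phi> :: "'a::euclidean_space \<Rightarrow> real"
  assumes "\<phi> \<in> test_functions \<Omega>"
  shows "integrable lborel \<phi>"
proof -
  obtain C where C: "\<And>x. \<bar>\<phi> x\<bar> \<le> C" using test_function_bounded[OF assms] by blast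
  obtain R where R: "\<And>x. norm x > R \<Longrightarrow> \<phi> x = 0"
    using test_functions_mono[OF assms] unfolding test_functions_UNIV_iff by blast
  have "(\<integral>\<^sup>+x. ennreal (norm (\<phi> x)) \<partial>lborel) \<le> (\<integral>\<^sup>+x. ennreal (C * indicator (cball 0 R) (x::'a)) \<partial>lborel)"
  proof (intro nn_integral_mono ennreal_leI)
    fix x show "norm (\<phi> x) \<le> C * indicator (cball 0 R) x"
      using C[of x] R[of x] by (cases "norm x \<le> R") auto
  qed
  also have "\<dots> < \<infinity>" by (rule nn_integral_indicator_cball_finite)
  finally show ?thesis
    using test_function_measurable[OF assms] by (intro integrableI_bounded) auto
qed

text \<open>Second differences with step at most one vanish outside the ball of radius
  \<open>R + 1\<close> and are at most \<open>\<tau>\<^sup>2 * (2 * C)\<close>, which gives an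
  explicit \<open>Q\<close> for the weighted estimate.\<close>

lemma test_function_FT_finite:
  fixes \<phi> :: "'a::euclidean_space \<Rightarrow> real"
  assumes \<phi>: "\<phi> \<in> test_functions \<Omega>" and s: "0 < s" "s < 2"
  shows "(\<integral>\<^sup>+\<xi>. ennreal (norm \<xi> powr (2 * s) * (cmod (FT (\<lambda>x. complex_of_real (\<phi> x)) \<xi>))\<^sup>2) \<partial>lborel) < \<infinity>"
proof -
  obtain R where R: "\<And>x. norm x > R \<Longrightarrow> \<phi> x = 0"
    using test_functions_mono[OF \<phi>] unfolding test_functions_UNIV_iff by blast
  have "Ck 2 \<phi>" using \<phi> unfolding test_functions_def by blast
  then obtain C g1 g2 where C: "\<And>x. \<bar>\<phi> x\<bar> \<le> C"
    and D1: "\<And>b x t. b \<in> Basis \<Longrightarrow> ((\<lambda>t. \<phi> (t *\<^sub>R b + x)) has_real_derivative g1 b (t *\<^sub>R b + x)) (at t)"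
    and D2: "\<And>b x t. b \<in> Basis \<Longrightarrow> ((\<lambda>t. g1 b (t *\<^sub>R b + x)) has_real_derivative g2 b (t *\<^sub>R b + x)) (at t)"
    and B1: "\<And>b x. b \<in> Basis \<Longrightarrow> \<bar>g1 b x\<bar> \<le> C" and B2: "\<And>b x. b \<in> Basis \<Longrightarrow> \<bar>g2 b x\<bar> \<le> C"
    by (rule Ck_2_compact_support[OF _ R]) (assumption | blast)+
  have C0: "C \<ge> 0" using C[of 0] by linarith
  let ?Q = "\<lambda>x::'a. 2 * C * indicator (cball 0 (R + 1)) x"
  let ?w = "\<lambda>x. complex_of_real (\<phi> x)"
  have "(\<integral>\<^sup>+\<xi>. ennreal (norm \<xi> powr (2 * s) * (cmod (FT ?w \<xi>))\<^sup>2) \<partial>lborel)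
     \<le> ennreal ((2 * pi) ^ DIM('a) * (1 + (real DIM('a))\<^sup>2)) * (\<integral>\<^sup>+x. ennreal ((?Q x)\<^sup>2) \<partial>lborel)"
  proof (rule weighted_FT_bound[OF s])
    show "integrable lborel ?w"
      unfolding complex_of_real_integrable_eq by (rule test_function_integrable[OF \<phi>])
    show "cmod (?w x) \<le> ?Q x" for x
      using C[of x] C0 R[of x] by (cases "norm x \<le> R + 1") (auto simp: indicator_def)
    show "cmod (?w (\<tau> *\<^sub>R b + x) + ?w (- \<tau> *\<^sub>R b + x) - 2 * ?w x) \<le> \<tau>\<^sup>2 * ?Q x"
      if b: "b \<in> Basis" and \<tau>: "0 < \<tau>" "\<tau> \<le> 1" for b x \<tau>
    proof (cases "norm x \<le> R + 1")
      case True
      have "cmod (?w (\<tau> *\<^sub>R b + x) + ?w ((- \<tau>) *\<^sub>R b + x) - 2 * ?w (0 *\<^sub>R b + x)) \<le> \<tau>\<^sup>2 * (2 * C)"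
      proof (rule second_difference_bound[where f="\<lambda>t. ?w (t *\<^sub>R b + x)"])
        show "((\<lambda>t. ?w (t *\<^sub>R b + x)) has_vector_derivative complex_of_real (g1 b (t *\<^sub>R b + x))) (at t)" for t
          using D1[OF b, of x t] by (intro has_vector_derivative_of_real) (simp add: has_real_derivative_iff_has_vector_derivative)
        show "((\<lambda>t. complex_of_real (g1 b (t *\<^sub>R b + x))) has_vector_derivative complex_of_real (g2 b (t *\<^sub>R b + x))) (at t)" for t
          using D2[OF b, of x t] by (intro has_vector_derivative_of_real) (simp add: has_real_derivative_iff_has_vector_derivative)
        show "cmod (complex_of_real (g2 b (t *\<^sub>R b + x))) \<le> C" for t
          using B2[OF b, of "t *\<^sub>R b + x"] by simp
      qed (fact \<tau>)+
      then show ?thesis using True by simp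
    next
      case False
      have "norm x - \<bar>c\<bar> \<le> norm (c *\<^sub>R b + x)" for c
        using norm_triangle_ineq2[of x "- (c *\<^sub>R b)"] b by (simp add: add.commute)
      from this[of \<tau>] this[of "- \<tau>"] have "norm (\<tau> *\<^sub>R b + x) > R" "norm (- \<tau> *\<^sub>R b + x) > R" "norm x > R"
        using False \<tau> by auto
      then show ?thesis using R C0 by simp
    qed
  qed (intro borel_measurable_times borel_measurable_const borel_measurable_indicator, simp)
  also have "\<dots> = ennreal ((2 * pi) ^ DIM('a) * (1 + (real DIM('a))\<^sup>2)) * (\<integral>\<^sup>+x. ennreal ((2 * C)\<^sup>2 * indicator (cball 0 (R + 1)) (x::'a)) \<partial>lborel)"
    by (intro arg_cong2[where f="(*)"] nn_integral_cong refl arg_cong[where f=ennreal]) (auto split: split_indicator)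
  also have "\<dots> < \<infinity>"
    using nn_integral_indicator_cball_finite[of "(2 * C)\<^sup>2" "0::'a" "R + 1"] by (simp add: ennreal_mult_less_top)
  finally show ?thesis .
qed

section \<open>\<open>fourier\<close> of test functions and the weighted norm\<close>

lemma fourier_eq_FT:
  fixes \<phi> :: "'a::euclidean_space \<Rightarrow> real"
  assumes [measurable]: "\<phi> \<in> borel_measurable borel"
  shows "fourier \<phi> \<xi> = complex_of_real ((2 * pi) powr (- (real DIM('a) / 2))) * cnj (FT (\<lambda>x. complex_of_real (\<phi> x)) \<xi>)"
proof -
  have "(LINT x|lebesgue. exp (- \<i> * complex_of_real (x \<bullet> \<xi>)) * complex_of_real (\<phi> x))
     = (LINT x|lborel. exp (- \<i> * complex_of_real (x \<bullet> \<xi>)) * complex_of_real (\<phi> x))"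
    by (rule integral_completion) measurable
  also have "\<dots> = (LINT x|lborel. cnj (complex_of_real (\<phi> x) * iexp (x \<bullet> \<xi>)))"
    by (intro Bochner_Integration.integral_cong refl) (simp add: exp_cnj mult.commute)
  also have "\<dots> = cnj (FT (\<lambda>x. complex_of_real (\<phi> x)) \<xi>)"
    unfolding FT_def by (rule Bochner_Integration.integral_cnj)
  finally show ?thesis by (simp add: fourier_def)
qed

lemma fourier_measurable [measurable]:
  fixes \<phi> :: "'a::euclidean_space \<Rightarrow> real"
  assumes [measurable]: "\<phi> \<in> borel_measurable borel"
  shows "fourier \<phi> \<in> borel_measurable borel"
proof -
  have "fourier \<phi> = (\<lambda>\<xi>. complex_of_real ((2 * pi) powr (- (real DIM('a) / 2))) * cnj (FT (\<lambda>x. complex_of_real (\<phi> x)) \<xi>))"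
    by (rule ext) (rule fourier_eq_FT[OF assms])
  then show ?thesis by simp
qed

lemma fourier_diff:
  fixes \<phi> \<psi> :: "'a::euclidean_space \<Rightarrow> real"
  assumes "integrable lborel \<phi>" "integrable lborel \<psi>"
  shows "fourier (\<lambda>x. \<phi> x - \<psi> x) \<xi> = fourier \<phi> \<xi> - fourier \<psi> \<xi>"
proof -
  have [measurable]: "\<phi> \<in> borel_measurable borel" "\<psi> \<in> borel_measurable borel"
    using borel_measurable_integrable[OF assms(1)] borel_measurable_integrable[OF assms(2)] by simp_all
  have "FT (\<lambda>x. complex_of_real (\<phi> x - \<psi> x)) \<xi> = FT (\<lambda>x. complex_of_real (\<phi> x)) \<xi> - FT (\<lambda>x. complex_of_real (\<psi> x)) \<xi>"
    unfolding FT_def of_real_diff left_diff_distrib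
    by (intro Bochner_Integration.integral_diff integrable_mult_iexp) (simp_all only: complex_of_real_integrable_eq assms)
  then show ?thesis by (simp add: fourier_eq_FT right_diff_distrib)
qed

text \<open>The squared norm of the weighted space, as an extended real so that it can be used
  before finiteness is known. Under the integral pairing, the space for \<open>- s\<close> is dual
  to the one for \<open>s\<close>.\<close>

definition weighted_sq :: "real \<Rightarrow> ('a::euclidean_space \<Rightarrow> complex) \<Rightarrow> ennreal" where
  "weighted_sq s g = (\<integral>\<^sup>+\<xi>. ennreal (norm \<xi> powr (2 * s) * (cmod (g \<xi>))\<^sup>2) \<partial>lborel)"

lemma weighted_sq_cmult:
  assumes [measurable]: "g \<in> borel_measurable borel"
  shows "weighted_sq s (\<lambda>\<xi>. c * g \<xi>) = ennreal ((cmod c)\<^sup>2) * weighted_sq s g"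
  unfolding weighted_sq_def
  by (subst nn_integral_cmult[symmetric]) (auto simp: norm_mult power_mult_distrib mult_ac simp flip: ennreal_mult intro!: nn_integral_cong)

lemma weighted_sq_cnj: "weighted_sq s (\<lambda>\<xi>. cnj (g \<xi>)) = weighted_sq s g"
  by (simp add: weighted_sq_def)

text \<open>Finiteness has to precede the identity: \<open>test_norm\<close> is built on a Bochner
  integral, which would be zero by default if the integrand were not integrable.\<close>

lemma test_norm_eq:
  fixes \<phi> :: "'a::euclidean_space \<Rightarrow> real"
  assumes \<phi>: "\<phi> \<in> test_functions \<Omega>" and s: "0 < s" "s < 2"
  shows "weighted_sq s (fourier \<phi>) = ennreal ((test_norm s \<phi>)\<^sup>2)" and "weighted_sq s (fourier \<phi>) < \<infinity>"
    and "test_norm s \<phi> \<ge> 0"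
proof -
  note [measurable] = test_function_measurable[OF \<phi>]
  have fin: "weighted_sq s (fourier \<phi>) < \<infinity>"
  proof -
    have "weighted_sq s (fourier \<phi>) = weighted_sq s (\<lambda>\<xi>. complex_of_real ((2 * pi) powr (- (real DIM('a) / 2))) * cnj (FT (\<lambda>x. complex_of_real (\<phi> x)) \<xi>))"
      by (intro arg_cong[where f="weighted_sq s"] ext fourier_eq_FT) measurable
    also have "\<dots> < \<infinity>"
      using test_function_FT_finite[OF \<phi> s]
      by (subst weighted_sq_cmult) (auto simp: weighted_sq_cnj weighted_sq_def ennreal_mult_less_top)
    finally show ?thesis .
  qed
  then show "weighted_sq s (fourier \<phi>) < \<infinity>" .
  let ?f = "\<lambda>\<xi>. norm \<xi> powr (2 * s) * (cmod (fourier \<phi> \<xi>))\<^sup>2"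
  have int: "integrable lborel ?f"
    using fin unfolding weighted_sq_def by (intro integrableI_bounded) auto
  have "test_inner s \<phi> \<phi> = (LINT \<xi>|lebesgue. complex_of_real (?f \<xi>))"
    unfolding test_inner_def
    by (intro Bochner_Integration.integral_cong refl) (simp add: complex_norm_square del: of_real_power)
  also have "\<dots> = (LINT \<xi>|lborel. complex_of_real (?f \<xi>))"
    by (rule integral_completion) measurable
  also have "\<dots> = complex_of_real (LINT \<xi>|lborel. ?f \<xi>)"
    by (rule integral_complex_of_real)
  finally have "Re (test_inner s \<phi> \<phi>) = (LINT \<xi>|lborel. ?f \<xi>)" by simp
  moreover have "(LINT \<xi>|lborel. ?f \<xi>) \<ge> 0" by (rule integral_nonneg_AE) simp
  ultimately have tn: "(test_norm s \<phi>)\<^sup>2 = (LINT \<xi>|lborel. ?f \<xi>)" and "test_norm s \<phi> \<ge> 0"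
    by (simp_all add: test_norm_def)
  then show "test_norm s \<phi> \<ge> 0" by simp
  show "weighted_sq s (fourier \<phi>) = ennreal ((test_norm s \<phi>)\<^sup>2)"
    unfolding weighted_sq_def tn by (rule nn_integral_eq_integral[OF int]) simp
qed

text \<open>Completing the square absorbs \<open>R * norm \<xi>\<close> at the cost of half the
  Gaussian. The linear exponential stems from the imaginary part of a complex evaluation
  point.\<close>

lemma nn_integral_singular_gaussian_exp:
  assumes s: "0 < s" "2 * s < real DIM('a)" and c: "c > 0"
  shows "(\<integral>\<^sup>+\<xi>. ennreal (norm (\<xi>::'a::euclidean_space) powr (- 2 * s) * exp (R * norm \<xi> - c * (norm \<xi>)\<^sup>2)) \<partial>lborel) < \<infinity>"
proof -
  have "(\<integral>\<^sup>+\<xi>. ennreal (norm (\<xi>::'a) powr (- 2 * s) * exp (R * norm \<xi> - c * (norm \<xi>)\<^sup>2)) \<partial>lborel)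
    \<le> (\<integral>\<^sup>+\<xi>. ennreal (exp (R\<^sup>2 / (2 * c))) * ennreal (norm (\<xi>::'a) powr (- 2 * s) * exp (- (c / 2) * (norm \<xi>)\<^sup>2)) \<partial>lborel)"
  proof (rule nn_integral_mono)
    fix \<xi> :: 'a
    have "R * norm \<xi> - c * (norm \<xi>)\<^sup>2 = R\<^sup>2 / (2 * c) - (c / 2) * (norm \<xi>)\<^sup>2 - (R - c * norm \<xi>)\<^sup>2 / (2 * c)"
      using c by (simp add: divide_simps) (simp add: algebra_simps power2_eq_square)
    also have "\<dots> \<le> R\<^sup>2 / (2 * c) + - (c / 2) * (norm \<xi>)\<^sup>2"
      using c by simp
    finally have "exp (R * norm \<xi> - c * (norm \<xi>)\<^sup>2) \<le> exp (R\<^sup>2 / (2 * c)) * exp (- (c / 2) * (norm \<xi>)\<^sup>2)"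
      by (simp only: exp_add[symmetric] exp_le_cancel_iff)
    then have "norm \<xi> powr (- 2 * s) * exp (R * norm \<xi> - c * (norm \<xi>)\<^sup>2)
       \<le> norm \<xi> powr (- 2 * s) * (exp (R\<^sup>2 / (2 * c)) * exp (- (c / 2) * (norm \<xi>)\<^sup>2))"
      by (rule mult_left_mono) simp
    also have "\<dots> = exp (R\<^sup>2 / (2 * c)) * (norm \<xi> powr (- 2 * s) * exp (- (c / 2) * (norm \<xi>)\<^sup>2))"
      by (simp only: mult_ac)
    finally show "ennreal (norm \<xi> powr (- 2 * s) * exp (R * norm \<xi> - c * (norm \<xi>)\<^sup>2))
      \<le> ennreal (exp (R\<^sup>2 / (2 * c))) * ennreal (norm \<xi> powr (- 2 * s) * exp (- (c / 2) * (norm \<xi>)\<^sup>2))"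
      by (subst ennreal_mult[symmetric]) (auto intro: ennreal_leI)
  qed
  also have "\<dots> = ennreal (exp (R\<^sup>2 / (2 * c))) * (\<integral>\<^sup>+\<xi>. ennreal (norm (\<xi>::'a) powr (- 2 * s) * exp (- (c / 2) * (norm \<xi>)\<^sup>2)) \<partial>lborel)"
    by (rule nn_integral_cmult) measurable
  also have "\<dots> < \<infinity>"
    using nn_integral_singular_gaussian[OF s, of "c / 2"] c by (simp add: ennreal_mult_less_top)
  finally show ?thesis .
qed

text \<open>Cauchy-Schwarz for \<open>|\<xi>| powr s * g\<close> and
  \<open>|\<xi>| powr (- s) * m\<close>; the two powers cancel except at the origin, a null
  set.\<close>

lemma weighted_pairing:
  fixes g m :: "'a::euclidean_space \<Rightarrow> complex"
  assumes [measurable]: "g \<in> borel_measurable borel" "m \<in> borel_measurable borel"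
    and g: "weighted_sq s g \<le> ennreal A" "A \<ge> 0"
    and m: "weighted_sq (- s) m \<le> ennreal B" "B \<ge> 0"
  shows "integrable lborel (\<lambda>\<xi>. g \<xi> * m \<xi>)" and "cmod (LINT \<xi>|lborel. g \<xi> * m \<xi>) \<le> sqrt (A * B)"
proof -
  let ?g = "\<lambda>\<xi>. complex_of_real (norm \<xi> powr s) * g \<xi>"
  let ?m = "\<lambda>\<xi>. complex_of_real (norm \<xi> powr (- s)) * m \<xi>"
  have sq: "(norm \<xi> powr r)\<^sup>2 = norm \<xi> powr (2 * r)" for \<xi> :: 'a and r
    by (simp add: power2_eq_square flip: powr_add)
  have gg: "(\<integral>\<^sup>+\<xi>. ennreal ((cmod (?g \<xi>))\<^sup>2) \<partial>lborel) \<le> ennreal A"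
    using g(1) unfolding weighted_sq_def by (simp add: norm_mult power_mult_distrib sq)
  have mm: "(\<integral>\<^sup>+\<xi>. ennreal ((cmod (?m \<xi>))\<^sup>2) \<partial>lborel) \<le> ennreal B"
    using m(1) unfolding weighted_sq_def norm_mult norm_of_real power_mult_distrib power2_abs sq by simp
  have ae: "AE \<xi> in lborel. ?g \<xi> * ?m \<xi> = g \<xi> * m \<xi>"
  proof (rule AE_lborel_if_not_negligible[of "{0}"])
    fix \<xi> :: 'a assume "\<xi> \<notin> {0}"
    then have "norm \<xi> powr s * norm \<xi> powr (- s) = 1"
      by (simp flip: powr_add)
    then have "complex_of_real (norm \<xi> powr s) * complex_of_real (norm \<xi> powr (- s)) = 1"
      by (simp only: of_real_mult[symmetric] of_real_1)
    then show "?g \<xi> * ?m \<xi> = g \<xi> * m \<xi>"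
      by (metis (no_types, lifting) mult.assoc mult.left_commute mult_1)
  qed simp
  have "integrable lborel (\<lambda>\<xi>. ?g \<xi> * ?m \<xi>)"
    by (rule Cauchy_Schwarz_integrable(1)[OF _ _ gg g(2) mm m(2)]) measurable
  then show "integrable lborel (\<lambda>\<xi>. g \<xi> * m \<xi>)"
    by (subst (asm) integrable_cong_AE[OF _ _ ae]) auto
  have "cmod (LINT \<xi>|lborel. ?g \<xi> * ?m \<xi>) \<le> sqrt (A * B)"
    by (rule Cauchy_Schwarz_integrable(3)[OF _ _ gg g(2) mm m(2)]) measurable
  then show "cmod (LINT \<xi>|lborel. g \<xi> * m \<xi>) \<le> sqrt (A * B)"
    by (subst (asm) integral_cong_AE[OF _ _ ae]) auto
qed

section \<open>The Fourier transform on the completion\<close>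

lemma ennreal_tendsto_0I:
  fixes X :: "'b \<Rightarrow> ennreal"
  assumes "\<And>e. e > 0 \<Longrightarrow> eventually (\<lambda>n. X n \<le> ennreal e) F"
  shows "(X \<longlongrightarrow> 0) F"
proof (rule order_tendstoI)
  fix a :: ennreal assume "0 < a"
  then obtain b where b: "0 < b" "b < a" using dense by blast
  then obtain e where e: "b = ennreal e" "e > 0"
    by (cases b) (auto simp: top_unique)
  show "eventually (\<lambda>n. X n < a) F"
    using assms[OF e(2)] by eventually_elim (use b e in auto)
qed simp

text \<open>If \<open>a > \<delta>\<close> then
  \<open>a powr (1 - p) \<le> \<delta> powr (1 - p)\<close>. This splitting takes the place of
  Hoelder's inequality, so no conjugate exponent appears.\<close>

lemma powr_split_le:
  fixes a :: real
  assumes "a \<ge> 0" "\<delta> > 0" "p \<ge> 1"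
  shows "a \<le> \<delta> + \<delta> powr (1 - p) * a powr p"
proof (cases "a \<le> \<delta>")
  case False
  then have a: "a > \<delta>" "a > 0" using assms by auto
  have "a = a powr (1 - p) * a powr p"
    using a by (simp flip: powr_add)
  also have "\<dots> \<le> \<delta> powr (1 - p) * a powr p"
    using a assms by (intro mult_right_mono powr_mono2') auto
  finally show ?thesis using assms by simp
qed (simp add: add_increasing2)

lemma nn_integral_weight_le_powr:
  fixes v m :: "'a::euclidean_space \<Rightarrow> real"
  assumes [measurable]: "v \<in> borel_measurable borel" "m \<in> borel_measurable borel"
    and m: "\<And>x. 0 \<le> m x" "\<And>x. m x \<le> C" and \<delta>: "\<delta> > 0" and p: "p \<ge> 1"
  shows "(\<integral>\<^sup>+x. ennreal (\<bar>v x\<bar> * m x) \<partial>lborel)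
     \<le> ennreal \<delta> * (\<integral>\<^sup>+x. ennreal (m x) \<partial>lborel) + ennreal (C * \<delta> powr (1 - p)) * (\<integral>\<^sup>+x. ennreal (\<bar>v x\<bar> powr p) \<partial>lborel)"
proof -
  have C: "C \<ge> 0" using m order.trans by blast
  have "(\<integral>\<^sup>+x. ennreal (\<bar>v x\<bar> * m x) \<partial>lborel)
    \<le> (\<integral>\<^sup>+x. ennreal \<delta> * ennreal (m x) + ennreal (C * \<delta> powr (1 - p)) * ennreal (\<bar>v x\<bar> powr p) \<partial>lborel)"
  proof (rule nn_integral_mono)
    fix x
    have "\<bar>v x\<bar> * m x \<le> (\<delta> + \<delta> powr (1 - p) * \<bar>v x\<bar> powr p) * m x"
      using powr_split_le[OF _ \<delta> p] m by (intro mult_right_mono) auto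
    also have "\<dots> = \<delta> * m x + m x * (\<delta> powr (1 - p) * \<bar>v x\<bar> powr p)"
      by (simp add: algebra_simps)
    also have "\<dots> \<le> \<delta> * m x + C * (\<delta> powr (1 - p) * \<bar>v x\<bar> powr p)"
      using m by (intro add_left_mono mult_right_mono) auto
    finally have "ennreal (\<bar>v x\<bar> * m x) \<le> ennreal (\<delta> * m x + (C * \<delta> powr (1 - p)) * \<bar>v x\<bar> powr p)"
      by (simp add: mult.assoc ennreal_leI)
    also have "\<dots> = ennreal \<delta> * ennreal (m x) + ennreal (C * \<delta> powr (1 - p)) * ennreal (\<bar>v x\<bar> powr p)"
      using m C \<delta> by (subst ennreal_plus) (auto simp: ennreal_mult)
    finally show "ennreal (\<bar>v x\<bar> * m x) \<le> ennreal \<delta> * ennreal (m x) + ennreal (C * \<delta> powr (1 - p)) * ennreal (\<bar>v x\<bar> powr p)" .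
  qed
  also have "\<dots> = ennreal \<delta> * (\<integral>\<^sup>+x. ennreal (m x) \<partial>lborel) + ennreal (C * \<delta> powr (1 - p)) * (\<integral>\<^sup>+x. ennreal (\<bar>v x\<bar> powr p) \<partial>lborel)"
    by (simp add: nn_integral_add nn_integral_cmult)
  finally show ?thesis .
qed

text \<open>\<open>\<delta>\<close> is fixed by the mass \<open>I\<close>, and \<open>n0\<close>
  afterwards by the bound \<open>C\<close>, so the same pair works for every weight sharing these
  two numbers. This uniformity later allows two limits to be exchanged.\<close>

lemma nn_integral_weight_uniform:
  fixes X :: "nat \<Rightarrow> ennreal"
  assumes X: "X \<longlonglongrightarrow> 0" and e: "e > 0" and I: "I \<ge> 0" and C: "C \<ge> 0"
  obtains \<delta> n0 where "\<delta> > 0" "\<And>n. n \<ge> n0 \<Longrightarrow> ennreal \<delta> * ennreal I + ennreal (C * \<delta> powr (1 - p)) * X n \<le> ennreal e"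
proof -
  define \<delta> where "\<delta> = e / (2 * (I + 1))"
  define K where "K = C * \<delta> powr (1 - p)"
  have \<delta>: "\<delta> > 0" using e I by (simp add: \<delta>_def)
  have K: "K \<ge> 0" using C by (simp add: K_def)
  have "\<delta> * I \<le> e / 2"
    using e I by (simp add: \<delta>_def divide_simps; simp add: algebra_simps)
  have "ennreal (e / (2 * (K + 1))) > 0" using e K by (simp add: ennreal_less_zero_iff)
  then obtain n0 where n0: "\<And>n. n \<ge> n0 \<Longrightarrow> X n < ennreal (e / (2 * (K + 1)))"
    using order_tendstoD(2)[OF X] unfolding eventually_sequentially by metis
  show thesis
  proof (rule that[OF \<delta>])
    fix n assume "n \<ge> n0"
    have "ennreal \<delta> * ennreal I + ennreal K * X n \<le> ennreal \<delta> * ennreal I + ennreal K * ennreal (e / (2 * (K + 1)))"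
      using n0[OF \<open>n \<ge> n0\<close>] by (intro add_left_mono mult_left_mono) auto
    also have "\<dots> = ennreal (\<delta> * I + K * (e / (2 * (K + 1))))"
    proof -
      have "0 \<le> e / (2 * (K + 1))" using e K by simp
      then show ?thesis
        using \<delta> I K by (simp only: ennreal_plus ennreal_mult mult_nonneg_nonneg less_imp_le)
    qed
    also have "\<dots> \<le> ennreal e"
    proof (rule ennreal_leI)
      have "K * (e / (2 * (K + 1))) \<le> e / 2"
        using e K by (simp add: divide_simps; simp add: algebra_simps)
      with \<open>\<delta> * I \<le> e / 2\<close> show "\<delta> * I + K * (e / (2 * (K + 1))) \<le> e" by linarith
    qed
    finally show "ennreal \<delta> * ennreal I + ennreal (C * \<delta> powr (1 - p)) * X n \<le> ennreal e"
      unfolding K_def .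
  qed
qed

lemma weighted_pairing_tendsto:
  fixes d :: "nat \<Rightarrow> 'a::euclidean_space \<Rightarrow> complex"
  assumes [measurable]: "\<And>n. d n \<in> borel_measurable borel" "m \<in> borel_measurable borel"
    and d: "(\<lambda>n. weighted_sq s (d n)) \<longlonglongrightarrow> 0" and m: "weighted_sq (- s) m < \<infinity>"
  shows "(\<lambda>n. LINT \<xi>|lborel. d n \<xi> * m \<xi>) \<longlonglongrightarrow> 0"
proof (rule Lim_null_comparison)
  let ?A = "\<lambda>n. enn2real (weighted_sq s (d n))" and ?B = "enn2real (weighted_sq (- s) m)"
  have "eventually (\<lambda>n. weighted_sq s (d n) < 1) sequentially"
    using order_tendstoD(2)[OF d] by simp
  then show "eventually (\<lambda>n. norm (LINT \<xi>|lborel. d n \<xi> * m \<xi>) \<le> sqrt (?A n * ?B)) sequentially"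
  proof eventually_elim
    case (elim n)
    then have "weighted_sq s (d n) < \<infinity>" using order.strict_trans[OF elim] by simp
    then show ?case
      using m by (intro weighted_pairing(2)[where s=s]) (auto simp: less_top)
  qed
  have "?A \<longlonglongrightarrow> 0" 
    using tendsto_enn2real[of "\<lambda>n. weighted_sq s (d n)" 0 sequentially] d by simp
  then have "(\<lambda>n. sqrt (?A n * ?B)) \<longlonglongrightarrow> sqrt (0 * ?B)"
    by (intro tendsto_real_sqrt tendsto_mult tendsto_const)
  then show "(\<lambda>n. sqrt (?A n * ?B)) \<longlonglongrightarrow> 0" by simp
qed

lemma weighted_sq_diff_le:
  assumes [measurable]: "f \<in> borel_measurable borel" "g \<in> borel_measurable borel"
  shows "weighted_sq s (\<lambda>\<xi>. f \<xi> - g \<xi>) \<le> 2 * weighted_sq s f + 2 * weighted_sq s g"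
proof -
  have "weighted_sq s (\<lambda>\<xi>. f \<xi> - g \<xi>)
     \<le> (\<integral>\<^sup>+\<xi>. 2 * ennreal (norm \<xi> powr (2 * s) * (cmod (f \<xi>))\<^sup>2) + 2 * ennreal (norm \<xi> powr (2 * s) * (cmod (g \<xi>))\<^sup>2) \<partial>lborel)"
    unfolding weighted_sq_def
  proof (rule nn_integral_mono)
    fix \<xi> :: 'a
    have "(cmod (f \<xi> - g \<xi>))\<^sup>2 \<le> (cmod (f \<xi>) + cmod (g \<xi>))\<^sup>2"
      by (intro power_mono norm_triangle_ineq4) simp
    also have "\<dots> \<le> 2 * (cmod (f \<xi>))\<^sup>2 + 2 * (cmod (g \<xi>))\<^sup>2"
      using zero_le_power2[of "cmod (f \<xi>) - cmod (g \<xi>)"] by (simp add: power2_eq_square algebra_simps)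
    finally have "norm \<xi> powr (2 * s) * (cmod (f \<xi> - g \<xi>))\<^sup>2 \<le> norm \<xi> powr (2 * s) * (2 * (cmod (f \<xi>))\<^sup>2 + 2 * (cmod (g \<xi>))\<^sup>2)"
      by (rule mult_left_mono) simp
    also have "\<dots> = 2 * (norm \<xi> powr (2 * s) * (cmod (f \<xi>))\<^sup>2) + 2 * (norm \<xi> powr (2 * s) * (cmod (g \<xi>))\<^sup>2)"
      by (simp add: algebra_simps)
    also have "ennreal \<dots> = 2 * ennreal (norm \<xi> powr (2 * s) * (cmod (f \<xi>))\<^sup>2) + 2 * ennreal (norm \<xi> powr (2 * s) * (cmod (g \<xi>))\<^sup>2)"
      by (subst ennreal_plus) (auto simp: ennreal_mult)
    finally show "ennreal (norm \<xi> powr (2 * s) * (cmod (f \<xi> - g \<xi>))\<^sup>2) \<le> \<dots>"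
      by (simp add: ennreal_leI)
  qed
  also have "\<dots> = 2 * weighted_sq s f + 2 * weighted_sq s g"
    unfolding weighted_sq_def by (simp add: nn_integral_add nn_integral_cmult)
  finally show ?thesis .
qed

lemma weighted_sq_cong_AE:
  assumes "AE \<xi> in lborel. f \<xi> = g \<xi>"
  shows "weighted_sq s f = weighted_sq s g"
  unfolding weighted_sq_def using assms by (intro nn_integral_cong_AE) (auto elim: eventually_mono)

lemma nn_integral_exp_square_finite:
  "c > 0 \<Longrightarrow> (\<integral>\<^sup>+\<xi>. ennreal (exp (- c * (norm (\<xi>::'a::euclidean_space))\<^sup>2)) \<partial>lborel) < \<infinity>"
  by (subst nn_integral_eq_integral[OF integrable_exp_square]) auto

text \<open>Completeness of the weighted space. Multiplication by \<open>|\<xi>| powr s\<close> and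
  a Gaussian maps it into the integrable functions, where a Cauchy sequence has an almost everywhere
  Cauchy subsequence. The multiplier does not vanish off the origin, so the transforms themselves
  converge almost everywhere.\<close>

lemma D_approx_fourier_limit:
  fixes \<phi> :: "nat \<Rightarrow> 'a::euclidean_space \<Rightarrow> real"
  assumes s: "0 < s" "s < 2" and appr: "D_approx s \<phi> u"
  obtains U where "U \<in> borel_measurable borel" "(\<lambda>n. weighted_sq s (\<lambda>\<xi>. fourier (\<phi> n) \<xi> - U \<xi>)) \<longlonglongrightarrow> 0"
proof -
  have test: "\<phi> n \<in> test_functions UNIV" for n using appr unfolding D_approx_def by blast
  have cauchy: "\<exists>M. \<forall>m\<ge>M. \<forall>n\<ge>M. test_norm s (\<lambda>x. \<phi> m x - \<phi> n x) < e" if "e > 0" for e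
    using appr that unfolding D_approx_def by blast
  note [measurable] = test_function_measurable[OF test]
  define f where "f n = fourier (\<phi> n)" for n
  have [measurable]: "f n \<in> borel_measurable borel" for n unfolding f_def by measurable
  have f_diff: "weighted_sq s (\<lambda>\<xi>. f i \<xi> - f j \<xi>) = ennreal ((test_norm s (\<lambda>x. \<phi> i x - \<phi> j x))\<^sup>2)"
    and tn0: "test_norm s (\<lambda>x. \<phi> i x - \<phi> j x) \<ge> 0" for i j
  proof -
    note d = test_functions_diff[OF test[of i] test[of j]]
    have "(\<lambda>\<xi>. f i \<xi> - f j \<xi>) = fourier (\<lambda>x. \<phi> i x - \<phi> j x)"
      unfolding f_def by (rule ext) (simp add: fourier_diff test_function_integrable[OF test])
    then show "weighted_sq s (\<lambda>\<xi>. f i \<xi> - f j \<xi>) = ennreal ((test_norm s (\<lambda>x. \<phi> i x - \<phi> j x))\<^sup>2)"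
      using test_norm_eq(1)[OF d s] by simp
    show "test_norm s (\<lambda>x. \<phi> i x - \<phi> j x) \<ge> 0" by (rule test_norm_eq(3)[OF d s])
  qed
  define E where "E \<xi> = complex_of_real (exp (- (norm \<xi>)\<^sup>2))" for \<xi> :: 'a
  have [measurable]: "E \<in> borel_measurable borel" unfolding E_def by measurable
  define B where "B = enn2real (\<integral>\<^sup>+\<xi>. ennreal (exp (- 2 * (norm (\<xi>::'a))\<^sup>2)) \<partial>lborel)"
  have E_sq: "(\<integral>\<^sup>+\<xi>. ennreal ((cmod (E \<xi>))\<^sup>2) \<partial>lborel) \<le> ennreal B"
  proof -
    have "(\<integral>\<^sup>+\<xi>. ennreal ((cmod (E \<xi>))\<^sup>2) \<partial>lborel) = (\<integral>\<^sup>+\<xi>. ennreal (exp (- 2 * (norm (\<xi>::'a))\<^sup>2)) \<partial>lborel)"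
      by (intro nn_integral_cong) (simp add: E_def exp_double[symmetric])
    then show ?thesis unfolding B_def using nn_integral_exp_square_finite[of 2, where 'a='a] by simp
  qed
  have B0: "B \<ge> 0" by (simp add: B_def)
  define w where "w g \<xi> = (complex_of_real (norm \<xi> powr s) * g \<xi>)" for g :: "'a \<Rightarrow> complex" and \<xi>
  have w_meas [measurable]: "w g \<in> borel_measurable borel" if [measurable]: "g \<in> borel_measurable borel" for g
    unfolding w_def by measurable
  have w_sq: "(\<integral>\<^sup>+\<xi>. ennreal ((cmod (w g \<xi>))\<^sup>2) \<partial>lborel) = weighted_sq s g" for g
    unfolding weighted_sq_def w_def
    by (intro nn_integral_cong) (simp add: norm_mult power_mult_distrib power2_eq_square[of "_ powr _"] flip: powr_add)
  define h where "h n \<xi> = w (f n) \<xi> * E \<xi>" for n \<xi>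
  have h_int: "integrable lborel (h n)" for n
  proof -
    have fin: "weighted_sq s (f n) < \<infinity>" unfolding f_def by (rule test_norm_eq(2)[OF test s])
    show ?thesis unfolding h_def
      by (rule Cauchy_Schwarz_integrable(1)[OF _ _ _ _ E_sq B0, where A="enn2real (weighted_sq s (f n))"])
         (use fin in \<open>auto simp: w_sq\<close>)
  qed
  have h_diff: "(LINT \<xi>|lborel. norm (h i \<xi> - h j \<xi>)) \<le> test_norm s (\<lambda>x. \<phi> i x - \<phi> j x) * sqrt B" for i j
  proof -
    let ?tn = "test_norm s (\<lambda>x. \<phi> i x - \<phi> j x)"
    have eq: "h i \<xi> - h j \<xi> = w (\<lambda>\<xi>. f i \<xi> - f j \<xi>) \<xi> * E \<xi>" for \<xi>
      by (simp add: h_def w_def algebra_simps)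
    have "(\<integral>\<^sup>+\<xi>. ennreal (norm (h i \<xi> - h j \<xi>)) \<partial>lborel) \<le> ennreal (sqrt (?tn\<^sup>2 * B))"
      unfolding eq
      by (rule Cauchy_Schwarz_integrable(2)[OF _ _ _ _ E_sq B0]) (auto simp: w_sq f_diff)
    also have "sqrt (?tn\<^sup>2 * B) = ?tn * sqrt B"
      using tn0 by (simp add: real_sqrt_mult)
    also have "(\<integral>\<^sup>+\<xi>. ennreal (norm (h i \<xi> - h j \<xi>)) \<partial>lborel) = ennreal (LINT \<xi>|lborel. norm (h i \<xi> - h j \<xi>))"
      using h_int by (intro nn_integral_eq_integral) auto
    finally show ?thesis using tn0 B0 by (subst (asm) ennreal_le_iff) auto
  qed
  obtain r where r: "strict_mono r" "AE \<xi> in lborel. Cauchy (\<lambda>k. h (r k) \<xi>)"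
  proof (rule cauchy_L1_AE_cauchy_subseq[OF h_int])
    fix e :: real assume e: "e > 0"
    then obtain M where M: "\<And>m n. m \<ge> M \<Longrightarrow> n \<ge> M \<Longrightarrow> test_norm s (\<lambda>x. \<phi> m x - \<phi> n x) < e / (sqrt B + 1)"
      using cauchy[of "e / (sqrt B + 1)"] B0 by (auto simp: add_nonneg_pos)
    have "(LINT \<xi>|lborel. norm (h i \<xi> - h j \<xi>)) < e" if "i \<ge> M" "j \<ge> M" for i j
    proof -
      have "(LINT \<xi>|lborel. norm (h i \<xi> - h j \<xi>)) \<le> test_norm s (\<lambda>x. \<phi> i x - \<phi> j x) * sqrt B"
        by (rule h_diff)
      also have "\<dots> \<le> test_norm s (\<lambda>x. \<phi> i x - \<phi> j x) * (sqrt B + 1)"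
        using tn0 by (intro mult_left_mono) auto
      also have "\<dots> < e / (sqrt B + 1) * (sqrt B + 1)"
        using M[OF that] B0 by (intro mult_strict_right_mono) (auto simp: add_nonneg_pos)
      also have "\<dots> = e" using B0 by (simp add: add_nonneg_eq_0_iff)
      finally show ?thesis .
    qed
    then show "\<exists>N. \<forall>i\<ge>N. \<forall>j\<ge>N. (LINT \<xi>|lborel. norm (h i \<xi> - h j \<xi>)) < e" by blast
  qed
  define U where "U \<xi> = lim (\<lambda>k. f (r k) \<xi>)" for \<xi>
  have U_meas [measurable]: "U \<in> borel_measurable borel"
    unfolding U_def by (rule borel_measurable_lim_metric) measurable
  have ae0: "AE \<xi>::'a in lborel. \<xi> \<noteq> 0"
    by (rule AE_lborel_if_not_negligible[of "{0}"]) auto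
  have lim: "AE \<xi> in lborel. (\<lambda>k. f (r k) \<xi>) \<longlonglongrightarrow> U \<xi>"
    using r(2) ae0
  proof eventually_elim
    case (elim \<xi>)
    let ?c = "complex_of_real (norm \<xi> powr s) * E \<xi>"
    have c: "?c \<noteq> 0" using elim(2) by (simp add: E_def)
    obtain l where "(\<lambda>k. h (r k) \<xi>) \<longlonglongrightarrow> l"
      using elim(1) Cauchy_convergent_iff convergent_def by blast
    then have "(\<lambda>k. h (r k) \<xi> / ?c) \<longlonglongrightarrow> l / ?c"
      using c by (intro tendsto_divide tendsto_const)
    moreover have "h (r k) \<xi> / ?c = f (r k) \<xi>" for k
      using c by (simp add: h_def w_def)
    ultimately have "(\<lambda>k. f (r k) \<xi>) \<longlonglongrightarrow> l / ?c" by simp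
    then show ?case unfolding U_def by (simp add: limI)
  qed
  have "(\<lambda>n. weighted_sq s (\<lambda>\<xi>. f n \<xi> - U \<xi>)) \<longlonglongrightarrow> 0"
  proof (rule ennreal_tendsto_0I)
    fix e :: real assume e: "e > 0"
    obtain M where M: "\<And>m n. m \<ge> M \<Longrightarrow> n \<ge> M \<Longrightarrow> test_norm s (\<lambda>x. \<phi> m x - \<phi> n x) < sqrt e"
      using cauchy[of "sqrt e"] e by auto
    show "eventually (\<lambda>n. weighted_sq s (\<lambda>\<xi>. f n \<xi> - U \<xi>) \<le> ennreal e) sequentially"
      unfolding eventually_sequentially
    proof (intro exI allI impI)
      fix n assume n: "n \<ge> M"
      \<comment> \<open>With \<open>n\<close> fixed, Fatou along the subsequence turns the Cauchy
        bound into a bound for the distance to \<open>U\<close>; hence the whole sequence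
        converges.\<close>
      show "weighted_sq s (\<lambda>\<xi>. f n \<xi> - U \<xi>) \<le> ennreal e"
        unfolding weighted_sq_def
      proof (rule nn_integral_le_of_tendsto)
        show "AE \<xi> in lborel. (\<lambda>k. ennreal (norm \<xi> powr (2 * s) * (cmod (f n \<xi> - f (r k) \<xi>))\<^sup>2))
           \<longlonglongrightarrow> ennreal (norm \<xi> powr (2 * s) * (cmod (f n \<xi> - U \<xi>))\<^sup>2)"
          using lim by eventually_elim (intro tendsto_intros tendsto_ennrealI)
        show "eventually (\<lambda>k. (\<integral>\<^sup>+\<xi>. ennreal (norm \<xi> powr (2 * s) * (cmod (f n \<xi> - f (r k) \<xi>))\<^sup>2) \<partial>lborel) \<le> ennreal e) sequentially"
          unfolding eventually_sequentially
        proof (intro exI allI impI)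
          fix k assume "k \<ge> M"
          then have rk: "r k \<ge> M" using seq_suble[OF r(1), of k] by linarith
          have "(test_norm s (\<lambda>x. \<phi> n x - \<phi> (r k) x))\<^sup>2 \<le> (sqrt e)\<^sup>2"
            using M[OF n rk] tn0 by (intro power_mono) auto
          then show "(\<integral>\<^sup>+\<xi>. ennreal (norm \<xi> powr (2 * s) * (cmod (f n \<xi> - f (r k) \<xi>))\<^sup>2) \<partial>lborel) \<le> ennreal e"
            using e unfolding weighted_sq_def[symmetric] f_diff by (auto intro: ennreal_leI)
        qed
      qed measurable
    qed
  qed
  then show thesis using that[OF U_meas] unfolding f_def by blast
qed

section \<open>The chosen transform \<open>D_fourier\<close> and its value on test functions\<close>

lemma complex_borel_version:
  fixes U :: "'a::euclidean_space \<Rightarrow> complex"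
  assumes [measurable]: "U \<in> borel_measurable lebesgue"
  obtains V where "V \<in> borel_measurable borel" "AE x in lborel. U x = V x"
proof -
  have "(\<lambda>x. Re (U x)) \<in> borel_measurable lebesgue" "(\<lambda>x. Im (U x)) \<in> borel_measurable lebesgue"
    by measurable
  then obtain R I where RI: "R \<in> borel_measurable lborel" "AE x in lborel. Re (U x) = R x"
    "I \<in> borel_measurable lborel" "AE x in lborel. Im (U x) = I x"
    by (blast dest: completion_ex_borel_measurable_real)
  have [measurable]: "R \<in> borel_measurable borel" "I \<in> borel_measurable borel" using RI by simp_all
  show thesis
  proof (rule that)
    show "(\<lambda>x. complex_of_real (R x) + \<i> * complex_of_real (I x)) \<in> borel_measurable borel" by measurable
    show "AE x in lborel. U x = complex_of_real (R x) + \<i> * complex_of_real (I x)"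
      using RI(2,4) by eventually_elim (simp add: complex_eq_iff)
  qed
qed

text \<open>By completeness the choice is not vacuous. The sequence \<open>\<phi>\<close> obtained
  is whichever belongs to the chosen function, not the given \<open>\<phi>0\<close>;
  \<open>V\<close> is a Borel version that spares working in the completed measure.\<close>

lemma D_fourier_spec:
  fixes u :: "'a::euclidean_space \<Rightarrow> real"
  assumes s: "0 < s" "s < 2" and appr: "D_approx s \<phi>0 u"
  obtains V \<phi> where "D_fourier s u \<in> borel_measurable lebesgue"
    "V \<in> borel_measurable borel" "AE \<xi> in lborel. D_fourier s u \<xi> = V \<xi>"
    "D_approx s \<phi> u" "(\<lambda>n. weighted_sq s (\<lambda>\<xi>. fourier (\<phi> n) \<xi> - V \<xi>)) \<longlonglongrightarrow> 0"
proof -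
  let ?P = "\<lambda>U. U \<in> borel_measurable lebesgue \<and> (\<exists>\<phi>. D_approx s \<phi> u \<and>
       (\<lambda>n. \<integral>\<^sup>+ \<xi>. ennreal (norm \<xi> powr (2 * s) * (cmod (fourier (\<phi> n) \<xi> - U \<xi>))\<^sup>2) \<partial>lebesgue) \<longlonglongrightarrow> 0)"
  obtain U where U: "U \<in> borel_measurable borel" "(\<lambda>n. weighted_sq s (\<lambda>\<xi>. fourier (\<phi>0 n) \<xi> - U \<xi>)) \<longlonglongrightarrow> 0"
    by (rule D_approx_fourier_limit[OF s appr])
  have "?P U"
  proof (intro conjI exI[of _ \<phi>0] appr)
    show "U \<in> borel_measurable lebesgue" using U(1) by (intro measurable_completion) simp
    show "(\<lambda>n. \<integral>\<^sup>+ \<xi>. ennreal (norm \<xi> powr (2 * s) * (cmod (fourier (\<phi>0 n) \<xi> - U \<xi>))\<^sup>2) \<partial>lebesgue) \<longlonglongrightarrow> 0"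
      using U(2) unfolding weighted_sq_def nn_integral_completion .
  qed
  then have "?P (SOME U. ?P U)"
    by (rule someI[of ?P])
  then have P: "?P (D_fourier s u)"
    unfolding D_fourier_def .
  obtain V where V: "V \<in> borel_measurable borel" "AE \<xi> in lborel. D_fourier s u \<xi> = V \<xi>"
    by (rule complex_borel_version[OF conjunct1[OF P]])
  obtain \<phi> where \<phi>: "D_approx s \<phi> u"
    "(\<lambda>n. \<integral>\<^sup>+ \<xi>. ennreal (norm \<xi> powr (2 * s) * (cmod (fourier (\<phi> n) \<xi> - D_fourier s u \<xi>))\<^sup>2) \<partial>lebesgue) \<longlonglongrightarrow> 0"
    using conjunct2[OF P] by blast
  show thesis
  proof (rule that[OF conjunct1[OF P] V \<phi>(1)])
    have "weighted_sq s (\<lambda>\<xi>. fourier (\<phi> n) \<xi> - V \<xi>) = weighted_sq s (\<lambda>\<xi>. fourier (\<phi> n) \<xi> - D_fourier s u \<xi>)" for n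
      using V(2) by (intro weighted_sq_cong_AE) (auto elim: eventually_mono)
    then show "(\<lambda>n. weighted_sq s (\<lambda>\<xi>. fourier (\<phi> n) \<xi> - V \<xi>)) \<longlonglongrightarrow> 0"
      using \<phi>(2) unfolding weighted_sq_def nn_integral_completion by simp
  qed
qed

text \<open>The exponential \<open>exp (i z \<bullet> \<xi> - t \<bar>\<xi>\<bar>\<^sup>2)\<close> at the complex point \<open>z = a + i b\<close>.\<close>

abbreviation gauss_exp :: "real \<Rightarrow> 'a::euclidean_space \<Rightarrow> 'a \<Rightarrow> 'a \<Rightarrow> complex" where
  "gauss_exp t a b \<xi> \<equiv> complex_of_real (exp (- t * (norm \<xi>)\<^sup>2 - b \<bullet> \<xi>)) * iexp (a \<bullet> \<xi>)"

text \<open>The finite dual norm is what gives meaning to pairings with \<open>Y\<close> at complex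
  points; the majorant involves \<open>b\<close> only through \<open>R\<close>.\<close>

lemma weighted_sq_gauss_exp:
  fixes a b :: "'a::euclidean_space"
  assumes s: "0 < s" "2 * s < real DIM('a)" and t: "t > 0" and b: "norm b \<le> R"
  shows "weighted_sq (- s) (gauss_exp t a b) \<le> (\<integral>\<^sup>+\<xi>. ennreal (norm (\<xi>::'a) powr (- 2 * s) * exp (2 * R * norm \<xi> - 2 * t * (norm \<xi>)\<^sup>2)) \<partial>lborel)"
    and "weighted_sq (- s) (gauss_exp t a b) < \<infinity>"
proof -
  show *: "weighted_sq (- s) (gauss_exp t a b) \<le> (\<integral>\<^sup>+\<xi>. ennreal (norm (\<xi>::'a) powr (- 2 * s) * exp (2 * R * norm \<xi> - 2 * t * (norm \<xi>)\<^sup>2)) \<partial>lborel)"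
    unfolding weighted_sq_def
  proof (intro nn_integral_mono ennreal_leI)
    fix \<xi> :: 'a
    have "\<bar>b \<bullet> \<xi>\<bar> \<le> R * norm \<xi>"
      using Cauchy_Schwarz_ineq2[of b \<xi>] b by (meson mult_right_mono norm_ge_zero order.trans)
    then have "2 * (- t * (norm \<xi>)\<^sup>2 - b \<bullet> \<xi>) \<le> 2 * R * norm \<xi> - 2 * t * (norm \<xi>)\<^sup>2"
      by (simp add: abs_le_iff algebra_simps)
    then have "(cmod (gauss_exp t a b \<xi>))\<^sup>2 \<le> exp (2 * R * norm \<xi> - 2 * t * (norm \<xi>)\<^sup>2)"
      by (simp add: norm_mult flip: exp_double)
    then show "norm \<xi> powr (2 * - s) * (cmod (gauss_exp t a b \<xi>))\<^sup>2 \<le> norm \<xi> powr (- 2 * s) * exp (2 * R * norm \<xi> - 2 * t * (norm \<xi>)\<^sup>2)"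
      by (simp add: mult_left_mono)
  qed
  also have "\<dots> < \<infinity>"
    using nn_integral_singular_gaussian_exp[OF s, of "2 * t" "2 * R"] t by simp
  finally show "weighted_sq (- s) (gauss_exp t a b) < \<infinity>" .
qed

text \<open>Pairing with \<open>gauss_exp t x 0\<close> evaluates the heat flow of
  \<open>\<phi>\<close> at \<open>x\<close>, up to \<open>(2 * pi) ^ N\<close>; the conjugate
  matches the sign convention of \<open>fourier\<close>.\<close>

lemma integral_cnj_FT_gaussian:
  fixes \<phi> :: "'a::euclidean_space \<Rightarrow> real"
  assumes \<phi>: "integrable lborel \<phi>" and t: "t > 0"
  shows "(LINT \<xi>|lborel. cnj (FT (\<lambda>x. complex_of_real (\<phi> x)) \<xi>) * gauss_exp t x 0 \<xi>)
     = complex_of_real ((2 * pi) ^ DIM('a) * (LINT y|lborel. heat_kernel t (y - x) * \<phi> y))"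
proof -
  let ?w = "\<lambda>x. complex_of_real (\<phi> x)"
  have w: "integrable lborel ?w" using \<phi> by (simp only: complex_of_real_integrable_eq)
  let ?g = "\<lambda>\<xi>. complex_of_real (exp (- t * (norm \<xi>)\<^sup>2)) * iexp (\<xi> \<bullet> (- x))"
  have "(LINT \<xi>|lborel. cnj (FT ?w \<xi>) * gauss_exp t x 0 \<xi>) = (LINT \<xi>|lborel. cnj (FT ?w \<xi> * ?g \<xi>))"
    by (intro Bochner_Integration.integral_cong refl) (simp add: exp_cnj inner_commute)
  also have "\<dots> = cnj (LINT \<xi>|lborel. FT ?w \<xi> * ?g \<xi>)"
    by (rule Bochner_Integration.integral_cnj)
  also have "(LINT \<xi>|lborel. FT ?w \<xi> * ?g \<xi>) = (LINT y|lborel. ?w y * FT ?g y)"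
    by (rule integral_FT_mult[OF w integrable_gaussian_iexp[OF t]])
  also have "\<dots> = (LINT y|lborel. complex_of_real ((2 * pi) ^ DIM('a) * (heat_kernel t (y - x) * \<phi> y)))"
    unfolding FT_gaussian_shift[OF t] by (intro Bochner_Integration.integral_cong refl) (simp add: mult_ac)
  also have "\<dots> = complex_of_real ((2 * pi) ^ DIM('a) * (LINT y|lborel. heat_kernel t (y - x) * \<phi> y))"
    by (simp only: integral_complex_of_real Bochner_Integration.integral_mult_right_zero)
  finally show ?thesis by simp
qed

lemma heat_kernel_le: "t > 0 \<Longrightarrow> heat_kernel t (x::'a::euclidean_space) \<le> (4 * pi * t) powr (- (real DIM('a) / 2))"
  unfolding heat_kernel_def by (simp add: mult_le_cancel_left1)

text \<open>The kernel is a bounded weight of mass one, so the splitting of \<open>L^p\<close>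
  quantities applies with this weight.\<close>

lemma heat_convolution_Lp_tendsto_0:
  fixes v :: "nat \<Rightarrow> 'a::euclidean_space \<Rightarrow> real"
  assumes [measurable]: "\<And>n. v n \<in> borel_measurable borel" and t: "t > 0" and p: "p \<ge> 1"
    and lim: "(\<lambda>n. \<integral>\<^sup>+x. ennreal (\<bar>v n x\<bar> powr p) \<partial>lborel) \<longlonglongrightarrow> 0"
  shows "(\<lambda>n. LINT y|lborel. heat_kernel t (y - x) * v n y) \<longlonglongrightarrow> 0"
proof (rule LIMSEQ_I)
  fix e :: real assume e: "e > 0"
  define C where "C = (4 * pi * t) powr (- (real DIM('a) / 2))"
  obtain \<delta> n0 where \<delta>: "\<delta> > 0" and n0: "\<And>n. n \<ge> n0 \<Longrightarrow>
      ennreal \<delta> * ennreal 1 + ennreal (C * \<delta> powr (1 - p)) * (\<integral>\<^sup>+x. ennreal (\<bar>v n x\<bar> powr p) \<partial>lborel) \<le> ennreal (e / 2)"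
    by (rule nn_integral_weight_uniform[OF lim, of "e / 2" 1 C p]) (use e in \<open>auto simp: C_def\<close>)
  show "\<exists>n0. \<forall>n\<ge>n0. norm ((LINT y|lborel. heat_kernel t (y - x) * v n y) - 0) < e"
  proof (intro exI allI impI)
    fix n assume n: "n \<ge> n0"
    have "ennreal (norm (LINT y|lborel. heat_kernel t (y - x) * v n y)) \<le> (\<integral>\<^sup>+y. ennreal (norm (heat_kernel t (y - x) * v n y)) \<partial>lborel)"
      by (rule ennreal_norm_integral_le)
    also have "\<dots> = (\<integral>\<^sup>+y. ennreal (\<bar>v n y\<bar> * heat_kernel t (y - x)) \<partial>lborel)"
      using heat_kernel_pos[OF t, where 'a='a] by (intro nn_integral_cong) (simp add: abs_mult abs_of_pos mult.commute)
    also have "\<dots> \<le> ennreal \<delta> * (\<integral>\<^sup>+y. ennreal (heat_kernel t (y - x)) \<partial>lborel) + ennreal (C * \<delta> powr (1 - p)) * (\<integral>\<^sup>+x. ennreal (\<bar>v n x\<bar> powr p) \<partial>lborel)"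
      by (rule nn_integral_weight_le_powr[OF _ _ _ _ \<delta> p])
         (use heat_kernel_pos[OF t, where 'a='a] heat_kernel_le[OF t, where 'a='a] in \<open>auto simp: C_def less_imp_le\<close>)
    also have "\<dots> \<le> ennreal (e / 2)"
      using n0[OF n] by (simp add: nn_integral_heat_kernel(1)[OF t])
    finally show "norm ((LINT y|lborel. heat_kernel t (y - x) * v n y) - 0) < e"
      using e by (simp add: ennreal_le_iff)
  qed
qed

lemma D_approx_const:
  fixes \<psi> :: "'a::euclidean_space \<Rightarrow> real"
  assumes "\<psi> \<in> test_functions UNIV"
  shows "D_approx s (\<lambda>_. \<psi>) \<psi>"
proof -
  have "test_norm s (\<lambda>x::'a. 0) = 0"
    by (simp add: test_norm_def test_inner_def fourier_def)
  then show ?thesis using assms by (simp add: D_approx_def)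
qed

text \<open>\<open>D_fourier\<close> of a test function is some limit along some sequence, so its
  agreement with the classical transform needs proof. The sequence minus \<open>\<psi>\<close> tends
  to zero in \<open>L^p\<close>, while its transforms tend to \<open>H = V - fourier \<psi>\<close>.
  Pairing both limits with heat kernels shows that \<open>H\<close> times a Gaussian has vanishing
  transform, and injectivity gives \<open>H = 0\<close> almost everywhere.\<close>

lemma D_fourier_test_function:
  fixes \<psi> :: "'a::euclidean_space \<Rightarrow> real"
  assumes s: "0 < s" "s < 2" "2 * s < real DIM('a)" and \<psi>: "\<psi> \<in> test_functions \<Omega>"
  shows "AE \<xi> in lborel. D_fourier s \<psi> \<xi> = fourier \<psi> \<xi>"
proof -
  note \<psi>' = test_functions_mono[OF \<psi>]
  define p where "p = 2 * real DIM('a) / (real DIM('a) - 2 * s)"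
  have p: "p \<ge> 1" using s by (simp add: p_def)
  obtain V \<phi> where "D_fourier s \<psi> \<in> borel_measurable lebesgue" and V [measurable]: "V \<in> borel_measurable borel" and ae: "AE \<xi> in lborel. D_fourier s \<psi> \<xi> = V \<xi>"
    and appr: "D_approx s \<phi> \<psi>" and lim: "(\<lambda>n. weighted_sq s (\<lambda>\<xi>. fourier (\<phi> n) \<xi> - V \<xi>)) \<longlonglongrightarrow> 0"
    by (rule D_fourier_spec[OF s(1,2) D_approx_const[OF \<psi>']])
  have test: "\<phi> n \<in> test_functions UNIV" for n using appr unfolding D_approx_def by blast
  note [measurable] = test_function_measurable[OF test] test_function_measurable[OF \<psi>]
  define c where "c = complex_of_real ((2 * pi) powr (- (real DIM('a) / 2)))"
  define v where "v n x = \<phi> n x - \<psi> x" for n x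
  have v_test: "v n \<in> test_functions UNIV" for n
    unfolding v_def by (rule test_functions_diff[OF test \<psi>'])
  note [measurable] = test_function_measurable[OF v_test]
  have v_lim: "(\<lambda>n. \<integral>\<^sup>+x. ennreal (\<bar>v n x\<bar> powr p) \<partial>lborel) \<longlonglongrightarrow> 0"
    using appr unfolding D_approx_def v_def p_def nn_integral_completion by blast
  define H where "H \<xi> = V \<xi> - fourier \<psi> \<xi>" for \<xi>
  have [measurable]: "H \<in> borel_measurable borel" unfolding H_def by measurable
  have fv: "fourier (v n) \<xi> - H \<xi> = fourier (\<phi> n) \<xi> - V \<xi>" for n \<xi>
    unfolding v_def H_def
    by (simp add: fourier_diff[OF test_function_integrable[OF test] test_function_integrable[OF \<psi>]])
  have H_lim: "(\<lambda>n. weighted_sq s (\<lambda>\<xi>. fourier (v n) \<xi> - H \<xi>)) \<longlonglongrightarrow> 0"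
    unfolding fv by (rule lim)
  have H_fin: "weighted_sq s H < \<infinity>"
  proof -
    have "eventually (\<lambda>n. weighted_sq s (\<lambda>\<xi>. fourier (v n) \<xi> - H \<xi>) < 1) sequentially"
      using order_tendstoD(2)[OF H_lim] by simp
    then obtain n where n: "weighted_sq s (\<lambda>\<xi>. fourier (v n) \<xi> - H \<xi>) < 1"
      using eventually_happens by force
    have "weighted_sq s H = weighted_sq s (\<lambda>\<xi>. fourier (v n) \<xi> - (fourier (v n) \<xi> - H \<xi>))" by simp
    also have "\<dots> \<le> 2 * weighted_sq s (fourier (v n)) + 2 * weighted_sq s (\<lambda>\<xi>. fourier (v n) \<xi> - H \<xi>)"
      by (rule weighted_sq_diff_le) measurable
    also have "\<dots> < \<infinity>"
      using order.strict_trans[OF n, of \<infinity>] test_norm_eq(2)[OF v_test s(1,2)] by (simp add: ennreal_mult_less_top)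
    finally show ?thesis .
  qed
  have g_fin: "weighted_sq (- s) (gauss_exp 1 x 0) < \<infinity>" for x :: 'a
    by (rule weighted_sq_gauss_exp(2)[OF s(1,3), of _ _ 0]) auto
  have pair_int: "integrable lborel (\<lambda>\<xi>. f \<xi> * gauss_exp 1 x 0 \<xi>)"
    if "f \<in> borel_measurable borel" "weighted_sq s f < \<infinity>" for f and x :: 'a
    by (rule weighted_pairing(1)[where s=s and A="enn2real (weighted_sq s f)" and B="enn2real (weighted_sq (- s) (gauss_exp 1 x 0))"])
       (use that g_fin[of x] in \<open>auto simp: less_top\<close>)
  have zero: "(LINT \<xi>|lborel. H \<xi> * gauss_exp 1 x 0 \<xi>) = 0" for x
  proof -
    let ?m = "gauss_exp 1 x 0"
    have "(\<lambda>n. LINT \<xi>|lborel. (fourier (v n) \<xi> - H \<xi>) * ?m \<xi>) \<longlonglongrightarrow> 0"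
      by (rule weighted_pairing_tendsto[OF _ _ H_lim g_fin]) measurable
    moreover have "(\<lambda>n. LINT \<xi>|lborel. fourier (v n) \<xi> * ?m \<xi>) \<longlonglongrightarrow> c * complex_of_real ((2 * pi) ^ DIM('a) * 0)"
    proof -
      have "(LINT \<xi>|lborel. fourier (v n) \<xi> * ?m \<xi>) = c * complex_of_real ((2 * pi) ^ DIM('a) * (LINT y|lborel. heat_kernel 1 (y - x) * v n y))" for n
      proof -
        have "(LINT \<xi>|lborel. fourier (v n) \<xi> * ?m \<xi>) = (LINT \<xi>|lborel. c * (cnj (FT (\<lambda>x. complex_of_real (v n x)) \<xi>) * ?m \<xi>))"
          by (intro Bochner_Integration.integral_cong refl) (simp add: fourier_eq_FT c_def mult.assoc)
        also have "\<dots> = c * (LINT \<xi>|lborel. cnj (FT (\<lambda>x. complex_of_real (v n x)) \<xi>) * ?m \<xi>)"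
          by (rule Bochner_Integration.integral_mult_right_zero)
        finally show ?thesis
          unfolding integral_cnj_FT_gaussian[OF test_function_integrable[OF v_test] zero_less_one] .
      qed
      moreover have "(\<lambda>n. LINT y|lborel. heat_kernel 1 (y - x) * v n y) \<longlonglongrightarrow> 0"
        by (rule heat_convolution_Lp_tendsto_0[OF _ _ p v_lim]) auto
      ultimately show ?thesis by (simp only:) (intro tendsto_intros)
    qed
    ultimately have "(\<lambda>n. (LINT \<xi>|lborel. fourier (v n) \<xi> * ?m \<xi>) - (LINT \<xi>|lborel. (fourier (v n) \<xi> - H \<xi>) * ?m \<xi>)) \<longlonglongrightarrow> 0"
      using tendsto_diff by fastforce
    moreover have "(LINT \<xi>|lborel. fourier (v n) \<xi> * ?m \<xi>) - (LINT \<xi>|lborel. (fourier (v n) \<xi> - H \<xi>) * ?m \<xi>) = (LINT \<xi>|lborel. H \<xi> * ?m \<xi>)" for n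
    proof -
      have "(LINT \<xi>|lborel. (fourier (v n) \<xi> - H \<xi>) * ?m \<xi>) = (LINT \<xi>|lborel. fourier (v n) \<xi> * ?m \<xi>) - (LINT \<xi>|lborel. H \<xi> * ?m \<xi>)"
        unfolding left_diff_distrib
        by (rule Bochner_Integration.integral_diff; rule pair_int) (use H_fin test_norm_eq(2)[OF v_test s(1,2)] in auto)
      then show ?thesis by simp
    qed
    ultimately show ?thesis by (simp add: LIMSEQ_const_iff)
  qed
  have "AE \<xi> in lborel. H \<xi> * complex_of_real (exp (- (norm \<xi>)\<^sup>2)) = 0"
  proof (rule FT_eq_zero_imp_AE_zero)
    show "integrable lborel (\<lambda>\<xi>. H \<xi> * complex_of_real (exp (- (norm \<xi>)\<^sup>2)))"
      using pair_int[of H 0] H_fin by simp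
    show "FT (\<lambda>\<xi>. H \<xi> * complex_of_real (exp (- (norm \<xi>)\<^sup>2))) x = 0" for x
      using zero[of x] unfolding FT_def by (simp add: mult.assoc inner_commute)
  qed
  then show ?thesis
    using ae by eventually_elim (simp add: H_def)
qed

text \<open>The hypothesis stripped of conventions: Borel representatives, the measure
  \<open>lborel\<close>, and \<open>Y = k * V\<close> scaled so that the constant in
  \<open>fourier\<close> disappears. The equation is tested with \<open>FT\<close>, since the
  conjugate in \<open>D_inner\<close> cancels the one in \<open>fourier\<close>.\<close>

lemma frac_harmonic_representation:
  fixes u :: "'a::euclidean_space \<Rightarrow> real"
  assumes s: "0 < s" "s < 2" "2 * s < real DIM('a)" and harm: "frac_harmonic s \<Omega> u"
  obtains u' Y \<phi> where "u' \<in> borel_measurable borel" "AE x in lborel. u x = u' x"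
    "Y \<in> borel_measurable borel" "weighted_sq s Y < \<infinity>" "\<And>n. \<phi> n \<in> test_functions UNIV"
    "(\<lambda>n. \<integral>\<^sup>+x. ennreal (\<bar>\<phi> n x - u' x\<bar> powr (2 * real DIM('a) / (real DIM('a) - 2 * s))) \<partial>lborel) \<longlonglongrightarrow> 0"
    "(\<lambda>n. weighted_sq s (\<lambda>\<xi>. cnj (FT (\<lambda>x. complex_of_real (\<phi> n x)) \<xi>) - Y \<xi>)) \<longlonglongrightarrow> 0"
    "\<And>\<psi>. \<psi> \<in> test_functions \<Omega> \<Longrightarrow>
       (LINT \<xi>|lborel. complex_of_real (norm \<xi> powr (2 * s)) * Y \<xi> * FT (\<lambda>x. complex_of_real (\<psi> x)) \<xi>) = 0"
proof -
  have "u \<in> borel_measurable lebesgue" "\<exists>\<phi>. D_approx s \<phi> u"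
    using harm unfolding frac_harmonic_def D_space_def by auto
  then obtain \<phi>0 where appr0: "D_approx s \<phi>0 u" by blast
  obtain u' where u': "u' \<in> borel_measurable borel" "AE x in lborel. u x = u' x"
    using completion_ex_borel_measurable_real[OF \<open>u \<in> borel_measurable lebesgue\<close>] by auto
  obtain V \<phi> where Du [measurable]: "D_fourier s u \<in> borel_measurable lebesgue" and V [measurable]: "V \<in> borel_measurable borel" and ae: "AE \<xi> in lborel. D_fourier s u \<xi> = V \<xi>"
    and appr: "D_approx s \<phi> u" and lim: "(\<lambda>n. weighted_sq s (\<lambda>\<xi>. fourier (\<phi> n) \<xi> - V \<xi>)) \<longlonglongrightarrow> 0"
    by (rule D_fourier_spec[OF s(1,2) appr0])
  have test: "\<phi> n \<in> test_functions UNIV" for n using appr unfolding D_approx_def by blast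
  note [measurable] = test_function_measurable[OF test]
  define k where "k = complex_of_real ((2 * pi) powr (real DIM('a) / 2))"
  define c where "c = complex_of_real ((2 * pi) powr (- (real DIM('a) / 2)))"
  have ck: "k * c = 1" "c \<noteq> 0" by (auto simp: k_def c_def powr_minus)
  define Y where "Y \<xi> = k * V \<xi>" for \<xi>
  have Y_meas [measurable]: "Y \<in> borel_measurable borel" unfolding Y_def by measurable
  have four: "fourier \<psi> \<xi> = c * cnj (FT (\<lambda>x. complex_of_real (\<psi> x)) \<xi>)" if "\<psi> \<in> borel_measurable borel" for \<psi> :: "'a \<Rightarrow> real" and \<xi>
    unfolding c_def by (rule fourier_eq_FT[OF that])
  have kf: "k * fourier \<psi> \<xi> = cnj (FT (\<lambda>x. complex_of_real (\<psi> x)) \<xi>)" if "\<psi> \<in> borel_measurable borel" for \<psi> :: "'a \<Rightarrow> real" and \<xi>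
    unfolding four[OF that] mult.assoc[symmetric] ck by simp
  have Y_lim: "(\<lambda>n. weighted_sq s (\<lambda>\<xi>. cnj (FT (\<lambda>x. complex_of_real (\<phi> n x)) \<xi>) - Y \<xi>)) \<longlonglongrightarrow> 0"
  proof -
    have "weighted_sq s (\<lambda>\<xi>. cnj (FT (\<lambda>x. complex_of_real (\<phi> n x)) \<xi>) - Y \<xi>) = ennreal ((cmod k)\<^sup>2) * weighted_sq s (\<lambda>\<xi>. fourier (\<phi> n) \<xi> - V \<xi>)" for n
      unfolding Y_def kf[OF test_function_measurable[OF test], symmetric] right_diff_distrib[symmetric]
      by (rule weighted_sq_cmult) measurable
    moreover have "(\<lambda>n. ennreal ((cmod k)\<^sup>2) * weighted_sq s (\<lambda>\<xi>. fourier (\<phi> n) \<xi> - V \<xi>)) \<longlonglongrightarrow> ennreal ((cmod k)\<^sup>2) * 0"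
      by (rule ennreal_tendsto_cmult[OF _ lim]) simp
    ultimately show ?thesis by simp
  qed
  have Y_fin: "weighted_sq s Y < \<infinity>"
  proof -
    let ?f = "\<lambda>n \<xi>. cnj (FT (\<lambda>x. complex_of_real (\<phi> n x)) \<xi>)"
    have "eventually (\<lambda>n. weighted_sq s (\<lambda>\<xi>. ?f n \<xi> - Y \<xi>) < 1) sequentially"
      using order_tendstoD(2)[OF Y_lim] by simp
    then obtain n where n: "weighted_sq s (\<lambda>\<xi>. ?f n \<xi> - Y \<xi>) < 1"
      using eventually_happens by force
    have "weighted_sq s Y = weighted_sq s (\<lambda>\<xi>. ?f n \<xi> - (?f n \<xi> - Y \<xi>))" by simp
    also have "\<dots> \<le> 2 * weighted_sq s (?f n) + 2 * weighted_sq s (\<lambda>\<xi>. ?f n \<xi> - Y \<xi>)"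
      by (rule weighted_sq_diff_le) measurable
    also have "\<dots> < \<infinity>"
      using order.strict_trans[OF n, of \<infinity>] test_function_FT_finite[OF test s(1,2), of n]
      by (simp add: ennreal_mult_less_top weighted_sq_cnj weighted_sq_def)
    finally show ?thesis .
  qed
  show thesis
  proof (rule that[OF u' Y_meas Y_fin test _ Y_lim])
    show "(\<lambda>n. \<integral>\<^sup>+x. ennreal (\<bar>\<phi> n x - u' x\<bar> powr (2 * real DIM('a) / (real DIM('a) - 2 * s))) \<partial>lborel) \<longlonglongrightarrow> 0"
    proof -
      have "(\<integral>\<^sup>+x. ennreal (\<bar>\<phi> n x - u' x\<bar> powr (2 * real DIM('a) / (real DIM('a) - 2 * s))) \<partial>lborel)
         = (\<integral>\<^sup>+x. ennreal (\<bar>\<phi> n x - u x\<bar> powr (2 * real DIM('a) / (real DIM('a) - 2 * s))) \<partial>lebesgue)" for n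
        unfolding nn_integral_completion using u'(2) by (intro nn_integral_cong_AE) (auto elim: eventually_mono)
      then show ?thesis using appr unfolding D_approx_def by simp
    qed
    show "(LINT \<xi>|lborel. complex_of_real (norm \<xi> powr (2 * s)) * Y \<xi> * FT (\<lambda>x. complex_of_real (\<psi> x)) \<xi>) = 0"
      if \<psi>: "\<psi> \<in> test_functions \<Omega>" for \<psi>
    proof -
      note [measurable] = test_function_measurable[OF \<psi>]
      let ?w = "\<lambda>\<xi>::'a. complex_of_real (norm \<xi> powr (2 * s))"
      have D\<psi>: "AE \<xi> in lborel. D_fourier s \<psi> \<xi> = fourier \<psi> \<xi>"
        by (rule D_fourier_test_function[OF s \<psi>])
      obtain V' \<phi>' where D\<psi>_meas [measurable]: "D_fourier s \<psi> \<in> borel_measurable lebesgue"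
        and "V' \<in> borel_measurable borel" "AE \<xi> in lborel. D_fourier s \<psi> \<xi> = V' \<xi>" "D_approx s \<phi>' \<psi>"
          "(\<lambda>n. weighted_sq s (\<lambda>\<xi>. fourier (\<phi>' n) \<xi> - V' \<xi>)) \<longlonglongrightarrow> 0"
        by (rule D_fourier_spec[OF s(1,2) D_approx_const[OF test_functions_mono[OF \<psi>]]])
      have w_meas [measurable]: "?w \<in> borel_measurable lebesgue"
        by (rule measurable_completion) measurable
      have "0 = (LINT \<xi>|lebesgue. ?w \<xi> * D_fourier s u \<xi> * cnj (D_fourier s \<psi> \<xi>))"
        using harm \<psi> unfolding frac_harmonic_def D_inner_def by simp
      also have "\<dots> = (LINT \<xi>|lebesgue. ?w \<xi> * V \<xi> * cnj (fourier \<psi> \<xi>))"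
      proof (rule integral_cong_AE)
        have "AE \<xi> in lborel. ?w \<xi> * D_fourier s u \<xi> * cnj (D_fourier s \<psi> \<xi>) = ?w \<xi> * V \<xi> * cnj (fourier \<psi> \<xi>)"
          using ae D\<psi> by eventually_elim simp
        then show "AE \<xi> in lebesgue. ?w \<xi> * D_fourier s u \<xi> * cnj (D_fourier s \<psi> \<xi>) = ?w \<xi> * V \<xi> * cnj (fourier \<psi> \<xi>)"
          by (rule AE_completion)
        show "(\<lambda>\<xi>. ?w \<xi> * V \<xi> * cnj (fourier \<psi> \<xi>)) \<in> borel_measurable lebesgue"
          by (rule measurable_completion) measurable
        show "(\<lambda>\<xi>. ?w \<xi> * D_fourier s u \<xi> * cnj (D_fourier s \<psi> \<xi>)) \<in> borel_measurable lebesgue"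
          by measurable
      qed
      also have "\<dots> = (LINT \<xi>|lborel. ?w \<xi> * V \<xi> * cnj (fourier \<psi> \<xi>))"
        by (rule integral_completion) measurable
      also have "\<dots> = (LINT \<xi>|lborel. c * c * (?w \<xi> * Y \<xi> * FT (\<lambda>x. complex_of_real (\<psi> x)) \<xi>))"
      proof (intro Bochner_Integration.integral_cong refl)
        fix \<xi> :: 'a
        have V: "V \<xi> = c * Y \<xi>" unfolding Y_def mult.assoc[symmetric] using ck by (simp add: mult.commute)
        have "cnj c = c" by (simp add: c_def)
        then show "?w \<xi> * V \<xi> * cnj (fourier \<psi> \<xi>) = c * c * (?w \<xi> * Y \<xi> * FT (\<lambda>x. complex_of_real (\<psi> x)) \<xi>)"
          unfolding four[OF test_function_measurable[OF \<psi>]] V by simp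
      qed
      also have "\<dots> = c * c * (LINT \<xi>|lborel. ?w \<xi> * Y \<xi> * FT (\<lambda>x. complex_of_real (\<psi> x)) \<xi>)"
        by (rule Bochner_Integration.integral_mult_right_zero)
      finally show ?thesis using ck by simp
    qed
  qed
qed

section \<open>The heat flow of a distribution vanishing near a point\<close>

text \<open>The heat kernel \<open>y \<mapsto> (4 \<pi> t)\<^sup>-\<^sup>N\<^sup>/\<^sup>2 exp (- (z - y)\<^sup>2 / (4 t))\<close> centred at the complex point \<open>z = a + i b\<close>.\<close>

definition complex_heat :: "real \<Rightarrow> 'a::euclidean_space \<Rightarrow> 'a \<Rightarrow> 'a \<Rightarrow> complex" where
  "complex_heat t a b y = complex_of_real (heat_kernel t (y - a) * exp ((norm b)\<^sup>2 / (4 * t))) * iexp (((y - a) \<bullet> b) / (2 * t))"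

lemma complex_heat_measurable [measurable]: "complex_heat t a b \<in> borel_measurable borel"
  unfolding complex_heat_def by measurable

text \<open>Completing the square: the phase shifts the frequency by \<open>b / (2 * t)\<close>, and
  the factor \<open>exp ((norm b)\<^sup>2 / (4 * t))\<close> cancels the constant that the shift
  leaves behind.\<close>

lemma FT_complex_heat:
  fixes a b :: "'a::euclidean_space"
  assumes t: "t > 0"
  shows "FT (complex_heat t a b) \<xi> = gauss_exp t a b \<xi>"
proof -
  let ?w = "\<lambda>y. complex_heat t 0 b y"
  let ?E = "exp ((norm b)\<^sup>2 / (4 * t))"
  have w: "complex_heat t a b = (\<lambda>y. ?w (- a + y))"
    by (simp add: complex_heat_def fun_eq_iff)
  have "FT ?w \<xi> = (LINT y|lborel. complex_of_real ?E * (complex_of_real (heat_kernel t y) * iexp (y \<bullet> (\<xi> + (1 / (2 * t)) *\<^sub>R b))))"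
    unfolding FT_def complex_heat_def
    by (intro Bochner_Integration.integral_cong refl) (simp add: inner_add_right ring_distribs exp_add mult_ac)
  also have "\<dots> = complex_of_real ?E * complex_of_real (exp (- t * (norm (\<xi> + (1 / (2 * t)) *\<^sub>R b))\<^sup>2))"
    by (simp only: Bochner_Integration.integral_mult_right_zero heat_kernel_char(2)[OF t])
  also have "\<dots> = complex_of_real (exp ((norm b)\<^sup>2 / (4 * t) - t * (norm (\<xi> + (1 / (2 * t)) *\<^sub>R b))\<^sup>2))"
    by (simp only: of_real_mult[symmetric] exp_add[symmetric]) simp
  also have "(norm b)\<^sup>2 / (4 * t) - t * (norm (\<xi> + (1 / (2 * t)) *\<^sub>R b))\<^sup>2 = - t * (norm \<xi>)\<^sup>2 - b \<bullet> \<xi>"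
  proof -
    have "(norm (\<xi> + (1 / (2 * t)) *\<^sub>R b))\<^sup>2 = (norm \<xi>)\<^sup>2 + (b \<bullet> \<xi>) / t + (norm b)\<^sup>2 / (4 * t\<^sup>2)"
      unfolding power2_norm_eq_inner by (simp add: inner_add_left inner_add_right inner_commute power2_eq_square)
    then have "t * (norm (\<xi> + (1 / (2 * t)) *\<^sub>R b))\<^sup>2 = t * ((norm \<xi>)\<^sup>2 + (b \<bullet> \<xi>) / t + (norm b)\<^sup>2 / (4 * t\<^sup>2))"
      by simp
    also have "\<dots> = t * (norm \<xi>)\<^sup>2 + b \<bullet> \<xi> + (norm b)\<^sup>2 / (4 * t)"
      using t by (simp add: ring_distribs power2_eq_square)
    finally show ?thesis by simp
  qed
  finally show ?thesis
    unfolding w by (subst FT_translation) (auto simp: mult.commute)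
qed

text \<open>The \<open>16\<close> is chosen so that the growth \<open>exp (u / 16)\<close> uses up
  half of the decay \<open>exp (- u / 8)\<close> available in the next estimate.\<close>

lemma one_plus_power_le_exp:
  assumes "u \<ge> 0" "m > 0"
  shows "(1 + u) ^ m \<le> (16 * real m) ^ m * exp (u / 16)"
proof -
  have "1 + u \<le> 16 * real m * (1 + u / (16 * real m))"
    using assms by (simp add: field_simps)
  also have "\<dots> \<le> 16 * real m * exp (u / (16 * real m))"
    using assms exp_ge_add_one_self[of "u / (16 * real m)"] by (intro mult_left_mono) auto
  finally have "(1 + u) ^ m \<le> (16 * real m * exp (u / (16 * real m))) ^ m"
    using assms by (intro power_mono) auto
  also have "\<dots> = (16 * real m) ^ m * exp (real m * (u / (16 * real m)))"
    by (simp only: power_mult_distrib exp_of_nat_mult)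
  also have "real m * (u / (16 * real m)) = u / 16" using assms by simp
  finally show ?thesis .
qed

text \<open>With \<open>R = norm (y - x0) \<ge> \<rho>\<close> one has
  \<open>norm (y - a) \<ge> 3 * R / 4\<close> and \<open>norm b \<le> R / 4\<close>, and
  \<open>9 / 16 - 1 / 16 = 1 / 2\<close> gives the kernel the decay
  \<open>exp (- R\<^sup>2 / (8 * t))\<close>. Both \<open>1 / t\<close> and \<open>R / t\<close> are
  at most \<open>B = k * (1 + u)\<close> with \<open>u = R\<^sup>2 / t\<close>, so all negative
  powers of \<open>t\<close> are covered by \<open>B ^ m\<close>: degree \<open>N\<close> for the
  normalisation and two for the derivatives. \<open>L\<close> will be the logarithmic derivative of
  the kernel along a unit vector.\<close>

lemma complex_heat_bounds:
  fixes a b y x0 :: "'a::euclidean_space"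
  assumes \<rho>: "\<rho> > 0" and t: "0 < t" "t \<le> 2" and a: "norm (a - x0) \<le> \<rho> / 4" and b: "norm b \<le> \<rho> / 4"
    and y: "norm (y - x0) \<ge> \<rho>" and L: "cmod L \<le> (norm (y - a) + norm b) / (2 * t)"
  defines "m \<equiv> DIM('a) + 2" and "k \<equiv> 1 + 1 / \<rho> + 1 / \<rho>\<^sup>2"
  shows "cmod (complex_heat t a b y) * (1 + 2 * cmod L + ((cmod L)\<^sup>2 + 1 / (2 * t)))
     \<le> 5 * k ^ m * (16 * real m) ^ m * exp (- (norm (y - x0))\<^sup>2 / 32)"
proof -
  define R where "R = norm (y - x0)"
  define u where "u = R\<^sup>2 / t"
  define B where "B = k * (1 + u)"
  have R: "R \<ge> \<rho>" "R > 0" using y \<rho> by (auto simp: R_def)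
  have u0: "u \<ge> 0" using t by (simp add: u_def)
  have k1: "k \<ge> 1" using \<rho> by (simp add: k_def)
  have ya: "norm (y - a) \<ge> 3 * R / 4" "norm (y - a) \<le> 5 * R / 4"
    using norm_triangle_ineq4[of "y - a" "x0 - a"] norm_triangle_ineq4[of "y - x0" "a - x0"] a R(1)
    unfolding R_def by (auto simp: norm_minus_commute)
  have bR: "norm b \<le> R / 4" using b R by linarith
  have Lt: "cmod L \<le> R / t"
  proof -
    have "(norm (y - a) + norm b) / (2 * t) \<le> (2 * R) / (2 * t)"
      using ya bR R t by (intro divide_right_mono) auto
    then show ?thesis using L by simp
  qed
  have ut: "1 / t = u / R\<^sup>2" "R / t = u / R" using R t by (auto simp: u_def power2_eq_square)
  have B1: "B \<ge> 1" "1 / t \<le> B" "R / t \<le> B"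
  proof -
    have "1 * 1 \<le> k * (1 + u)" using k1 u0 by (intro mult_mono) auto
    then show "B \<ge> 1" by (simp add: B_def)
    have "u / R\<^sup>2 \<le> u / \<rho>\<^sup>2" using R u0 \<rho> by (intro divide_left_mono power_mono mult_pos_pos) auto
    also have "\<dots> = (1 / \<rho>\<^sup>2) * u" by simp
    also have "\<dots> \<le> k * (1 + u)" using u0 \<rho> by (intro mult_mono) (auto simp: k_def)
    finally show "1 / t \<le> B" by (simp only: ut B_def)
    have "u / R \<le> u / \<rho>" using R u0 \<rho> by (intro divide_left_mono mult_pos_pos) auto
    also have "\<dots> = (1 / \<rho>) * u" by simp
    also have "\<dots> \<le> k * (1 + u)" using u0 \<rho> by (intro mult_mono) (auto simp: k_def)
    finally show "R / t \<le> B" by (simp only: ut B_def)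
  qed
  have LB: "cmod L \<le> B" using Lt B1 by linarith
  \<comment> \<open>The left side is at most \<open>1 + 2 * B + B\<^sup>2 + B\<close>, and
    \<open>B \<ge> 1\<close>.\<close>
  have poly: "1 + 2 * cmod L + ((cmod L)\<^sup>2 + 1 / (2 * t)) \<le> 5 * B\<^sup>2"
  proof -
    have "(cmod L)\<^sup>2 \<le> B\<^sup>2" using LB by (intro power_mono) auto
    moreover have "1 / (2 * t) \<le> B" using B1 t by (simp add: field_simps)
    moreover have "B \<le> B\<^sup>2" "1 \<le> B\<^sup>2" using B1(1) by (auto simp: power2_eq_square intro: mult_right_mono[of 1 B B, simplified] one_le_power[of B 2, unfolded power2_eq_square])
    ultimately show ?thesis using LB by linarith
  qed
  have A: "cmod (complex_heat t a b y) \<le> B ^ DIM('a) * exp (- u / 8)"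
  proof -
    have "cmod (complex_heat t a b y) = heat_kernel t (y - a) * exp ((norm b)\<^sup>2 / (4 * t))"
      using heat_kernel_pos[OF t(1), of "y - a"] by (simp add: complex_heat_def norm_mult)
    also have "\<dots> = (4 * pi * t) powr (- (real DIM('a) / 2)) * exp (- (norm (y - a))\<^sup>2 / (4 * t) + (norm b)\<^sup>2 / (4 * t))"
      by (simp only: heat_kernel_def exp_add mult.assoc)
    also have "\<dots> \<le> B ^ DIM('a) * exp (- u / 8)"
    proof (rule mult_mono)
      have "1 * t \<le> 4 * pi * t" using pi_gt3 t by (intro mult_right_mono) auto
      then have "(4 * pi * t) powr (- (real DIM('a) / 2)) \<le> t powr (- (real DIM('a) / 2))"
        using t by (intro powr_mono2') auto
      also have "\<dots> = (1 / t) powr (real DIM('a) / 2)"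
        by (simp only: powr_minus powr_divide powr_one_eq_one) (simp only: divide_inverse mult_1)
      also have "\<dots> \<le> B powr (real DIM('a) / 2)"
        using B1 t by (intro powr_mono2) auto
      also have "\<dots> \<le> B powr (real DIM('a))"
        using B1 by (intro powr_mono) auto
      also have "\<dots> = B ^ DIM('a)" using B1 by (intro powr_realpow) auto
      finally show "(4 * pi * t) powr (- (real DIM('a) / 2)) \<le> B ^ DIM('a)" .
      have "(3 * R / 4)\<^sup>2 \<le> (norm (y - a))\<^sup>2" using ya R by (intro power_mono) auto
      moreover have "(norm b)\<^sup>2 \<le> (R / 4)\<^sup>2" using bR by (intro power_mono) auto
      ultimately have "- (norm (y - a))\<^sup>2 + (norm b)\<^sup>2 \<le> - R\<^sup>2 / 2" by (simp add: power2_eq_square)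
      then have "(- (norm (y - a))\<^sup>2 + (norm b)\<^sup>2) / (4 * t) \<le> (- R\<^sup>2 / 2) / (4 * t)"
        using t by (intro divide_right_mono) auto
      then have "- (norm (y - a))\<^sup>2 / (4 * t) + (norm b)\<^sup>2 / (4 * t) \<le> - u / 8"
        by (simp add: u_def add_divide_distrib diff_divide_distrib mult.commute)
      then show "exp (- (norm (y - a))\<^sup>2 / (4 * t) + (norm b)\<^sup>2 / (4 * t)) \<le> exp (- u / 8)" by simp
    qed (use B1 in auto)
    finally show ?thesis .
  qed
  have "cmod (complex_heat t a b y) * (1 + 2 * cmod L + ((cmod L)\<^sup>2 + 1 / (2 * t))) \<le> (B ^ DIM('a) * exp (- u / 8)) * (5 * B\<^sup>2)"
    using t B1 by (intro mult_mono A poly) (auto intro!: add_nonneg_nonneg)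
  also have "\<dots> = 5 * (B ^ m * exp (- u / 8))"
    by (simp add: m_def power_add power2_eq_square)
  also have "B ^ m = k ^ m * (1 + u) ^ m" by (simp add: B_def power_mult_distrib)
  also have "5 * (k ^ m * (1 + u) ^ m * exp (- u / 8)) \<le> 5 * (k ^ m * ((16 * real m) ^ m * exp (u / 16)) * exp (- u / 8))"
    using k1 by (intro mult_left_mono mult_right_mono one_plus_power_le_exp u0) (auto simp: m_def)
  also have "\<dots> = 5 * k ^ m * (16 * real m) ^ m * exp (u / 16 + - u / 8)"
    by (simp only: exp_add mult_ac)
  also have "\<dots> \<le> 5 * k ^ m * (16 * real m) ^ m * exp (- R\<^sup>2 / 32)"
  proof -
    \<comment> \<open>Here \<open>t \<le> 2\<close> turns the remaining
      \<open>exp (- u / 16)\<close> into a Gaussian in \<open>R\<close> that no longer involves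
      \<open>t\<close>.\<close>
    have "R\<^sup>2 / 2 \<le> u" using t unfolding u_def by (intro divide_left_mono) auto
    then show ?thesis using k1 by (intro mult_left_mono) auto
  qed
  finally show ?thesis unfolding R_def .
qed

text \<open>The kernel is the exponential of a quadratic, so its derivative along \<open>e\<close>
  is itself times the affine function \<open>L\<close>, and its second derivative is itself times
  \<open>L\<^sup>2 - 1 / (2 * t)\<close>.\<close>

lemma complex_heat_derivatives:
  fixes a b x :: "'a::euclidean_space"
  assumes t: "t > 0" and e: "norm e = 1"
  defines "L \<equiv> \<lambda>y. complex_of_real (- ((y - a) \<bullet> e) / (2 * t)) + \<i> * complex_of_real ((e \<bullet> b) / (2 * t))"
  shows "((\<lambda>\<tau>. complex_heat t a b (\<tau> *\<^sub>R e + x)) has_vector_derivative complex_heat t a b (\<tau> *\<^sub>R e + x) * L (\<tau> *\<^sub>R e + x)) (at \<tau>)"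
    and "((\<lambda>\<tau>. L (\<tau> *\<^sub>R e + x)) has_vector_derivative complex_of_real (- 1 / (2 * t))) (at \<tau>)"
    and "cmod (L y) \<le> (norm (y - a) + norm b) / (2 * t)"
proof -
  define c where "c = complex_of_real ((4 * pi * t) powr (- (real DIM('a) / 2)) * exp ((norm b)\<^sup>2 / (4 * t)))"
  define g where "g \<tau> = complex_of_real (- ((norm (\<tau> *\<^sub>R e + x - a))\<^sup>2) / (4 * t)) + \<i> * complex_of_real (((\<tau> *\<^sub>R e + x - a) \<bullet> b) / (2 * t))" for \<tau>
  have A: "complex_heat t a b (\<tau> *\<^sub>R e + x) = c * exp (g \<tau>)" for \<tau>
    by (simp only: complex_heat_def heat_kernel_def c_def g_def exp_add exp_of_real of_real_mult mult_ac)
  have ee: "e \<bullet> e = 1" using e by (simp add: norm_eq_1)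
  have "((\<lambda>\<tau>. - ((norm (\<tau> *\<^sub>R e + x - a))\<^sup>2) / (4 * t)) has_real_derivative (- ((\<tau> *\<^sub>R e + x - a) \<bullet> e) / (2 * t))) (at \<tau>)"
    unfolding power2_norm_eq_inner
    using t ee by (auto intro!: derivative_eq_intros simp: has_field_derivative_def inner_commute field_simps fun_eq_iff inner_add_left inner_diff_left inner_add_right inner_diff_right)
  moreover have "((\<lambda>\<tau>. ((\<tau> *\<^sub>R e + x - a) \<bullet> b) / (2 * t)) has_real_derivative ((e \<bullet> b) / (2 * t))) (at \<tau>)"
    using t by (auto intro!: derivative_eq_intros simp: has_field_derivative_def field_simps fun_eq_iff)
  ultimately have "(g has_vector_derivative L (\<tau> *\<^sub>R e + x)) (at \<tau>)"
    unfolding g_def L_def by (intro has_vector_derivative_add has_vector_derivative_mult_right has_vector_derivative_of_real)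
  then have "((\<lambda>\<tau>. exp (g \<tau>)) has_vector_derivative L (\<tau> *\<^sub>R e + x) * exp (g \<tau>)) (at \<tau>)"
    using field_vector_diff_chain_at[of g _ \<tau> exp "exp (g \<tau>)"] by (simp add: o_def DERIV_exp)
  then have "((\<lambda>\<tau>. c * exp (g \<tau>)) has_vector_derivative c * (L (\<tau> *\<^sub>R e + x) * exp (g \<tau>))) (at \<tau>)"
    by (rule has_vector_derivative_mult_right)
  then show "((\<lambda>\<tau>. complex_heat t a b (\<tau> *\<^sub>R e + x)) has_vector_derivative complex_heat t a b (\<tau> *\<^sub>R e + x) * L (\<tau> *\<^sub>R e + x)) (at \<tau>)"
    unfolding A by (simp add: mult_ac)
  have "((\<lambda>\<tau>. - ((\<tau> *\<^sub>R e + x - a) \<bullet> e) / (2 * t)) has_real_derivative (- 1 / (2 * t))) (at \<tau>)"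
    using t ee by (auto intro!: derivative_eq_intros simp: has_field_derivative_def field_simps fun_eq_iff)
  then have "((\<lambda>\<tau>. L (\<tau> *\<^sub>R e + x)) has_vector_derivative complex_of_real (- 1 / (2 * t)) + 0) (at \<tau>)"
    unfolding L_def by (intro has_vector_derivative_add has_vector_derivative_const has_vector_derivative_of_real)
  then show "((\<lambda>\<tau>. L (\<tau> *\<^sub>R e + x)) has_vector_derivative complex_of_real (- 1 / (2 * t))) (at \<tau>)" by simp
  have "cmod (L y) \<le> \<bar>(y - a) \<bullet> e\<bar> / (2 * t) + \<bar>e \<bullet> b\<bar> / (2 * t)"
    unfolding L_def using t by (intro order.trans[OF norm_triangle_ineq]) (simp add: norm_mult norm_divide)
  also have "\<dots> \<le> norm (y - a) / (2 * t) + norm b / (2 * t)"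
    using t e Cauchy_Schwarz_ineq2[of "y - a" e] Cauchy_Schwarz_ineq2[of e b] by (intro add_mono divide_right_mono) auto
  finally show "cmod (L y) \<le> (norm (y - a) + norm b) / (2 * t)" by (simp add: add_divide_distrib)
qed

lemma gaussian_shift_integrable:
  assumes "c > 0"
  shows "integrable lborel (\<lambda>x::'a::euclidean_space. exp (- c * (norm (x - x0))\<^sup>2))"
  using integrable_lborel_translation[OF integrable_exp_square[OF assms], of "- x0"] by simp

text \<open>Where \<open>1 - \<eta>\<close> is nonzero, at distance more than \<open>\<rho>\<close>
  from \<open>x0\<close>, the kernel and two of its derivatives are bounded by a Gaussian free of
  \<open>t\<close>, \<open>a\<close> and \<open>b\<close>. Hence one \<open>Q\<close> dominates
  values and second differences, and the weighted Fourier estimate gives a bound that survives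
  \<open>t \<rightarrow> 0\<close>.\<close>

lemma cutoff_heat_bound:
  fixes \<eta> :: "'a::euclidean_space \<Rightarrow> real"
  assumes s: "0 < s" "s < 2" and \<rho>: "\<rho> > 0" and \<eta>: "Ck 2 \<eta>"
    and one: "\<And>x. dist x0 x \<le> \<rho> \<Longrightarrow> \<eta> x = 1" and zero: "\<And>x. dist x0 x \<ge> 2 * \<rho> \<Longrightarrow> \<eta> x = 0"
  obtains K where "\<And>t a b. 0 < t \<Longrightarrow> t \<le> 2 \<Longrightarrow> norm (a - x0) \<le> \<rho> / 4 \<Longrightarrow> norm b \<le> \<rho> / 4 \<Longrightarrow>
     weighted_sq s (FT (\<lambda>y. complex_of_real (1 - \<eta> y) * complex_heat t a b y)) \<le> ennreal K"
    "\<And>t a b. 0 < t \<Longrightarrow> t \<le> 2 \<Longrightarrow> norm (a - x0) \<le> \<rho> / 4 \<Longrightarrow> norm b \<le> \<rho> / 4 \<Longrightarrow>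
     integrable lborel (\<lambda>y. complex_of_real (1 - \<eta> y) * complex_heat t a b y)" "K \<ge> 0"
proof -
  have \<eta>_0: "\<eta> x = 0" if "norm x > norm x0 + 2 * \<rho>" for x
  proof (rule zero)
    show "2 * \<rho> \<le> dist x0 x"
      using that norm_triangle_ineq2[of x x0] by (simp add: dist_norm norm_minus_commute)
  qed
  obtain C g1 g2 where C: "\<And>x. \<bar>\<eta> x\<bar> \<le> C"
    and D1: "\<And>b x t. b \<in> Basis \<Longrightarrow> ((\<lambda>t. \<eta> (t *\<^sub>R b + x)) has_real_derivative g1 b (t *\<^sub>R b + x)) (at t)"
    and D2: "\<And>b x t. b \<in> Basis \<Longrightarrow> ((\<lambda>t. g1 b (t *\<^sub>R b + x)) has_real_derivative g2 b (t *\<^sub>R b + x)) (at t)"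
    and B1: "\<And>b x. b \<in> Basis \<Longrightarrow> \<bar>g1 b x\<bar> \<le> C" and B2: "\<And>b x. b \<in> Basis \<Longrightarrow> \<bar>g2 b x\<bar> \<le> C"
    by (rule Ck_2_compact_support[OF \<eta> \<eta>_0]) (assumption | blast)+
  have Z1: "g1 b x = 0" if "b \<in> Basis" "x \<in> ball x0 \<rho>" for b x
    by (rule directional_derivative_zero[OF D1[OF that(1)] open_ball, of x0 \<rho> 1]) (use one that in auto)
  have Z2: "g2 b x = 0" if "b \<in> Basis" "x \<in> ball x0 \<rho>" for b x
    by (rule directional_derivative_zero[OF D2[OF that(1)] open_ball, of x0 \<rho> 0]) (use Z1 that in auto)
  have C0: "C \<ge> 0" using C[of 0] by linarith
  have \<eta>_meas [measurable]: "\<eta> \<in> borel_measurable borel"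
    by (rule borel_measurable_continuous_onI[OF Ck_imp_continuous[OF \<eta>]])
  define m where "m = DIM('a) + 2"
  define k where "k = 1 + 1 / \<rho> + 1 / \<rho>\<^sup>2"
  define K0 where "K0 = (1 + C) * (5 * k ^ m * (16 * real m) ^ m)"
  \<comment> \<open>The factor \<open>exp (1 / 32)\<close> and the weaker rate \<open>1 / 64\<close>
    pay for moving a point by at most one in the second differences.\<close>
  define K1 where "K1 = K0 * exp (1 / 32)"
  define Q where "Q x = 2 * K1 * exp (- (1 / 64) * (norm (x - x0))\<^sup>2)" for x :: 'a
  have k0: "k \<ge> 1" using \<rho> by (simp add: k_def)
  have K0: "K0 \<ge> 0" using C0 k0 by (simp add: K0_def)
  have K1: "K1 \<ge> 0" "K0 \<le> K1" using K0 by (auto simp: K1_def mult_le_cancel_left1)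
  have Q_meas [measurable]: "Q \<in> borel_measurable borel" unfolding Q_def by measurable
  have Q_int: "integrable lborel Q"
    unfolding Q_def by (intro integrable_mult_right gaussian_shift_integrable) simp
  define I where "I = (2 * pi) ^ DIM('a) * (1 + (real DIM('a))\<^sup>2)"
  have Q_sq: "(\<integral>\<^sup>+x. ennreal ((Q x)\<^sup>2) \<partial>lborel) < \<infinity>"
  proof -
    have "(Q x)\<^sup>2 = (2 * K1)\<^sup>2 * exp (- (1 / 32) * (norm (x - x0))\<^sup>2)" for x
      unfolding Q_def power_mult_distrib exp_double[symmetric] by simp
    then have "integrable lborel (\<lambda>x. (Q x)\<^sup>2)"
      using gaussian_shift_integrable[of "1 / 32" x0] by simp
    then show ?thesis by (subst nn_integral_eq_integral) auto
  qed
  define K where "K = enn2real (ennreal I * (\<integral>\<^sup>+x. ennreal ((Q x)\<^sup>2) \<partial>lborel))"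
  have *: "cmod (complex_of_real (1 - \<eta> x) * complex_heat t a b x) \<le> Q x"
    "\<And>e \<tau>. e \<in> Basis \<Longrightarrow> 0 < \<tau> \<Longrightarrow> \<tau> \<le> 1 \<Longrightarrow>
      cmod ((complex_of_real (1 - \<eta> (\<tau> *\<^sub>R e + x)) * complex_heat t a b (\<tau> *\<^sub>R e + x))
          + (complex_of_real (1 - \<eta> (- \<tau> *\<^sub>R e + x)) * complex_heat t a b (- \<tau> *\<^sub>R e + x))
          - 2 * (complex_of_real (1 - \<eta> x) * complex_heat t a b x)) \<le> \<tau>\<^sup>2 * Q x"
    if t: "0 < t" "t \<le> 2" and a: "norm (a - x0) \<le> \<rho> / 4" and b: "norm b \<le> \<rho> / 4" for t a b x
  proof -
    let ?A = "complex_heat t a b"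
    \<comment> \<open>One inequality for the whole product rule: \<open>c0\<close>,
      \<open>c1\<close>, \<open>c2\<close> stand for \<open>1 - \<eta>\<close> and its first two
      derivatives, all zero on the ball around \<open>x0\<close>. The value itself is bounded by
      putting \<open>1 - \<eta> x\<close> in place of \<open>c2\<close> and zero for the
      others.\<close>
    have bound: "cmod (complex_of_real c2 * ?A y + 2 * (complex_of_real c1 * (?A y * l)) + complex_of_real c0 * (?A y * l\<^sup>2 - ?A y * complex_of_real (1 / (2 * t))))
        \<le> K0 * exp (- (norm (y - x0))\<^sup>2 / 32)"
      if l: "cmod l \<le> (norm (y - a) + norm b) / (2 * t)"
        and c: "\<bar>c0\<bar> \<le> 1 + C" "\<bar>c1\<bar> \<le> 1 + C" "\<bar>c2\<bar> \<le> 1 + C"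
        and c_0: "y \<in> ball x0 \<rho> \<Longrightarrow> c0 = 0 \<and> c1 = 0 \<and> c2 = 0" for c0 c1 c2 y l
    proof (cases "y \<in> ball x0 \<rho>")
      case True
      then show ?thesis using c_0 K0 by simp
    next
      case False
      then have y: "norm (y - x0) \<ge> \<rho>" by (simp add: dist_norm norm_minus_commute)
      let ?r = "complex_of_real (1 / (2 * t))"
      have r: "cmod ?r = 1 / (2 * t)" using t by (simp only: norm_of_real) simp
      have "cmod (complex_of_real c2 * ?A y + 2 * (complex_of_real c1 * (?A y * l)) + complex_of_real c0 * (?A y * l\<^sup>2 - ?A y * ?r))
         \<le> (cmod (complex_of_real c2 * ?A y) + cmod (2 * (complex_of_real c1 * (?A y * l)))) + cmod (complex_of_real c0 * (?A y * l\<^sup>2 - ?A y * ?r))"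
        by (intro order.trans[OF norm_triangle_ineq] add_mono norm_triangle_ineq order.refl)
      also have "\<dots> \<le> ((1 + C) * cmod (?A y) + 2 * ((1 + C) * (cmod (?A y) * cmod l))) + (1 + C) * (cmod (?A y) * (cmod l)\<^sup>2 + cmod (?A y) * (1 / (2 * t)))"
      proof (intro add_mono)
        show "cmod (complex_of_real c2 * ?A y) \<le> (1 + C) * cmod (?A y)"
          unfolding norm_mult norm_of_real by (intro mult_right_mono c) auto
        show "cmod (2 * (complex_of_real c1 * (?A y * l))) \<le> 2 * ((1 + C) * (cmod (?A y) * cmod l))"
          unfolding norm_mult norm_of_real norm_numeral by (intro mult_left_mono mult_right_mono c) auto
        have "cmod (?A y * l\<^sup>2 - ?A y * ?r) \<le> cmod (?A y) * (cmod l)\<^sup>2 + cmod (?A y) * (1 / (2 * t))"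
          by (rule order.trans[OF norm_triangle_ineq4]) (simp only: norm_mult norm_power r order.refl)
        then show "cmod (complex_of_real c0 * (?A y * l\<^sup>2 - ?A y * ?r)) \<le> (1 + C) * (cmod (?A y) * (cmod l)\<^sup>2 + cmod (?A y) * (1 / (2 * t)))"
          unfolding norm_mult[of "complex_of_real c0"] norm_of_real using C0 by (intro mult_mono c) auto
      qed
      also have "\<dots> = (1 + C) * (cmod (?A y) * (1 + 2 * cmod l + ((cmod l)\<^sup>2 + 1 / (2 * t))))"
        by (simp only: distrib_left distrib_right mult_ac add_ac mult_1_left mult_1_right)
      also have "\<dots> \<le> (1 + C) * (5 * k ^ m * (16 * real m) ^ m * exp (- (norm (y - x0))\<^sup>2 / 32))"
        unfolding m_def k_def using C0 by (intro mult_left_mono complex_heat_bounds[OF \<rho> t a b y l]) auto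
      finally show ?thesis by (simp only: K0_def mult.assoc)
    qed
    have \<eta>1: "\<bar>1 - \<eta> y\<bar> \<le> 1 + C" for y using C[of y] by linarith
    have shift: "K0 * exp (- (norm (\<tau> *\<^sub>R e + x - x0))\<^sup>2 / 32) \<le> K1 * exp (- (1 / 64) * (norm (x - x0))\<^sup>2)"
      if "\<bar>\<tau>\<bar> \<le> 1" "norm e = 1" for \<tau> e
    proof -
      define r where "r = norm (x - x0)"
      define r' where "r' = norm (\<tau> *\<^sub>R e + x - x0)"
      have "r - 1 \<le> r'"
      proof -
        have "norm (x - x0) \<le> norm (\<tau> *\<^sub>R e + x - x0) + norm (\<tau> *\<^sub>R e)"
          using norm_triangle_ineq4[of "\<tau> *\<^sub>R e + x - x0" "\<tau> *\<^sub>R e"] by (simp add: algebra_simps)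
        then show ?thesis using that by (simp add: r_def r'_def)
      qed
      \<comment> \<open>For \<open>r \<ge> 1\<close> this is
        \<open>(r - 1)\<^sup>2 \<ge> r\<^sup>2 / 2 - 1\<close>, equivalent to
        \<open>(r - 2)\<^sup>2 \<ge> 0\<close>.\<close>
      have "r\<^sup>2 / 2 - 1 \<le> r'\<^sup>2"
      proof (cases "r \<ge> 1")
        case True
        then have "(r - 1)\<^sup>2 \<le> r'\<^sup>2" using \<open>r - 1 \<le> r'\<close> by (intro power_mono) auto
        moreover have "0 \<le> (r - 2)\<^sup>2" by simp
        ultimately show ?thesis by (simp add: power2_eq_square algebra_simps)
      next
        case False
        then have "r\<^sup>2 \<le> 1" using power_mono[of r 1 2] by (simp add: r_def)
        then show ?thesis using zero_le_power2[of r'] by linarith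
      qed
      then have "- r'\<^sup>2 / 32 \<le> 1 / 32 + - (1 / 64) * r\<^sup>2" by simp
      then have "exp (- r'\<^sup>2 / 32) \<le> exp (1 / 32) * exp (- (1 / 64) * r\<^sup>2)"
        by (simp only: exp_add[symmetric] exp_le_cancel_iff)
      then have "K0 * exp (- r'\<^sup>2 / 32) \<le> K0 * (exp (1 / 32) * exp (- (1 / 64) * r\<^sup>2))"
        by (rule mult_left_mono) (rule K0)
      then show ?thesis unfolding K1_def r_def r'_def by (simp only: mult.assoc)
    qed
    obtain e0 :: 'a where e0: "e0 \<in> Basis" using nonempty_Basis by blast
    have "cmod (complex_of_real (1 - \<eta> x) * ?A x) \<le> K1 * exp (- (1 / 64) * (norm (x - x0))\<^sup>2)"
      using bound[of 0 x 0 0 "1 - \<eta> x"] shift[of 0 e0] \<eta>1[of x] C0 one t e0 by (auto simp: dist_norm)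
    also have "\<dots> \<le> Q x" using K1 by (simp add: Q_def)
    finally show "cmod (complex_of_real (1 - \<eta> x) * ?A x) \<le> Q x" .
    fix e :: 'a and \<tau> :: real
    assume e: "e \<in> Basis" and \<tau>: "0 < \<tau>" "\<tau> \<le> 1"
    have ne: "norm e = 1" using e by simp
    define L where "L y = complex_of_real (- ((y - a) \<bullet> e) / (2 * t)) + \<i> * complex_of_real ((e \<bullet> b) / (2 * t))" for y
    note dA = complex_heat_derivatives[OF t(1) ne, where a=a and b=b, folded L_def]
    let ?k = "\<lambda>\<tau>. complex_of_real (1 - \<eta> (\<tau> *\<^sub>R e + x))"
    let ?k1 = "\<lambda>\<tau>. complex_of_real (- g1 e (\<tau> *\<^sub>R e + x))"
    let ?k2 = "\<lambda>\<tau>. complex_of_real (- g2 e (\<tau> *\<^sub>R e + x))"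
    let ?a = "\<lambda>\<tau>. ?A (\<tau> *\<^sub>R e + x)"
    let ?l = "\<lambda>\<tau>. L (\<tau> *\<^sub>R e + x)"
    let ?r = "complex_of_real (- 1 / (2 * t))"
    have dk: "(?k has_vector_derivative ?k1 \<tau>) (at \<tau>)" for \<tau>
      using D1[OF e, of x \<tau>]
      by (intro has_vector_derivative_of_real)
         (auto simp: has_real_derivative_iff_has_vector_derivative[symmetric] intro!: derivative_eq_intros)
    have dk1: "(?k1 has_vector_derivative ?k2 \<tau>) (at \<tau>)" for \<tau>
      using D2[OF e, of x \<tau>]
      by (intro has_vector_derivative_of_real)
         (auto simp: has_real_derivative_iff_has_vector_derivative[symmetric] intro!: derivative_eq_intros)
    have "cmod (?k \<tau> * ?a \<tau> + ?k (- \<tau>) * ?a (- \<tau>) - 2 * (?k 0 * ?a 0)) \<le> \<tau>\<^sup>2 * (2 * (K1 * exp (- (1 / 64) * (norm (x - x0))\<^sup>2)))"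
    proof (rule second_difference_bound[where f="\<lambda>\<tau>. ?k \<tau> * ?a \<tau>"])
      show "((\<lambda>\<tau>. ?k \<tau> * ?a \<tau>) has_vector_derivative ?k \<tau> * (?a \<tau> * ?l \<tau>) + ?k1 \<tau> * ?a \<tau>) (at \<tau>)" for \<tau>
        by (rule has_vector_derivative_mult[OF dk dA(1)])
      show "((\<lambda>\<tau>. ?k \<tau> * (?a \<tau> * ?l \<tau>) + ?k1 \<tau> * ?a \<tau>) has_vector_derivative
         (?k \<tau> * (?a \<tau> * ?r + ?a \<tau> * ?l \<tau> * ?l \<tau>) + ?k1 \<tau> * (?a \<tau> * ?l \<tau>)) + (?k1 \<tau> * (?a \<tau> * ?l \<tau>) + ?k2 \<tau> * ?a \<tau>)) (at \<tau>)" for \<tau>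
        by (rule has_vector_derivative_add[OF has_vector_derivative_mult[OF dk has_vector_derivative_mult[OF dA(1) dA(2)]] has_vector_derivative_mult[OF dk1 dA(1)]])
      show "cmod ((?k \<sigma> * (?a \<sigma> * ?r + ?a \<sigma> * ?l \<sigma> * ?l \<sigma>) + ?k1 \<sigma> * (?a \<sigma> * ?l \<sigma>)) + (?k1 \<sigma> * (?a \<sigma> * ?l \<sigma>) + ?k2 \<sigma> * ?a \<sigma>))
          \<le> K1 * exp (- (1 / 64) * (norm (x - x0))\<^sup>2)" if "\<bar>\<sigma>\<bar> \<le> 1" for \<sigma>
      proof -
        let ?y = "\<sigma> *\<^sub>R e + x"
        have "(?k \<sigma> * (?a \<sigma> * ?r + ?a \<sigma> * ?l \<sigma> * ?l \<sigma>) + ?k1 \<sigma> * (?a \<sigma> * ?l \<sigma>)) + (?k1 \<sigma> * (?a \<sigma> * ?l \<sigma>) + ?k2 \<sigma> * ?a \<sigma>)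
           = ?k2 \<sigma> * ?a \<sigma> + 2 * (?k1 \<sigma> * (?a \<sigma> * ?l \<sigma>)) + ?k \<sigma> * (?a \<sigma> * (?l \<sigma>)\<^sup>2 - ?a \<sigma> * complex_of_real (1 / (2 * t)))"
          by (simp add: algebra_simps power2_eq_square)
        also have "cmod \<dots> \<le> K0 * exp (- (norm (?y - x0))\<^sup>2 / 32)"
        proof (rule bound[OF dA(3)])
          show "\<bar>1 - \<eta> ?y\<bar> \<le> 1 + C" by (rule \<eta>1)
          show "\<bar>- g1 e ?y\<bar> \<le> 1 + C" "\<bar>- g2 e ?y\<bar> \<le> 1 + C" using B1[OF e, of ?y] B2[OF e, of ?y] by auto
          show "1 - \<eta> ?y = 0 \<and> - g1 e ?y = 0 \<and> - g2 e ?y = 0" if "?y \<in> ball x0 \<rho>"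
            using Z1[OF e that] Z2[OF e that] one[of ?y] that by simp
        qed
        also have "\<dots> \<le> K1 * exp (- (1 / 64) * (norm (x - x0))\<^sup>2)"
          by (rule shift[OF that ne])
        finally show ?thesis .
      qed
    qed (fact \<tau>)+
    then show "cmod ((complex_of_real (1 - \<eta> (\<tau> *\<^sub>R e + x)) * complex_heat t a b (\<tau> *\<^sub>R e + x))
          + (complex_of_real (1 - \<eta> (- \<tau> *\<^sub>R e + x)) * complex_heat t a b (- \<tau> *\<^sub>R e + x))
          - 2 * (complex_of_real (1 - \<eta> x) * complex_heat t a b x)) \<le> \<tau>\<^sup>2 * Q x"
      by (simp add: Q_def)
  qed
  show thesis
  proof (rule that)
    fix t :: real and a b :: 'a
    assume t: "0 < t" "t \<le> 2" and a: "norm (a - x0) \<le> \<rho> / 4" and b: "norm b \<le> \<rho> / 4"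
    show int: "integrable lborel (\<lambda>y. complex_of_real (1 - \<eta> y) * complex_heat t a b y)"
      by (rule Bochner_Integration.integrable_bound[OF Q_int]) (use *(1)[OF t a b] in \<open>auto intro!: AE_I2 order.trans[OF _ abs_ge_self]\<close>)
    have "weighted_sq s (FT (\<lambda>y. complex_of_real (1 - \<eta> y) * complex_heat t a b y)) \<le> ennreal I * (\<integral>\<^sup>+x. ennreal ((Q x)\<^sup>2) \<partial>lborel)"
      unfolding weighted_sq_def I_def
      by (rule weighted_FT_bound[OF s int Q_meas *[OF t a b]])
    also have "\<dots> = ennreal K"
      using Q_sq unfolding K_def by (simp add: ennreal_mult_less_top)
    finally show "weighted_sq s (FT (\<lambda>y. complex_of_real (1 - \<eta> y) * complex_heat t a b y)) \<le> ennreal K" .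
  qed (simp add: K_def)
qed

section \<open>Splitting the kernel by the cutoff\<close>

lemma test_functions_ballI:
  assumes "\<And>k. Ck k \<psi>" "\<And>x. dist x0 x \<ge> r \<Longrightarrow> \<psi> x = 0" "cball x0 r \<subseteq> \<Omega>"
  shows "\<psi> \<in> test_functions \<Omega>"
proof -
  have sub: "{x. \<psi> x \<noteq> 0} \<subseteq> cball x0 r"
  proof
    fix x assume "x \<in> {x. \<psi> x \<noteq> 0}"
    then have "\<not> dist x0 x \<ge> r" using assms(2) by blast
    then show "x \<in> cball x0 r" by simp
  qed
  then have "bounded {x. \<psi> x \<noteq> 0}" "closure {x. \<psi> x \<noteq> 0} \<subseteq> cball x0 r"
    using bounded_subset[OF bounded_cball] closure_minimal[OF sub closed_cball] by auto
  then show ?thesis using assms(1,3) unfolding test_functions_iff by blast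
qed

text \<open>Test functions are real, so the kernel enters the weak equation through its real and
  imaginary parts.\<close>

lemma Ck_complex_heat:
  fixes a b :: "'a::euclidean_space"
  shows "Ck k (\<lambda>y. Re (complex_heat t a b y))" "Ck k (\<lambda>y. Im (complex_heat t a b y))"
proof -
  define q where "q y = (\<Sum>e\<in>Basis. (y \<bullet> e + - (a \<bullet> e)) * (y \<bullet> e + - (a \<bullet> e))) * (- 1 / (4 * t))" for y
  define l where "l y = y \<bullet> ((1 / (2 * t)) *\<^sub>R b) + - ((a \<bullet> b) / (2 * t))" for y
  define c where "c = (4 * pi * t) powr (- (real DIM('a) / 2)) * exp ((norm b)\<^sup>2 / (4 * t))"
  have q: "- (norm (y - a))\<^sup>2 / (4 * t) = q y" for y
  proof -
    have "(norm (y - a))\<^sup>2 = (\<Sum>e\<in>Basis. (y \<bullet> e + - (a \<bullet> e)) * (y \<bullet> e + - (a \<bullet> e)))"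
      unfolding norm_square_eq_sum by (intro sum.cong refl) (simp add: inner_diff_left power2_eq_square)
    then show ?thesis by (simp add: q_def)
  qed
  have l: "((y - a) \<bullet> b) / (2 * t) = l y" for y
    by (simp add: l_def inner_diff_left diff_divide_distrib)
  have A: "complex_heat t a b y = complex_of_real (c * exp (q y)) * iexp (l y)" for y
    unfolding complex_heat_def heat_kernel_def q l c_def by (simp add: mult_ac)
  have Ckq: "Ck k q" unfolding q_def by (intro Ck_mult Ck_sum Ck_affine Ck_const) auto
  have Ckl: "Ck k l" unfolding l_def by (rule Ck_affine)
  have "Re (complex_heat t a b y) = c * (exp (q y) * cos (l y))" "Im (complex_heat t a b y) = c * (exp (q y) * sin (l y))" for y
    unfolding A cis_conv_exp[symmetric] by simp_all
  moreover have "Ck k (\<lambda>y. c * (exp (q y) * cos (l y)))"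
    by (rule Ck_cmult[OF Ck_mult[OF Ck_compose[OF Ck_exp Ckq] Ck_compose[OF conjunct2[OF Ck_sin_cos] Ckl]]])
  moreover have "Ck k (\<lambda>y. c * (exp (q y) * sin (l y)))"
    by (rule Ck_cmult[OF Ck_mult[OF Ck_compose[OF Ck_exp Ckq] Ck_compose[OF conjunct1[OF Ck_sin_cos] Ckl]]])
  ultimately show "Ck k (\<lambda>y. Re (complex_heat t a b y))" "Ck k (\<lambda>y. Im (complex_heat t a b y))"
    by simp_all
qed

text \<open>Multiplication by \<open>|\<xi>| powr (2 * s)\<close> is an isometry of the weighted
  space into its dual; at the origin both integrands vanish.\<close>

lemma weighted_sq_powr_mult:
  "weighted_sq (- s) (\<lambda>\<xi>. complex_of_real (norm \<xi> powr (2 * s)) * Y \<xi>) = weighted_sq s Y"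
  unfolding weighted_sq_def
proof (intro nn_integral_cong arg_cong[where f=ennreal])
  fix \<xi> :: 'a
  have "norm \<xi> powr (2 * - s) * (norm \<xi> powr (2 * s))\<^sup>2 = norm \<xi> powr (2 * s)"
    by (cases "\<xi> = 0") (simp_all add: power2_eq_square flip: powr_add)
  then show "norm \<xi> powr (2 * - s) * (cmod (complex_of_real (norm \<xi> powr (2 * s)) * Y \<xi>))\<^sup>2 = norm \<xi> powr (2 * s) * (cmod (Y \<xi>))\<^sup>2"
    by (simp add: norm_mult power_mult_distrib mult.assoc[symmetric])
qed

text \<open>This is where the equation enters. The Gaussian exponential is the transform of the
  complex heat kernel. The part of the kernel cut out by \<open>\<eta>\<close> consists of two test
  functions in \<open>\<Omega>\<close> and pairs to zero; the part away from \<open>x0\<close> has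
  weighted norm bounded uniformly in \<open>t\<close>.\<close>

lemma local_heat_bound:
  fixes Y :: "'a::euclidean_space \<Rightarrow> complex"
  assumes s: "0 < s" "s < 2" and Y [measurable]: "Y \<in> borel_measurable borel" and Y_fin: "weighted_sq s Y < \<infinity>"
    and orth: "\<And>\<psi>. \<psi> \<in> test_functions \<Omega> \<Longrightarrow>
       (LINT \<xi>|lborel. complex_of_real (norm \<xi> powr (2 * s)) * Y \<xi> * FT (\<lambda>x. complex_of_real (\<psi> x)) \<xi>) = 0"
    and \<rho>: "\<rho> > 0" and \<Omega>: "cball x0 (2 * \<rho>) \<subseteq> \<Omega>"
  obtains K where "\<And>t a b. 0 < t \<Longrightarrow> t \<le> 2 \<Longrightarrow> norm (a - x0) \<le> \<rho> / 4 \<Longrightarrow> norm b \<le> \<rho> / 4 \<Longrightarrow>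
     cmod (LINT \<xi>|lborel. complex_of_real (norm \<xi> powr (2 * s)) * Y \<xi> * gauss_exp t a b \<xi>) \<le> K"
proof -
  obtain \<eta> :: "'a \<Rightarrow> real" where \<eta>: "\<And>k. Ck k \<eta>" "\<And>x. dist x0 x \<le> \<rho> \<Longrightarrow> \<eta> x = 1" "\<And>x. dist x0 x \<ge> 2 * \<rho> \<Longrightarrow> \<eta> x = 0"
    using smooth_cutoff[OF \<rho>, of x0] by blast
  obtain K where K: "\<And>t a b. 0 < t \<Longrightarrow> t \<le> 2 \<Longrightarrow> norm (a - x0) \<le> \<rho> / 4 \<Longrightarrow> norm b \<le> \<rho> / 4 \<Longrightarrow>
     weighted_sq s (FT (\<lambda>y. complex_of_real (1 - \<eta> y) * complex_heat t a b y)) \<le> ennreal K"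
    "\<And>t a b. 0 < t \<Longrightarrow> t \<le> 2 \<Longrightarrow> norm (a - x0) \<le> \<rho> / 4 \<Longrightarrow> norm b \<le> \<rho> / 4 \<Longrightarrow>
     integrable lborel (\<lambda>y. complex_of_real (1 - \<eta> y) * complex_heat t a b y)" "K \<ge> 0"
    using cutoff_heat_bound[OF s \<rho> \<eta>(1) \<eta>(2) \<eta>(3)] by blast
  define m where "m \<xi> = complex_of_real (norm \<xi> powr (2 * s)) * Y \<xi>" for \<xi>
  have [measurable]: "m \<in> borel_measurable borel" unfolding m_def by measurable
  define B where "B = enn2real (weighted_sq s Y)"
  have m: "weighted_sq (- s) m \<le> ennreal B" "B \<ge> 0"
    using Y_fin unfolding m_def weighted_sq_powr_mult B_def by (auto simp: less_top)
  show thesis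
  proof (rule that)
    fix t :: real and a b :: 'a
    assume t: "0 < t" "t \<le> 2" and a: "norm (a - x0) \<le> \<rho> / 4" and b: "norm b \<le> \<rho> / 4"
    define w where "w y = complex_of_real (1 - \<eta> y) * complex_heat t a b y" for y
    define \<psi>1 where "\<psi>1 y = \<eta> y * Re (complex_heat t a b y)" for y
    define \<psi>2 where "\<psi>2 y = \<eta> y * Im (complex_heat t a b y)" for y
    let ?p1 = "\<lambda>y. complex_of_real (\<psi>1 y)" and ?p2 = "\<lambda>y. complex_of_real (\<psi>2 y)"
    have w: "integrable lborel w" "weighted_sq s (FT w) \<le> ennreal K"
      unfolding w_def by (rule K(2)[OF t a b], rule K(1)[OF t a b])
    have test: "\<psi>1 \<in> test_functions \<Omega>" "\<psi>2 \<in> test_functions \<Omega>"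
      unfolding \<psi>1_def \<psi>2_def
      by (rule test_functions_ballI[OF Ck_mult[OF \<eta>(1) Ck_complex_heat(1)] _ \<Omega>]; simp add: \<eta>(3))
         (rule test_functions_ballI[OF Ck_mult[OF \<eta>(1) Ck_complex_heat(2)] _ \<Omega>]; simp add: \<eta>(3))
    note [measurable] = borel_measurable_integrable[OF w(1), simplified] test_function_measurable[OF test(1)] test_function_measurable[OF test(2)]
    have int: "integrable lborel ?p1" "integrable lborel ?p2"
      unfolding complex_of_real_integrable_eq by (rule test_function_integrable[OF test(1)], rule test_function_integrable[OF test(2)])
    have A: "complex_heat t a b y = (?p1 y + \<i> * ?p2 y) + w y" for y
      unfolding \<psi>1_def \<psi>2_def w_def by (simp add: complex_eq_iff algebra_simps)
    have FTA: "gauss_exp t a b \<xi> = (FT ?p1 \<xi> + \<i> * FT ?p2 \<xi>) + FT w \<xi>" for \<xi>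
    proof -
      note i = integrable_mult_iexp[OF int(1)] integrable_mult_iexp[OF int(2)] integrable_mult_iexp[OF w(1)]
      have "gauss_exp t a b \<xi> = (LINT y|lborel. (?p1 y * iexp (y \<bullet> \<xi>) + \<i> * (?p2 y * iexp (y \<bullet> \<xi>))) + w y * iexp (y \<bullet> \<xi>))"
        unfolding FT_complex_heat[OF t(1), symmetric] FT_def A
        by (intro Bochner_Integration.integral_cong refl) (simp only: distrib_right mult.assoc)
      also have "\<dots> = (FT ?p1 \<xi> + \<i> * FT ?p2 \<xi>) + FT w \<xi>"
        unfolding FT_def
        by (simp only: Bochner_Integration.integral_add Bochner_Integration.integrable_add integrable_mult_right i Bochner_Integration.integral_mult_right_zero)
      finally show ?thesis .
    qed
    have p: "integrable lborel (\<lambda>\<xi>. m \<xi> * FT ?p1 \<xi>)" "integrable lborel (\<lambda>\<xi>. m \<xi> * FT ?p2 \<xi>)"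
    proof -
      have fin: "weighted_sq s (FT ?p1) < \<infinity>" "weighted_sq s (FT ?p2) < \<infinity>"
        unfolding weighted_sq_def by (rule test_function_FT_finite[OF test(1) s], rule test_function_FT_finite[OF test(2) s])
      show "integrable lborel (\<lambda>\<xi>. m \<xi> * FT ?p1 \<xi>)"
        unfolding mult.commute[of "m _"]
        by (rule weighted_pairing(1)[OF _ _ _ _ m, where A="enn2real (weighted_sq s (FT ?p1))"]) (use fin in \<open>auto simp: less_top\<close>)
      show "integrable lborel (\<lambda>\<xi>. m \<xi> * FT ?p2 \<xi>)"
        unfolding mult.commute[of "m _"]
        by (rule weighted_pairing(1)[OF _ _ _ _ m, where A="enn2real (weighted_sq s (FT ?p2))"]) (use fin in \<open>auto simp: less_top\<close>)
    qed
    have pw: "integrable lborel (\<lambda>\<xi>. m \<xi> * FT w \<xi>)" "cmod (LINT \<xi>|lborel. m \<xi> * FT w \<xi>) \<le> sqrt (K * B)"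
      unfolding mult.commute[of "m _"]
      by (rule weighted_pairing[OF _ _ w(2) K(3) m]; measurable)+
    have "(LINT \<xi>|lborel. m \<xi> * gauss_exp t a b \<xi>) = (LINT \<xi>|lborel. (m \<xi> * FT ?p1 \<xi> + \<i> * (m \<xi> * FT ?p2 \<xi>)) + m \<xi> * FT w \<xi>)"
      unfolding FTA by (intro Bochner_Integration.integral_cong refl) (simp only: distrib_left mult_ac)
    also have "\<dots> = ((LINT \<xi>|lborel. m \<xi> * FT ?p1 \<xi>) + \<i> * (LINT \<xi>|lborel. m \<xi> * FT ?p2 \<xi>)) + (LINT \<xi>|lborel. m \<xi> * FT w \<xi>)"
      by (simp only: Bochner_Integration.integral_add Bochner_Integration.integrable_add integrable_mult_right p pw(1) Bochner_Integration.integral_mult_right_zero)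
    also have "\<dots> = (LINT \<xi>|lborel. m \<xi> * FT w \<xi>)"
      using orth[OF test(1)] orth[OF test(2)] unfolding m_def[symmetric] by simp
    finally show "cmod (LINT \<xi>|lborel. complex_of_real (norm \<xi> powr (2 * s)) * Y \<xi> * gauss_exp t a b \<xi>) \<le> sqrt (K * B)"
      using pw(2) unfolding m_def[symmetric] by simp
  qed
qed

section \<open>Holomorphic extension of the heat flow\<close>

text \<open>Trades the weight for an arbitrarily small part of a Gaussian: for
  \<open>norm \<xi> > 1\<close> it is at most \<open>norm \<xi> ^ 4 = x\<^sup>2 / c\<^sup>2\<close>
  with \<open>x = c * (norm \<xi>)\<^sup>2\<close>, and
  \<open>x\<^sup>2 \<le> 2 * exp x\<close>.\<close>

lemma norm_powr_le_exp:
  fixes \<xi> :: "'a::euclidean_space"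
  assumes "0 < s" "s < 2" "c > 0"
  shows "norm \<xi> powr (2 * s) \<le> (1 + 2 / c\<^sup>2) * exp (c * (norm \<xi>)\<^sup>2)"
proof (cases "norm \<xi> \<le> 1")
  case True
  then have "norm \<xi> powr (2 * s) \<le> 1"
    using assms powr_mono'[of 0 "2 * s" "norm \<xi>"] by (cases "\<xi> = 0") auto
  moreover have "1 * 1 \<le> (1 + 2 / c\<^sup>2) * exp (c * (norm \<xi>)\<^sup>2)"
    using assms by (intro mult_mono) auto
  ultimately show ?thesis by linarith
next
  case False
  define x where "x = c * (norm \<xi>)\<^sup>2"
  have x: "x \<ge> 0" using assms by (simp add: x_def)
  have "norm \<xi> powr (2 * s) \<le> norm \<xi> powr (real 4)"
    using False assms by (intro powr_mono) auto
  also have "\<dots> = norm \<xi> ^ 4"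
    using False by (subst powr_realpow) auto
  also have "\<dots> = x\<^sup>2 / c\<^sup>2"
    using assms by (simp add: x_def power_mult_distrib flip: power_mult)
  also have "\<dots> \<le> (2 * exp x) / c\<^sup>2"
    using exp_lower_Taylor_quadratic[OF x] x by (intro divide_right_mono) auto
  also have "\<dots> \<le> (1 + 2 / c\<^sup>2) * exp x" by (simp add: distrib_right)
  finally show ?thesis by (simp only: x_def)
qed

lemma cmod_gauss_exp: "cmod (gauss_exp t a b \<xi>) = exp (- t * (norm \<xi>)\<^sup>2 - b \<bullet> \<xi>)"
  by (simp add: norm_mult)

lemma gauss_exp_le:
  assumes "norm b \<le> R"
  shows "exp (- t * (norm \<xi>)\<^sup>2 - b \<bullet> \<xi>) \<le> exp (R * norm \<xi> - t * (norm \<xi>)\<^sup>2)"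
proof -
  have "\<bar>b \<bullet> \<xi>\<bar> \<le> R * norm \<xi>"
    using Cauchy_Schwarz_ineq2[of b \<xi>] assms by (meson mult_right_mono norm_ge_zero order.trans)
  then show ?thesis by (simp add: abs_le_iff)
qed

text \<open>Expanding the exponential under the integral yields an everywhere convergent power
  series in \<open>\<zeta>\<close>; the partial sums are dominated by
  \<open>exp (cmod \<zeta> * \<bar>k \<xi>\<bar>)\<close>, so no differentiation under the integral
  is involved.\<close>

lemma holomorphic_exp_integral:
  fixes f :: "'b \<Rightarrow> complex" and k :: "'b \<Rightarrow> real"
  assumes [measurable]: "f \<in> borel_measurable M" "k \<in> borel_measurable M"
    and int: "\<And>R. integrable M (\<lambda>\<xi>. cmod (f \<xi>) * exp (R * \<bar>k \<xi>\<bar>))"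
  shows "(\<lambda>\<zeta>. LINT \<xi>|M. f \<xi> * exp (\<i> * \<zeta> * complex_of_real (k \<xi>))) holomorphic_on S"
proof -
  define c where "c n = (LINT \<xi>|M. f \<xi> * ((\<i> * complex_of_real (k \<xi>)) ^ n /\<^sub>R fact n))" for n
  let ?G = "\<lambda>\<zeta>. LINT \<xi>|M. f \<xi> * exp (\<i> * \<zeta> * complex_of_real (k \<xi>))"
  have partial: "cmod (\<Sum>i<n. (\<zeta> * (\<i> * complex_of_real x)) ^ i /\<^sub>R fact i) \<le> exp (cmod \<zeta> * \<bar>x\<bar>)" for \<zeta> x n
  proof -
    have "cmod (\<Sum>i<n. (\<zeta> * (\<i> * complex_of_real x)) ^ i /\<^sub>R fact i) \<le> (\<Sum>i<n. (cmod \<zeta> * \<bar>x\<bar>) ^ i /\<^sub>R fact i)"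
      by (rule order.trans[OF norm_sum]) (simp add: norm_mult norm_power norm_divide)
    also have "\<dots> \<le> (\<Sum>i. (cmod \<zeta> * \<bar>x\<bar>) ^ i /\<^sub>R fact i)"
      by (intro sum_le_suminf summable_exp_generic) auto
    also have "\<dots> = exp (cmod \<zeta> * \<bar>x\<bar>)" by (simp add: exp_def)
    finally show ?thesis .
  qed
  have int_n: "integrable M (\<lambda>\<xi>. f \<xi> * ((\<i> * complex_of_real (k \<xi>)) ^ n /\<^sub>R fact n))" for n
  proof (rule Bochner_Integration.integrable_bound[OF int[of 1]])
    show "AE \<xi> in M. norm (f \<xi> * ((\<i> * complex_of_real (k \<xi>)) ^ n /\<^sub>R fact n)) \<le> norm (cmod (f \<xi>) * exp (1 * \<bar>k \<xi>\<bar>))"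
    proof (rule AE_I2)
      fix \<xi>
      have "(\<bar>k \<xi>\<bar>) ^ n /\<^sub>R fact n \<le> (\<Sum>i. \<bar>k \<xi>\<bar> ^ i /\<^sub>R fact i)"
        using sum_le_suminf[OF summable_exp_generic[of "\<bar>k \<xi>\<bar>"], of "{n}"] by simp
      then have "\<bar>k \<xi>\<bar> ^ n /\<^sub>R fact n \<le> exp \<bar>k \<xi>\<bar>" by (simp add: exp_def)
      then have "cmod (f \<xi>) * (\<bar>k \<xi>\<bar> ^ n /\<^sub>R fact n) \<le> cmod (f \<xi>) * exp \<bar>k \<xi>\<bar>"
        by (rule mult_left_mono) simp
      then show "norm (f \<xi> * ((\<i> * complex_of_real (k \<xi>)) ^ n /\<^sub>R fact n)) \<le> norm (cmod (f \<xi>) * exp (1 * \<bar>k \<xi>\<bar>))"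
        by (simp add: norm_mult norm_power mult.left_commute)
    qed
  qed measurable
  have sums: "(\<lambda>n. c n * (\<zeta> - 0) ^ n) sums ?G \<zeta>" for \<zeta>
  proof -
    have "(\<lambda>n. LINT \<xi>|M. f \<xi> * (\<Sum>i<n. (\<zeta> * (\<i> * complex_of_real (k \<xi>))) ^ i /\<^sub>R fact i)) \<longlonglongrightarrow> ?G \<zeta>"
    proof (rule integral_dominated_convergence[where w="\<lambda>\<xi>. cmod (f \<xi>) * exp (cmod \<zeta> * \<bar>k \<xi>\<bar>)"])
      show "AE \<xi> in M. (\<lambda>n. f \<xi> * (\<Sum>i<n. (\<zeta> * (\<i> * complex_of_real (k \<xi>))) ^ i /\<^sub>R fact i)) \<longlonglongrightarrow> f \<xi> * exp (\<i> * \<zeta> * complex_of_real (k \<xi>))"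
      proof (intro AE_I2 tendsto_mult tendsto_const)
        fix \<xi>
        have "(\<lambda>n. (\<zeta> * (\<i> * complex_of_real (k \<xi>))) ^ n /\<^sub>R fact n) sums exp (\<zeta> * (\<i> * complex_of_real (k \<xi>)))"
          by (rule exp_converges)
        then show "(\<lambda>n. \<Sum>i<n. (\<zeta> * (\<i> * complex_of_real (k \<xi>))) ^ i /\<^sub>R fact i) \<longlonglongrightarrow> exp (\<i> * \<zeta> * complex_of_real (k \<xi>))"
          unfolding sums_def by (simp only: mult_ac)
      qed
      show "AE \<xi> in M. norm (f \<xi> * (\<Sum>i<n. (\<zeta> * (\<i> * complex_of_real (k \<xi>))) ^ i /\<^sub>R fact i)) \<le> cmod (f \<xi>) * exp (cmod \<zeta> * \<bar>k \<xi>\<bar>)" for n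
        unfolding norm_mult[of "f _"] by (intro AE_I2 mult_left_mono partial) auto
      show "integrable M (\<lambda>\<xi>. cmod (f \<xi>) * exp (cmod \<zeta> * \<bar>k \<xi>\<bar>))" by (rule int)
    qed measurable
    moreover have "(LINT \<xi>|M. f \<xi> * (\<Sum>i<n. (\<zeta> * (\<i> * complex_of_real (k \<xi>))) ^ i /\<^sub>R fact i)) = (\<Sum>i<n. c i * (\<zeta> - 0) ^ i)" for n
    proof -
      have "(LINT \<xi>|M. f \<xi> * (\<Sum>i<n. (\<zeta> * (\<i> * complex_of_real (k \<xi>))) ^ i /\<^sub>R fact i))
         = (LINT \<xi>|M. (\<Sum>i<n. \<zeta> ^ i * (f \<xi> * ((\<i> * complex_of_real (k \<xi>)) ^ i /\<^sub>R fact i))))"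
        by (intro Bochner_Integration.integral_cong refl) (simp add: sum_distrib_left power_mult_distrib mult_ac)
      also have "\<dots> = (\<Sum>i<n. LINT \<xi>|M. \<zeta> ^ i * (f \<xi> * ((\<i> * complex_of_real (k \<xi>)) ^ i /\<^sub>R fact i)))"
        by (intro Bochner_Integration.integral_sum integrable_mult_right int_n)
      also have "\<dots> = (\<Sum>i<n. c i * (\<zeta> - 0) ^ i)"
        by (simp only: Bochner_Integration.integral_mult_right_zero c_def diff_zero mult.commute)
      finally show ?thesis .
    qed
    ultimately show ?thesis unfolding sums_def by simp
  qed
  have "?G holomorphic_on ball 0 r" for r
    by (rule power_series_holomorphic[of 0 r c]) (rule sums)
  then have "?G field_differentiable at z" for z
    by (intro holomorphic_on_imp_differentiable_at[of _ "ball 0 (cmod z + 1)"]) auto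
  then show ?thesis
    unfolding holomorphic_on_def by (blast intro: field_differentiable_at_within)
qed

section \<open>Heat flow of a function and of its fractional Laplacian at complex points\<close>

locale weighted_data =
  fixes s :: real and Y :: "'a::euclidean_space \<Rightarrow> complex"
  assumes s: "0 < s" "s < 2" "2 * s < real DIM('a)"
    and Y_meas [measurable]: "Y \<in> borel_measurable borel" and Y_fin: "weighted_sq s Y < \<infinity>"
begin

text \<open>When \<open>Y\<close> is the unnormalised transform of \<open>u\<close>, this is the
  heat flow of \<open>u\<close> at time \<open>t\<close> and point \<open>a + i b\<close>, up to
  \<open>(2 * pi) ^ N\<close>.\<close>

definition heat_ext :: "real \<Rightarrow> 'a \<Rightarrow> 'a \<Rightarrow> complex" where
  "heat_ext t a b = (LINT \<xi>|lborel. Y \<xi> * gauss_exp t a b \<xi>)"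

text \<open>The function \<open>v\<close> with index \<open>t\<close> of the overview, at the point
  \<open>a + i b\<close>.\<close>

definition heat_lap :: "real \<Rightarrow> 'a \<Rightarrow> 'a \<Rightarrow> complex" where
  "heat_lap t a b = (LINT \<xi>|lborel. complex_of_real (norm \<xi> powr (2 * s)) * Y \<xi> * gauss_exp t a b \<xi>)"

lemma heat_ext_integrable:
  assumes "t > 0"
  shows "integrable lborel (\<lambda>\<xi>. Y \<xi> * gauss_exp t a b \<xi>)"
  by (rule weighted_pairing(1)[where s=s and A="enn2real (weighted_sq s Y)" and B="enn2real (weighted_sq (- s) (gauss_exp t a b))"])
     (use Y_fin weighted_sq_gauss_exp(2)[OF s(1,3) assms order.refl, where a=a and b=b] in \<open>auto simp: less_top\<close>)

text \<open>\<open>exp (R * norm \<xi>)\<close> majorises \<open>exp (- (b \<bullet> \<xi>))\<close>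
  for all \<open>b\<close> of norm at most \<open>R\<close>, so this is a common dominating
  function.\<close>

lemma heat_ext_integrable_exp:
  assumes "t > 0"
  shows "integrable lborel (\<lambda>\<xi>. cmod (Y \<xi>) * exp (R * norm \<xi> - t * (norm \<xi>)\<^sup>2))"
proof -
  let ?m = "\<lambda>\<xi>::'a. complex_of_real (exp (R * norm \<xi> - t * (norm \<xi>)\<^sup>2))"
  have "weighted_sq (- s) ?m = (\<integral>\<^sup>+\<xi>. ennreal (norm (\<xi>::'a) powr (- 2 * s) * exp (2 * R * norm \<xi> - (2 * t) * (norm \<xi>)\<^sup>2)) \<partial>lborel)"
    unfolding weighted_sq_def by (intro nn_integral_cong arg_cong[where f=ennreal]) (simp add: exp_double[symmetric] algebra_simps)
  also have "\<dots> < \<infinity>" by (rule nn_integral_singular_gaussian_exp[OF s(1,3)]) (use assms in simp)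
  finally have fin: "weighted_sq (- s) ?m < \<infinity>" .
  have "integrable lborel (\<lambda>\<xi>. Y \<xi> * ?m \<xi>)"
    by (rule weighted_pairing(1)[where s=s and A="enn2real (weighted_sq s Y)" and B="enn2real (weighted_sq (- s) ?m)"])
       (use Y_fin fin in \<open>auto simp: less_top\<close>)
  then have "integrable lborel (\<lambda>\<xi>. cmod (Y \<xi> * ?m \<xi>))" by (rule integrable_norm)
  then show ?thesis by (simp add: norm_mult)
qed

lemma powr_exp_integral:
  assumes "r > 0"
  shows "integrable lborel (\<lambda>t. indicator {0..} t * t powr (s - 1) * exp (- t * r))"
    and "(LINT t|lborel. indicator {0..} t * t powr (s - 1) * exp (- t * r)) = Gamma s * r powr (- s)"
proof -
  have G: "Gamma s * r powr (- s) \<ge> 0" using s by (simp add: Gamma_real_pos less_imp_le)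
  have "has_bochner_integral lborel (\<lambda>t. indicator {0..} t * t powr (s - 1) * exp (- t * r)) (Gamma s * r powr (- s))"
    by (rule has_bochner_integral_nn_integral) (use nn_integral_powr_exp[OF s(1) assms] G in auto)
  then show "integrable lborel (\<lambda>t. indicator {0..} t * t powr (s - 1) * exp (- t * r))"
    "(LINT t|lborel. indicator {0..} t * t powr (s - 1) * exp (- t * r)) = Gamma s * r powr (- s)"
    by (auto simp: has_bochner_integral_iff)
qed

lemma norm_powr_cancel:
  fixes \<xi> :: 'a
  assumes "\<xi> \<noteq> 0"
  shows "((norm \<xi>)\<^sup>2) powr (- s) * norm \<xi> powr (2 * s) = 1"
proof -
  have "(norm \<xi>)\<^sup>2 = norm \<xi> powr real 2"
    using assms by (intro powr_realpow[symmetric]) simp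
  then have "((norm \<xi>)\<^sup>2) powr (- s) = norm \<xi> powr (real 2 * - s)"
    by (simp only: powr_powr)
  then have "((norm \<xi>)\<^sup>2) powr (- s) * norm \<xi> powr (2 * s) = norm \<xi> powr (real 2 * - s + 2 * s)"
    by (simp only: powr_add)
  then show ?thesis using assms by simp
qed

text \<open>For \<open>\<xi> \<noteq> 0\<close> the integral over \<open>t\<close> produces
  \<open>Gamma s * norm \<xi> powr (- 2 * s)\<close>, which cancels the weight in
  \<open>heat_lap\<close>. The shift by \<open>\<epsilon> > 0\<close> leaves a Gaussian factor, so
  the double integral converges absolutely and Fubini applies.\<close>

lemma heat_ext_eq_integral:
  assumes \<epsilon>: "\<epsilon> > 0"
  shows "(LINT t|lborel. complex_of_real (indicator {0..} t * t powr (s - 1)) * heat_lap (t + \<epsilon>) a b)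
     = complex_of_real (Gamma s) * heat_ext \<epsilon> a b"
proof -
  let ?i = "\<lambda>t::real. indicator {0..} t * t powr (s - 1) :: real"
  let ?n = "\<lambda>\<xi>::'a. norm \<xi> powr (2 * s)"
  let ?f = "\<lambda>\<xi> t. complex_of_real (?i t) * (complex_of_real (?n \<xi>) * Y \<xi> * gauss_exp (t + \<epsilon>) a b \<xi>)"
  have f: "?f \<xi> t = complex_of_real (?i t * exp (- t * (norm \<xi>)\<^sup>2)) * (complex_of_real (?n \<xi>) * (Y \<xi> * gauss_exp \<epsilon> a b \<xi>))" for \<xi> t
  proof -
    have "exp (- (t + \<epsilon>) * (norm \<xi>)\<^sup>2 - b \<bullet> \<xi>) = exp (- t * (norm \<xi>)\<^sup>2) * exp (- \<epsilon> * (norm \<xi>)\<^sup>2 - b \<bullet> \<xi>)"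
      by (simp add: algebra_simps flip: exp_add)
    then show ?thesis by (simp only: of_real_mult mult_ac)
  qed
  have i0: "?i t \<ge> 0" for t by simp
  have ae0: "AE \<xi>::'a in lborel. \<xi> \<noteq> 0"
    by (rule AE_lborel_if_not_negligible[of "{0}"]) auto
  have int_t: "integrable lborel (\<lambda>t. ?f \<xi> t)" if "\<xi> \<noteq> 0" for \<xi>
    unfolding f using powr_exp_integral(1)[of "(norm \<xi>)\<^sup>2"] that
    by (intro integrable_mult_left integrable_of_real) (simp add: mult.assoc)
  have LINT_t: "(LINT t|lborel. ?f \<xi> t) = complex_of_real (Gamma s) * (Y \<xi> * gauss_exp \<epsilon> a b \<xi>)" if "\<xi> \<noteq> 0" for \<xi>
  proof -
    have "(LINT t|lborel. ?f \<xi> t) = complex_of_real (LINT t|lborel. ?i t * exp (- t * (norm \<xi>)\<^sup>2)) * (complex_of_real (?n \<xi>) * (Y \<xi> * gauss_exp \<epsilon> a b \<xi>))"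
      unfolding f by (simp only: Bochner_Integration.integral_mult_left_zero integral_complex_of_real)
    also have "\<dots> = complex_of_real (Gamma s * (((norm \<xi>)\<^sup>2) powr (- s) * ?n \<xi>)) * (Y \<xi> * gauss_exp \<epsilon> a b \<xi>)"
      using that by (subst powr_exp_integral(2)) (simp_all add: mult_ac)
    finally show ?thesis by (simp only: norm_powr_cancel[OF that] mult_1_right)
  qed
  have "integrable (lborel \<Otimes>\<^sub>M lborel) (\<lambda>(\<xi>, t). ?f \<xi> t)"
  proof (rule lborel_pair.Fubini_integrable)
    show "AE \<xi> in lborel. integrable lborel (\<lambda>t. case (\<xi>, t) of (\<xi>, t) \<Rightarrow> ?f \<xi> t)"
      using ae0 by eventually_elim (unfold prod.case, rule int_t)
    have "(LINT t|lborel. norm (?f \<xi> t)) = Gamma s * cmod (Y \<xi> * gauss_exp \<epsilon> a b \<xi>)" if "\<xi> \<noteq> 0" for \<xi>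
    proof -
      have "(LINT t|lborel. norm (?f \<xi> t)) = (LINT t|lborel. ?i t * exp (- t * (norm \<xi>)\<^sup>2)) * (?n \<xi> * cmod (Y \<xi> * gauss_exp \<epsilon> a b \<xi>))"
        unfolding f norm_mult norm_of_real
        by (simp only: Bochner_Integration.integral_mult_left_zero) (simp add: abs_mult)
      also have "\<dots> = Gamma s * (((norm \<xi>)\<^sup>2) powr (- s) * ?n \<xi>) * cmod (Y \<xi> * gauss_exp \<epsilon> a b \<xi>)"
        using that by (subst powr_exp_integral(2)) (simp_all add: mult_ac)
      finally show ?thesis by (simp only: norm_powr_cancel[OF that] mult_1_right)
    qed
    then have ae: "AE \<xi> in lborel. (LINT t|lborel. norm (?f \<xi> t)) = Gamma s * cmod (Y \<xi> * gauss_exp \<epsilon> a b \<xi>)"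
      using ae0 by (auto elim: eventually_mono)
    have "integrable lborel (\<lambda>\<xi>. Gamma s * cmod (Y \<xi> * gauss_exp \<epsilon> a b \<xi>))"
      by (intro integrable_mult_right integrable_norm heat_ext_integrable \<epsilon>)
    then have "integrable lborel (\<lambda>\<xi>. LINT t|lborel. norm (?f \<xi> t))"
      by (subst integrable_cong_AE[OF _ _ ae]) measurable
    then show "integrable lborel (\<lambda>\<xi>. LINT t|lborel. norm (case (\<xi>, t) of (\<xi>, t) \<Rightarrow> ?f \<xi> t))"
      by simp
  qed measurable
  from lborel_pair.Fubini_integral[OF this]
  have "(LINT t|lborel. LINT \<xi>|lborel. ?f \<xi> t) = (LINT \<xi>|lborel. LINT t|lborel. ?f \<xi> t)" .
  also have "\<dots> = (LINT \<xi>|lborel. complex_of_real (Gamma s) * (Y \<xi> * gauss_exp \<epsilon> a b \<xi>))"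
  proof (rule integral_cong_AE)
    show "AE \<xi> in lborel. (LINT t|lborel. ?f \<xi> t) = complex_of_real (Gamma s) * (Y \<xi> * gauss_exp \<epsilon> a b \<xi>)"
      using ae0 by eventually_elim (rule LINT_t)
  qed measurable
  also have "\<dots> = complex_of_real (Gamma s) * heat_ext \<epsilon> a b"
    unfolding heat_ext_def by (rule Bochner_Integration.integral_mult_right_zero)
  also have "(LINT t|lborel. LINT \<xi>|lborel. ?f \<xi> t) = (LINT t|lborel. complex_of_real (?i t) * heat_lap (t + \<epsilon>) a b)"
    unfolding heat_lap_def by (simp only: Bochner_Integration.integral_mult_right_zero)
  finally show ?thesis .
qed

text \<open>With \<open>r = (norm \<xi>)\<^sup>2\<close> and \<open>t \<ge> 1\<close>,
  \<open>exp (- t * r) \<le> exp (- r / 2) * exp (- t * r / 2)\<close>. Integrating the second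
  factor against \<open>t powr (s - 1)\<close> cancels the weight, and the first keeps the frequency
  integral finite. \<open>R\<close> is arbitrary here, in contrast to small times.\<close>

lemma heat_lap_tail:
  "(\<integral>\<^sup>+t. ennreal (indicator {1..} t * t powr (s - 1)) *
      (\<integral>\<^sup>+\<xi>. ennreal (norm \<xi> powr (2 * s) * cmod (Y \<xi>) * exp (R * norm \<xi> - t * (norm \<xi>)\<^sup>2)) \<partial>lborel) \<partial>lborel) < \<infinity>"
proof -
  let ?i1 = "\<lambda>t::real. indicator {1..} t * t powr (s - 1) :: real"
  let ?i = "\<lambda>t::real. indicator {0..} t * t powr (s - 1) :: real"
  let ?n = "\<lambda>\<xi>::'a. norm \<xi> powr (2 * s) * cmod (Y \<xi>)"
  have G: "Gamma s > 0" using s by (simp add: Gamma_real_pos)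
  have "(\<integral>\<^sup>+t. ennreal (?i1 t) * (\<integral>\<^sup>+\<xi>. ennreal (?n \<xi> * exp (R * norm \<xi> - t * (norm \<xi>)\<^sup>2)) \<partial>lborel) \<partial>lborel)
     = (\<integral>\<^sup>+t. (\<integral>\<^sup>+\<xi>. ennreal (?i1 t) * ennreal (?n \<xi> * exp (R * norm \<xi> - t * (norm \<xi>)\<^sup>2)) \<partial>lborel) \<partial>lborel)"
    by (intro nn_integral_cong nn_integral_cmult[symmetric]) measurable
  also have "\<dots> = (\<integral>\<^sup>+\<xi>. (\<integral>\<^sup>+t. ennreal (?i1 t) * ennreal (?n \<xi> * exp (R * norm \<xi> - t * (norm \<xi>)\<^sup>2)) \<partial>lborel) \<partial>lborel)"
    by (rule lborel_pair.Fubini') measurable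
  also have "\<dots> \<le> (\<integral>\<^sup>+\<xi>. ennreal (Gamma s * 2 powr s) * ennreal (cmod (Y \<xi>) * exp (R * norm \<xi> - (1 / 2) * (norm \<xi>)\<^sup>2)) \<partial>lborel)"
  proof (rule nn_integral_mono)
    fix \<xi> :: 'a
    show "(\<integral>\<^sup>+t. ennreal (?i1 t) * ennreal (?n \<xi> * exp (R * norm \<xi> - t * (norm \<xi>)\<^sup>2)) \<partial>lborel)
      \<le> ennreal (Gamma s * 2 powr s) * ennreal (cmod (Y \<xi>) * exp (R * norm \<xi> - (1 / 2) * (norm \<xi>)\<^sup>2))"
    proof (cases "\<xi> = 0")
      case False
      let ?c = "?n \<xi> * exp (R * norm \<xi> - (1 / 2) * (norm \<xi>)\<^sup>2)"
      define r where "r = (norm \<xi>)\<^sup>2"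
      have r: "r > 0" using False by (simp add: r_def)
      have "(\<integral>\<^sup>+t. ennreal (?i1 t) * ennreal (?n \<xi> * exp (R * norm \<xi> - t * r)) \<partial>lborel)
        \<le> (\<integral>\<^sup>+t. ennreal (?n \<xi> * exp (R * norm \<xi> - (1 / 2) * r)) * ennreal (?i t * exp (- t * (r / 2))) \<partial>lborel)"
      proof (rule nn_integral_mono)
        fix t :: real
        show "ennreal (?i1 t) * ennreal (?n \<xi> * exp (R * norm \<xi> - t * r))
          \<le> ennreal (?n \<xi> * exp (R * norm \<xi> - (1 / 2) * r)) * ennreal (?i t * exp (- t * (r / 2)))"
        proof (cases "t \<ge> 1")
          case True
          have "R * norm \<xi> - t * r \<le> R * norm \<xi> - (1 / 2) * r + - t * (r / 2)"
            using True r mult_right_mono[of 1 t r] by (simp add: field_simps)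
          then have "exp (R * norm \<xi> - t * r) \<le> exp (R * norm \<xi> - (1 / 2) * r) * exp (- t * (r / 2))"
            by (simp only: exp_add[symmetric] exp_le_cancel_iff)
          then have "t powr (s - 1) * (?n \<xi> * exp (R * norm \<xi> - t * r)) \<le> t powr (s - 1) * (?n \<xi> * (exp (R * norm \<xi> - (1 / 2) * r) * exp (- t * (r / 2))))"
            by (intro mult_left_mono) auto
          then show ?thesis using True
            by (simp add: ennreal_mult[symmetric] mult_ac ennreal_leI)
        qed simp
      qed
      also have "\<dots> = ennreal (?n \<xi> * exp (R * norm \<xi> - (1 / 2) * r)) * (\<integral>\<^sup>+t. ennreal (?i t * exp (- t * (r / 2))) \<partial>lborel)"
        by (rule nn_integral_cmult) measurable
      also have "\<dots> = ennreal (?n \<xi> * exp (R * norm \<xi> - (1 / 2) * r)) * ennreal (Gamma s * (r / 2) powr (- s))"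
        using nn_integral_powr_exp[OF s(1), of "r / 2"] r by (simp add: mult.assoc)
      also have "\<dots> = ennreal (Gamma s * 2 powr s) * ennreal (cmod (Y \<xi>) * exp (R * norm \<xi> - (1 / 2) * r))"
      proof -
        have "(r / 2) powr (- s) = 2 powr s * r powr (- s)"
          by (simp only: powr_divide) (simp add: powr_minus divide_inverse)
        then have "(?n \<xi> * exp (R * norm \<xi> - (1 / 2) * r)) * (Gamma s * (r / 2) powr (- s))
           = (Gamma s * 2 powr s) * ((r powr (- s) * norm \<xi> powr (2 * s)) * (cmod (Y \<xi>) * exp (R * norm \<xi> - (1 / 2) * r)))"
          by (simp only: mult_ac)
        also have "r powr (- s) * norm \<xi> powr (2 * s) = 1" unfolding r_def by (rule norm_powr_cancel[OF False])
        finally show ?thesis using G by (simp add: ennreal_mult[symmetric])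
      qed
      finally show ?thesis unfolding r_def .
    qed simp
  qed
  also have "\<dots> = ennreal (Gamma s * 2 powr s) * (\<integral>\<^sup>+\<xi>. ennreal (cmod (Y \<xi>) * exp (R * norm \<xi> - (1 / 2) * (norm \<xi>)\<^sup>2)) \<partial>lborel)"
    by (rule nn_integral_cmult) measurable
  also have "\<dots> < \<infinity>"
    using heat_ext_integrable_exp[of "1 / 2" R] by (subst nn_integral_eq_integral) (auto simp: ennreal_mult_less_top)
  finally show ?thesis .
qed

end

section \<open>Zero sets\<close>

text \<open>The identity theorem for the holomorphic extension \<open>g\<close> of \<open>F\<close>
  along a line: real zeros accumulating at \<open>0\<close> force \<open>g\<close> to vanish on the
  connected set \<open>D\<close>.\<close>

lemma holomorphic_line_zero:
  fixes F :: "'a::euclidean_space \<Rightarrow> complex"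
  assumes g: "g holomorphic_on D" and D: "open D" "connected D" "0 \<in> D"
    and gF: "\<And>\<tau>. complex_of_real \<tau> \<in> D \<Longrightarrow> g (complex_of_real \<tau>) = F (x + \<tau> *\<^sub>R v)"
    and acc: "\<And>d. d > 0 \<Longrightarrow> \<exists>\<tau>. 0 < \<bar>\<tau>\<bar> \<and> \<bar>\<tau>\<bar> < d \<and> F (x + \<tau> *\<^sub>R v) = 0"
    and \<sigma>: "complex_of_real \<sigma> \<in> D"
  shows "F (x + \<sigma> *\<^sub>R v) = 0"
proof -
  define U where "U = {\<zeta> \<in> D. g \<zeta> = 0}"
  obtain r where r: "r > 0" "ball 0 r \<subseteq> D" using open_contains_ball[of D] D(1,3) by blast
  have lp: "0 islimpt U"
    unfolding islimpt_approachable
  proof (intro allI impI)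
    fix e :: real assume e: "e > 0"
    have "min e r > 0" using e r(1) by simp
    from acc[OF this] obtain \<tau> where \<tau>: "0 < \<bar>\<tau>\<bar>" "\<bar>\<tau>\<bar> < min e r" "F (x + \<tau> *\<^sub>R v) = 0"
      by blast
    have "complex_of_real \<tau> \<in> ball 0 r" using \<tau> by simp
    then have "complex_of_real \<tau> \<in> D" using r(2) by blast
    then have "complex_of_real \<tau> \<in> U" using gF \<tau> by (simp add: U_def)
    then show "\<exists>x'\<in>U. x' \<noteq> 0 \<and> dist x' 0 < e"
      using \<tau> by (intro bexI[of _ "complex_of_real \<tau>"]) auto
  qed
  have "g (complex_of_real \<sigma>) = 0"
  proof (rule analytic_continuation[OF g D(1,2) _ D(3) lp _ \<sigma>])
    show "U \<subseteq> D" "\<And>z. z \<in> U \<Longrightarrow> g z = 0" by (auto simp: U_def)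
  qed
  then show ?thesis using gF[OF \<sigma>] by simp
qed

text \<open>Infinitely many small translates of \<open>N\<close> along \<open>v\<close> are pairwise disjoint and lie in one bounded set.\<close>

lemma emeasure_zero_if_isolated_along_line:
  fixes N :: "'a::euclidean_space set"
  assumes N: "N \<in> sets borel" "bounded N" and d: "d > 0"
    and iso: "\<And>x \<tau>. x \<in> N \<Longrightarrow> 0 < \<bar>\<tau>\<bar> \<Longrightarrow> \<bar>\<tau>\<bar> \<le> d \<Longrightarrow> x + \<tau> *\<^sub>R v \<notin> N"
  shows "emeasure lborel N = 0"
proof -
  obtain B where B: "\<And>x. x \<in> N \<Longrightarrow> norm x \<le> B" using N(2) unfolding bounded_iff by blast
  \<comment> \<open>Distinct positive shifts of size at most \<open>d\<close>: the difference of any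
    two is again nonzero and of size at most \<open>d\<close>, which isolation excludes.\<close>
  define \<tau> where "\<tau> j = d / real (Suc j)" for j
  define T where "T j = (\<lambda>x. \<tau> j *\<^sub>R v + x) ` N" for j
  have T_eq: "T j = (\<lambda>x. - (\<tau> j *\<^sub>R v) + x) -` N" for j
  proof (intro set_eqI iffI)
    fix y assume "y \<in> (\<lambda>x. - (\<tau> j *\<^sub>R v) + x) -` N"
    then show "y \<in> T j"
      unfolding T_def by (intro image_eqI[of _ _ "- (\<tau> j *\<^sub>R v) + y"]) auto
  qed (auto simp: T_def)
  have T_sets: "T j \<in> sets lborel" for j
  proof -
    have "(\<lambda>x. - (\<tau> j *\<^sub>R v) + x) -` N \<inter> space borel \<in> sets borel"
      by (rule measurable_sets[OF _ N(1)]) measurable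
    then show ?thesis unfolding T_eq by (simp only: space_borel Int_UNIV_right sets_lborel)
  qed
  have \<tau>: "0 < \<tau> j" "\<tau> j \<le> d" for j using d by (auto simp: \<tau>_def divide_le_eq)
  have T_meas: "emeasure lborel (T j) = emeasure lborel N" for j
  proof -
    have "emeasure lborel N = (\<integral>\<^sup>+x. indicator N x \<partial>lborel)" using N by simp
    also have "\<dots> = (\<integral>\<^sup>+x. indicator N (- (\<tau> j *\<^sub>R v) + x) \<partial>lborel)"
      by (rule nn_integral_lborel_translation[symmetric]) (use N in measurable)
    also have "\<dots> = (\<integral>\<^sup>+x. indicator (T j) x \<partial>lborel)"
      unfolding T_eq by (intro nn_integral_cong) (auto split: split_indicator)
    also have "\<dots> = emeasure lborel (T j)" using T_sets by simp
    finally show ?thesis ..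
  qed
  have disj: "disjoint_family T"
    unfolding disjoint_family_on_def
  proof (intro ballI impI)
    fix i j :: nat assume "i \<noteq> j"
    then have ne: "\<tau> i \<noteq> \<tau> j" using d by (simp add: \<tau>_def)
    show "T i \<inter> T j = {}"
    proof (rule ccontr)
      assume "T i \<inter> T j \<noteq> {}"
      then obtain x y where xy: "x \<in> N" "y \<in> N" "\<tau> i *\<^sub>R v + x = \<tau> j *\<^sub>R v + y" unfolding T_def by auto
      then have "y = x + (\<tau> i - \<tau> j) *\<^sub>R v" by (simp add: algebra_simps)
      moreover have "0 < \<bar>\<tau> i - \<tau> j\<bar>" "\<bar>\<tau> i - \<tau> j\<bar> \<le> d" using ne \<tau>[of i] \<tau>[of j] by auto
      ultimately show False using iso[OF xy(1)] xy(2) by blast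
    qed
  qed
  have "(\<Union>j. T j) \<subseteq> cball 0 (d * norm v + B)"
  proof
    fix y assume "y \<in> (\<Union>j. T j)"
    then obtain j x where x: "x \<in> N" "y = \<tau> j *\<^sub>R v + x" unfolding T_def by auto
    have "norm y \<le> \<tau> j * norm v + norm x" using norm_triangle_ineq[of "\<tau> j *\<^sub>R v" x] \<tau>[of j] x by simp
    also have "\<dots> \<le> d * norm v + B" using \<tau>[of j] B[OF x(1)] by (intro add_mono mult_right_mono) auto
    finally show "y \<in> cball 0 (d * norm v + B)" by simp
  qed
  then have "emeasure lborel (\<Union>j. T j) \<le> emeasure lborel (cball (0::'a) (d * norm v + B))"
    by (intro emeasure_mono) auto
  also have "\<dots> < \<infinity>" using emeasure_bounded_finite[OF bounded_cball] by simp
  finally have fin: "emeasure lborel (\<Union>j. T j) < \<infinity>" .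
  have sum: "(\<Sum>j. emeasure lborel (T j)) = emeasure lborel (\<Union>j. T j)"
    by (rule suminf_emeasure) (use T_sets disj in auto)
  show ?thesis
  proof (rule ccontr)
    assume "emeasure lborel N \<noteq> 0"
    have "(\<Sum>j::nat. emeasure lborel N) = \<infinity>"
    proof -
      have "of_nat n * emeasure lborel N \<le> (\<Sum>j::nat. emeasure lborel N)" for n
        using sum_le_suminf[of "\<lambda>_. emeasure lborel N" "{..<n}"] by simp
      then have "(SUP n. of_nat n * emeasure lborel N) \<le> (\<Sum>j::nat. emeasure lborel N)"
        by (intro SUP_least)
      moreover have "(SUP n::nat. of_nat n * emeasure lborel N) = (SUP n::nat. of_nat n) * emeasure lborel N"
        by (rule SUP_mult_right_ennreal[symmetric])
      ultimately show ?thesis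
        using \<open>emeasure lborel N \<noteq> 0\<close> by (simp add: ennreal_SUP_of_nat_eq_top ennreal_top_mult top_unique)
    qed
    then show False using sum fin unfolding T_meas by simp
  qed
qed

text \<open>\<open>N v k\<close> holds the zeros with no further zero within
  \<open>1 / (k + 1)\<close> along \<open>v\<close>, a null set by isolation. Discarding these for
  countably many \<open>v\<close>, together with the bounding sphere, leaves a zero in the open ball
  at which zeros accumulate in all those directions.\<close>

lemma zero_set_dichotomy:
  fixes F :: "'a::euclidean_space \<Rightarrow> complex"
  assumes cont: "continuous_on (cball x0 R) F"
    and line: "\<And>x v. x \<in> ball x0 R \<Longrightarrow> x + v \<in> ball x0 R \<Longrightarrow>
        (\<And>d. d > 0 \<Longrightarrow> \<exists>\<tau>. 0 < \<bar>\<tau>\<bar> \<and> \<bar>\<tau>\<bar> < d \<and> F (x + \<tau> *\<^sub>R v) = 0) \<Longrightarrow> F (x + v) = 0"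
    and pos: "emeasure lborel {x \<in> cball x0 R. F x = 0} \<noteq> 0" and x: "x \<in> ball x0 R"
  shows "F x = 0"
proof -
  define Z where "Z = {x \<in> cball x0 R. F x = 0}"
  have Z_closed: "closed Z"
  proof -
    have "Z = cball x0 R \<inter> F -` {0}" by (auto simp: Z_def)
    then show ?thesis using continuous_closed_preimage[OF cont closed_cball closed_singleton] by simp
  qed
  have Z_compact: "compact Z"
    using Z_closed by (rule compact_eq_bounded_closed[THEN iffD2, OF conjI, rotated])
      (auto simp: Z_def intro: bounded_subset[OF bounded_cball])
  \<comment> \<open>The lower bound \<open>1 / (m + 1)\<close> on the shift makes
    \<open>G v k m\<close> the continuous image of a compact set, so that \<open>N v k\<close> is
    Borel.\<close>
  define G where "G v k m = (\<lambda>(y, \<tau>). y - \<tau> *\<^sub>R v) ` (Z \<times> {\<tau>. 1 / real (Suc m) \<le> \<bar>\<tau>\<bar> \<and> \<bar>\<tau>\<bar> \<le> 1 / real (Suc k)})" for v k m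
  define N where "N v k = Z - (\<Union>m. G v k m)" for v k
  have G_closed: "closed (G v k m)" for v k m
  proof -
    let ?T = "{\<tau>::real. 1 / real (Suc m) \<le> \<bar>\<tau>\<bar> \<and> \<bar>\<tau>\<bar> \<le> 1 / real (Suc k)}"
    have "closed ?T" by (intro closed_Collect_conj closed_Collect_le continuous_intros)
    moreover have "bounded ?T" by (rule bounded_subset[of "{- (1 / real (Suc k))..1 / real (Suc k)}"]) auto
    ultimately have "compact ?T" by (simp add: compact_eq_bounded_closed)
    then have "compact (G v k m)"
      unfolding G_def using Z_compact
      by (intro compact_continuous_image compact_Times) (auto simp: case_prod_unfold intro!: continuous_intros)
    then show ?thesis by (rule compact_imp_closed)
  qed
  have N_null: "emeasure lborel (N v k) = 0" for v k
  proof (rule emeasure_zero_if_isolated_along_line)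
    show "N v k \<in> sets borel"
      unfolding N_def using Z_closed G_closed by (intro sets.Diff sets.countable_UN) auto
    show "bounded (N v k)" unfolding N_def using compact_imp_bounded[OF Z_compact] by (rule bounded_subset) auto
    show "1 / real (Suc k) > 0" by simp
    show "y + \<tau> *\<^sub>R v \<notin> N v k" if y: "y \<in> N v k" and \<tau>: "0 < \<bar>\<tau>\<bar>" "\<bar>\<tau>\<bar> \<le> 1 / real (Suc k)" for y \<tau>
    proof
      assume "y + \<tau> *\<^sub>R v \<in> N v k"
      then have "y + \<tau> *\<^sub>R v \<in> Z" by (simp add: N_def)
      moreover obtain m where "1 / real (Suc m) < \<bar>\<tau>\<bar>"
        using reals_Archimedean[OF \<tau>(1)] by (auto simp: inverse_eq_divide)
      ultimately have "y \<in> G v k m"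
        unfolding G_def using \<tau> by (intro image_eqI[of _ _ "(y + \<tau> *\<^sub>R v, \<tau>)"]) auto
      then show False using y by (auto simp: N_def)
    qed
  qed
  obtain D :: "'a set" where D: "countable D" "\<And>X. open X \<Longrightarrow> X \<noteq> {} \<Longrightarrow> \<exists>d\<in>D. d \<in> X"
    using countable_dense_exists by blast
  define M where "M = (\<Union>v\<in>D. \<Union>k. N v k) \<union> sphere x0 R"
  have N_sets: "N v k \<in> null_sets lborel" for v k
    using N_null[of v k] Z_closed G_closed unfolding null_sets_def N_def
    by (auto intro!: sets.Diff sets.countable_UN)
  have "M \<in> null_sets lborel"
    unfolding M_def
  proof (intro null_sets.Un null_sets_UN' D(1) countableI_type N_sets)
    show "sphere x0 R \<in> null_sets lborel"
      using negligible_sphere[of x0 R] by (simp add: negligible_iff_null_sets null_sets_completion_iff)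
  qed
  moreover have "Z \<notin> null_sets lborel" using pos unfolding Z_def by auto
  ultimately have "\<not> Z \<subseteq> M"
    using Z_closed by (auto intro: null_sets_subset)
  then obtain z where z: "z \<in> Z" "z \<notin> M" by blast
  then have zb: "z \<in> ball x0 R" by (auto simp: Z_def M_def)
  have zero: "F (z + v) = 0" if v: "v \<in> D" "z + v \<in> ball x0 R" for v
  proof (rule line[OF zb v(2)])
    fix d :: real assume "d > 0"
    then obtain k where k: "1 / real (Suc k) < d"
      using reals_Archimedean[of d] by (auto simp: inverse_eq_divide)
    have "z \<notin> N v k" using z(2) v(1) by (auto simp: M_def)
    then obtain m where "z \<in> G v k m" using z(1) by (auto simp: N_def)
    then obtain y \<tau> where y: "y \<in> Z" "1 / real (Suc m) \<le> \<bar>\<tau>\<bar>" "\<bar>\<tau>\<bar> \<le> 1 / real (Suc k)" "z = y - \<tau> *\<^sub>R v"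
      by (auto simp: G_def)
    have "0 < \<bar>\<tau>\<bar>" using y(2) by (rule less_le_trans[rotated]) simp
    then show "\<exists>\<tau>. 0 < \<bar>\<tau>\<bar> \<and> \<bar>\<tau>\<bar> < d \<and> F (z + \<tau> *\<^sub>R v) = 0"
      using y k by (intro exI[of _ \<tau>]) (auto simp: Z_def)
  qed
  show ?thesis
  proof (rule ccontr)
    assume "F x \<noteq> 0"
    have "continuous_on (ball x0 R) F" using cont by (rule continuous_on_subset) auto
    then have "open (ball x0 R \<inter> F -` (- {0}))"
      by (rule continuous_open_preimage) auto
    then have "open ((\<lambda>v. z + v) -` (ball x0 R \<inter> F -` (- {0})))"
      by (intro open_vimage continuous_intros)
    moreover have "x - z \<in> (\<lambda>v. z + v) -` (ball x0 R \<inter> F -` (- {0}))"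
      using x \<open>F x \<noteq> 0\<close> by simp
    ultimately obtain v where v: "v \<in> D" "v \<in> (\<lambda>v. z + v) -` (ball x0 R \<inter> F -` (- {0}))"
      using D(2)[of "(\<lambda>v. z + v) -` (ball x0 R \<inter> F -` (- {0}))"] by blast
    then have "z + v \<in> ball x0 R" "F (z + v) \<noteq> 0" by auto
    then show False using zero[OF v(1)] by blast
  qed
qed

section \<open>Identification of a function with the limit of its heat flow\<close>

text \<open>The limits in \<open>n\<close> and \<open>k\<close> have to be exchanged. Over
  \<open>B\<close>, the difference of two heat flows is bounded by
  \<open>\<bar>\<phi> i y - \<phi> j y\<bar>\<close> integrated against \<open>m k\<close>, the heat
  flow of the indicator of \<open>B\<close>. For every \<open>k\<close> this weight lies between
  \<open>0\<close> and \<open>1\<close> and has mass \<open>emeasure lborel B\<close>, so the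
  estimate in \<open>n\<close> is uniform in \<open>k\<close>.\<close>

lemma L1_identification:
  fixes \<phi> :: "nat \<Rightarrow> 'a::euclidean_space \<Rightarrow> real"
  assumes test: "\<And>n. \<phi> n \<in> test_functions UNIV" and [measurable]: "u \<in> borel_measurable borel"
    and p: "p \<ge> 1" and lim: "(\<lambda>n. \<integral>\<^sup>+x. ennreal (\<bar>\<phi> n x - u x\<bar> powr p) \<partial>lborel) \<longlonglongrightarrow> 0"
    and B [measurable]: "B \<in> sets borel" and B_fin: "emeasure lborel B < \<infinity>"
    and U [measurable]: "\<And>k. U k \<in> borel_measurable borel"
    and U_lim: "\<And>k x. (\<lambda>n. complex_of_real (LINT y|lborel. heat_kernel (1 / real (Suc k)) (y - x) * \<phi> n y)) \<longlonglongrightarrow> U k x"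
    and F: "\<And>x. x \<in> B \<Longrightarrow> (\<lambda>k. U k x) \<longlonglongrightarrow> F x"
  shows "AE x in lborel. x \<in> B \<longrightarrow> complex_of_real (u x) = F x"
proof -
  note [measurable] = test_function_measurable[OF test]
  \<comment> \<open>Outside \<open>B\<close> nothing is known about \<open>F\<close>; cutting it off
    there makes it a limit of Borel functions everywhere.\<close>
  define F' where "F' x = indicator B x *\<^sub>R F x" for x
  have F'_meas [measurable]: "F' \<in> borel_measurable borel"
  proof (rule borel_measurable_LIMSEQ_metric)
    show "(\<lambda>x. indicator B x *\<^sub>R U k x) \<in> borel_measurable borel" for k by measurable
    show "(\<lambda>k. indicator B x *\<^sub>R U k x) \<longlonglongrightarrow> F' x" for x
      unfolding F'_def using F[of x] by (cases "x \<in> B") auto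
  qed
  define h where "h k = (heat_kernel (1 / real (Suc k)) :: 'a \<Rightarrow> real)" for k
  have [measurable]: "h k \<in> borel_measurable borel" for k unfolding h_def by measurable
  define c where "c n k x = (LINT y|lborel. h k (y - x) * \<phi> n y)" for n k x
  have c_meas [measurable]: "c n k \<in> borel_measurable borel" for n k unfolding c_def by measurable
  define m where "m k y = (LINT x|lborel. indicator B x * h k (y - x))" for k and y :: 'a
  have t: "1 / real (Suc k) > 0" for k by simp
  have h0: "h k y \<ge> 0" for k y unfolding h_def by (rule less_imp_le[OF heat_kernel_pos[OF t]])
  have h_int: "integrable lborel (\<lambda>x. h k (y - x))" "(LINT x|lborel. h k (y - x)) = 1" for k y
    unfolding h_def using heat_kernel_translate[OF t[of k], of y] by (simp_all only: heat_kernel_minus[of _ y])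
  have m_int: "integrable lborel (\<lambda>x. indicator B x * h k (y - x))" for k y
    by (rule Bochner_Integration.integrable_bound[OF h_int(1)[of k y]]) (auto simp: indicator_def)
  have m_meas [measurable]: "m k \<in> borel_measurable borel" for k unfolding m_def by measurable
  have m0: "m k y \<ge> 0" for k y unfolding m_def by (intro integral_nonneg_AE AE_I2) (simp add: h0)
  have m1: "m k y \<le> 1" for k y
  proof -
    have "m k y \<le> (LINT x|lborel. h k (y - x))"
      unfolding m_def by (intro integral_mono m_int h_int) (auto simp: indicator_def h0)
    then show ?thesis by (simp add: h_int)
  qed
  have m_nn: "ennreal (m k y) = (\<integral>\<^sup>+x. indicator B x * ennreal (h k (y - x)) \<partial>lborel)" for k y
  proof -
    have "(\<integral>\<^sup>+x. indicator B x * ennreal (h k (y - x)) \<partial>lborel) = (\<integral>\<^sup>+x. ennreal (indicator B x * h k (y - x)) \<partial>lborel)"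
      by (intro nn_integral_cong) (auto split: split_indicator)
    also have "\<dots> = ennreal (m k y)"
      unfolding m_def by (rule nn_integral_eq_integral[OF m_int]) (simp add: h0)
    finally show ?thesis ..
  qed
  have m_total: "(\<integral>\<^sup>+y. ennreal (m k y) \<partial>lborel) = emeasure lborel B" for k
  proof -
    have "(\<integral>\<^sup>+y. ennreal (m k y) \<partial>lborel) = (\<integral>\<^sup>+x. \<integral>\<^sup>+y. indicator B x * ennreal (h k (y - x)) \<partial>lborel \<partial>lborel)"
      unfolding m_nn by (rule lborel_pair.Fubini') measurable
    also have "\<dots> = (\<integral>\<^sup>+x. indicator B x \<partial>lborel)"
      by (simp add: nn_integral_cmult nn_integral_heat_kernel(1)[OF t, where 'a='a, folded h_def])
    finally show ?thesis by simp
  qed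
  define I where "I = enn2real (emeasure lborel B)"
  have I: "emeasure lborel B = ennreal I" "I \<ge> 0" using B_fin by (auto simp: I_def less_top)
  have \<phi>_int: "integrable lborel (\<phi> n)" for n by (rule test_function_integrable[OF test])
  have conv_int: "integrable lborel (\<lambda>y. h k (y - x) * \<phi> n y)" for k x n
  proof (rule Bochner_Integration.integrable_bound)
    show "integrable lborel (\<lambda>y. (4 * pi * (1 / real (Suc k))) powr (- (real DIM('a) / 2)) * \<phi> n y)"
      by (intro integrable_mult_right \<phi>_int)
    show "AE y in lborel. norm (h k (y - x) * \<phi> n y) \<le> norm ((4 * pi * (1 / real (Suc k))) powr (- (real DIM('a) / 2)) * \<phi> n y)"
      unfolding norm_mult by (intro AE_I2 mult_right_mono) (use heat_kernel_le[OF t, where 'a='a, folded h_def] h0 in auto)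
  qed measurable
  have diff_le: "(\<integral>\<^sup>+x. indicator B x * ennreal \<bar>c i k x - c j k x\<bar> \<partial>lborel)
      \<le> (\<integral>\<^sup>+y. ennreal (\<bar>\<phi> i y - u y\<bar> * m k y) \<partial>lborel) + (\<integral>\<^sup>+y. ennreal (\<bar>\<phi> j y - u y\<bar> * m k y) \<partial>lborel)" for i j k
  proof -
    have "(\<integral>\<^sup>+x. indicator B x * ennreal \<bar>c i k x - c j k x\<bar> \<partial>lborel)
      \<le> (\<integral>\<^sup>+x. \<integral>\<^sup>+y. ennreal \<bar>\<phi> i y - \<phi> j y\<bar> * (indicator B x * ennreal (h k (y - x))) \<partial>lborel \<partial>lborel)"
    proof (rule nn_integral_mono)
      fix x :: 'a
      have "c i k x - c j k x = (LINT y|lborel. h k (y - x) * (\<phi> i y - \<phi> j y))"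
        unfolding c_def right_diff_distrib by (rule Bochner_Integration.integral_diff[symmetric, OF conv_int conv_int])
      then have "ennreal \<bar>c i k x - c j k x\<bar> \<le> (\<integral>\<^sup>+y. ennreal (norm (h k (y - x) * (\<phi> i y - \<phi> j y))) \<partial>lborel)"
        using ennreal_norm_integral_le[of lborel "\<lambda>y. h k (y - x) * (\<phi> i y - \<phi> j y)"] by simp
      also have "\<dots> = (\<integral>\<^sup>+y. ennreal \<bar>\<phi> i y - \<phi> j y\<bar> * ennreal (h k (y - x)) \<partial>lborel)"
        using h0 by (intro nn_integral_cong) (simp add: abs_mult mult.commute flip: ennreal_mult)
      finally show "indicator B x * ennreal \<bar>c i k x - c j k x\<bar> \<le> (\<integral>\<^sup>+y. ennreal \<bar>\<phi> i y - \<phi> j y\<bar> * (indicator B x * ennreal (h k (y - x))) \<partial>lborel)"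
        by (auto split: split_indicator)
    qed
    also have "\<dots> = (\<integral>\<^sup>+y. \<integral>\<^sup>+x. ennreal \<bar>\<phi> i y - \<phi> j y\<bar> * (indicator B x * ennreal (h k (y - x))) \<partial>lborel \<partial>lborel)"
      by (rule lborel_pair.Fubini') measurable
    also have "\<dots> = (\<integral>\<^sup>+y. ennreal \<bar>\<phi> i y - \<phi> j y\<bar> * ennreal (m k y) \<partial>lborel)"
      unfolding m_nn by (intro nn_integral_cong nn_integral_cmult) measurable
    also have "\<dots> \<le> (\<integral>\<^sup>+y. ennreal (\<bar>\<phi> i y - u y\<bar> * m k y) + ennreal (\<bar>\<phi> j y - u y\<bar> * m k y) \<partial>lborel)"
    proof (rule nn_integral_mono)
      fix y
      have "\<bar>\<phi> i y - \<phi> j y\<bar> * m k y \<le> (\<bar>\<phi> i y - u y\<bar> + \<bar>\<phi> j y - u y\<bar>) * m k y"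
        using m0 by (intro mult_right_mono) auto
      then have "\<bar>\<phi> i y - \<phi> j y\<bar> * m k y \<le> \<bar>\<phi> i y - u y\<bar> * m k y + \<bar>\<phi> j y - u y\<bar> * m k y"
        by (simp only: distrib_right)
      then show "ennreal \<bar>\<phi> i y - \<phi> j y\<bar> * ennreal (m k y) \<le> ennreal (\<bar>\<phi> i y - u y\<bar> * m k y) + ennreal (\<bar>\<phi> j y - u y\<bar> * m k y)"
        using m0 by (simp add: ennreal_mult[symmetric] ennreal_plus[symmetric] ennreal_leI del: ennreal_plus)
    qed
    also have "\<dots> = (\<integral>\<^sup>+y. ennreal (\<bar>\<phi> i y - u y\<bar> * m k y) \<partial>lborel) + (\<integral>\<^sup>+y. ennreal (\<bar>\<phi> j y - u y\<bar> * m k y) \<partial>lborel)"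
      by (rule nn_integral_add) measurable
    finally show ?thesis .
  qed
  \<comment> \<open>\<open>2 * e\<close> bounds the distance from \<open>\<phi> n0\<close> to
    \<open>F'\<close>, by comparing heat flows with index \<open>n0\<close> and letting first
    \<open>n\<close>, then \<open>k\<close> tend to infinity; the third \<open>e\<close> bounds the
    distance from \<open>u\<close> to \<open>\<phi> n0\<close>.\<close>
  have small: "(\<integral>\<^sup>+x. indicator B x * ennreal (cmod (complex_of_real (u x) - F' x)) \<partial>lborel) \<le> ennreal (3 * e)" if e: "e > 0" for e
  proof -
    obtain \<delta> n0 where \<delta>: "\<delta> > 0" and n0: "\<And>n. n \<ge> n0 \<Longrightarrow>
        ennreal \<delta> * ennreal I + ennreal (1 * \<delta> powr (1 - p)) * (\<integral>\<^sup>+x. ennreal (\<bar>\<phi> n x - u x\<bar> powr p) \<partial>lborel) \<le> ennreal e"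
      by (rule nn_integral_weight_uniform[OF lim e I(2), of 1 p]) auto
    have w: "(\<integral>\<^sup>+y. ennreal (\<bar>\<phi> n y - u y\<bar> * w y) \<partial>lborel) \<le> ennreal e"
      if n: "n \<ge> n0" and [measurable]: "w \<in> borel_measurable borel" and w: "\<And>y. 0 \<le> w y" "\<And>y. w y \<le> 1" "(\<integral>\<^sup>+y. ennreal (w y) \<partial>lborel) = ennreal I" for n w
      using order.trans[OF nn_integral_weight_le_powr[OF _ _ w(1,2) \<delta> p, of "\<lambda>y. \<phi> n y - u y"]] n0[OF n] w(3) by simp
    have ck: "(\<integral>\<^sup>+x. indicator B x * ennreal (cmod (complex_of_real (c n0 k x) - U k x)) \<partial>lborel) \<le> ennreal (2 * e)" for k
    proof (rule nn_integral_le_of_tendsto)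
      show "AE x in lborel. (\<lambda>n. indicator B x * ennreal (cmod (complex_of_real (c n0 k x) - complex_of_real (c n k x))))
          \<longlonglongrightarrow> indicator B x * ennreal (cmod (complex_of_real (c n0 k x) - U k x))"
        using U_lim[of k, folded h_def, folded c_def]
        by (intro AE_I2 ennreal_tendsto_cmult tendsto_ennrealI tendsto_norm tendsto_diff tendsto_const) (auto split: split_indicator)
      show "eventually (\<lambda>n. (\<integral>\<^sup>+x. indicator B x * ennreal (cmod (complex_of_real (c n0 k x) - complex_of_real (c n k x))) \<partial>lborel) \<le> ennreal (2 * e)) sequentially"
        unfolding eventually_sequentially
      proof (intro exI allI impI)
        fix n assume n: "n \<ge> n0"
        have "(\<integral>\<^sup>+x. indicator B x * ennreal (cmod (complex_of_real (c n0 k x) - complex_of_real (c n k x))) \<partial>lborel)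
           = (\<integral>\<^sup>+x. indicator B x * ennreal \<bar>c n0 k x - c n k x\<bar> \<partial>lborel)"
          by (simp only: of_real_diff[symmetric] norm_of_real)
        also have "\<dots> \<le> ennreal e + ennreal e"
          using m_total I by (intro order.trans[OF diff_le] add_mono w m0 m1 n) auto
        also have "\<dots> = ennreal (2 * e)" using e by (simp flip: ennreal_plus)
        finally show "(\<integral>\<^sup>+x. indicator B x * ennreal (cmod (complex_of_real (c n0 k x) - complex_of_real (c n k x))) \<partial>lborel) \<le> ennreal (2 * e)" .
      qed
    qed measurable
    have \<phi>F: "(\<integral>\<^sup>+x. indicator B x * ennreal (cmod (complex_of_real (\<phi> n0 x) - F' x)) \<partial>lborel) \<le> ennreal (2 * e)"
    proof (rule nn_integral_le_of_tendsto)
      show "AE x in lborel. (\<lambda>k. indicator B x * ennreal (cmod (complex_of_real (c n0 k x) - U k x)))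
          \<longlonglongrightarrow> indicator B x * ennreal (cmod (complex_of_real (\<phi> n0 x) - F' x))"
      proof (rule AE_I2)
        fix x
        obtain C where C: "\<And>y. \<bar>\<phi> n0 y\<bar> \<le> C" using test_function_bounded[OF test] by blast
        have "isCont (\<phi> n0) x" using test_function_continuous[OF test[of n0]] by (simp add: continuous_on_eq_continuous_at)
        then have "(\<lambda>k. c n0 k x) \<longlonglongrightarrow> \<phi> n0 x"
          unfolding c_def h_def
          by (rule heat_convolution_tendsto[OF test_function_measurable[OF test] C])
        then show "(\<lambda>k. indicator B x * ennreal (cmod (complex_of_real (c n0 k x) - U k x)))
          \<longlonglongrightarrow> indicator B x * ennreal (cmod (complex_of_real (\<phi> n0 x) - F' x))"
          using F[of x]
          by (cases "x \<in> B") (auto simp: F'_def intro!: tendsto_ennrealI tendsto_norm tendsto_diff tendsto_of_real)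
      qed
      show "eventually (\<lambda>k. (\<integral>\<^sup>+x. indicator B x * ennreal (cmod (complex_of_real (c n0 k x) - U k x)) \<partial>lborel) \<le> ennreal (2 * e)) sequentially"
        by (intro always_eventually allI ck)
    qed measurable
    have \<phi>u: "(\<integral>\<^sup>+y. ennreal (\<bar>\<phi> n0 y - u y\<bar> * indicator B y) \<partial>lborel) \<le> ennreal e"
    proof (rule w[OF order.refl])
      show "(\<integral>\<^sup>+y. ennreal (indicator B y) \<partial>lborel) = ennreal I"
        using I by (simp add: ennreal_indicator)
    qed (auto split: split_indicator)
    have "(\<integral>\<^sup>+x. indicator B x * ennreal (cmod (complex_of_real (u x) - F' x)) \<partial>lborel)
      \<le> (\<integral>\<^sup>+x. ennreal (\<bar>\<phi> n0 x - u x\<bar> * indicator B x) + indicator B x * ennreal (cmod (complex_of_real (\<phi> n0 x) - F' x)) \<partial>lborel)"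
    proof (rule nn_integral_mono)
      fix x
      have "cmod (complex_of_real (u x) - F' x) \<le> cmod (complex_of_real (u x) - complex_of_real (\<phi> n0 x)) + cmod (complex_of_real (\<phi> n0 x) - F' x)"
        using norm_triangle_ineq[of "complex_of_real (u x) - complex_of_real (\<phi> n0 x)" "complex_of_real (\<phi> n0 x) - F' x"] by simp
      also have "cmod (complex_of_real (u x) - complex_of_real (\<phi> n0 x)) = \<bar>\<phi> n0 x - u x\<bar>"
        by (simp only: of_real_diff[symmetric] norm_of_real abs_minus_commute)
      finally have "ennreal (cmod (complex_of_real (u x) - F' x)) \<le> ennreal \<bar>\<phi> n0 x - u x\<bar> + ennreal (cmod (complex_of_real (\<phi> n0 x) - F' x))"
        by (simp add: ennreal_leI flip: ennreal_plus)
      then show "indicator B x * ennreal (cmod (complex_of_real (u x) - F' x))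
         \<le> ennreal (\<bar>\<phi> n0 x - u x\<bar> * indicator B x) + indicator B x * ennreal (cmod (complex_of_real (\<phi> n0 x) - F' x))"
        by (auto split: split_indicator)
    qed
    also have "\<dots> = (\<integral>\<^sup>+x. ennreal (\<bar>\<phi> n0 x - u x\<bar> * indicator B x) \<partial>lborel) + (\<integral>\<^sup>+x. indicator B x * ennreal (cmod (complex_of_real (\<phi> n0 x) - F' x)) \<partial>lborel)"
      by (rule nn_integral_add) measurable
    also have "\<dots> \<le> ennreal e + ennreal (2 * e)"
      by (rule add_mono[OF \<phi>u \<phi>F])
    also have "\<dots> = ennreal (3 * e)" using e by (simp flip: ennreal_plus)
    finally show ?thesis .
  qed
  have "(\<integral>\<^sup>+x. indicator B x * ennreal (cmod (complex_of_real (u x) - F' x)) \<partial>lborel) = 0"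
  proof (rule ccontr)
    let ?X = "\<integral>\<^sup>+x. indicator B x * ennreal (cmod (complex_of_real (u x) - F' x)) \<partial>lborel"
    assume "?X \<noteq> 0"
    then have "0 < ?X" by (simp add: zero_less_iff_neq_zero)
    then obtain b where b: "0 < b" "b < ?X" using dense by blast
    then obtain e where e: "b = ennreal e" "e > 0"
      by (cases b) (auto simp: top_unique)
    have "?X \<le> ennreal (3 * (e / 3))" by (rule small) (use e in simp)
    then show False using b e by simp
  qed
  then have "AE x in lborel. indicator B x * ennreal (cmod (complex_of_real (u x) - F' x)) = 0"
    by (subst (asm) nn_integral_0_iff_AE) auto
  then show ?thesis
    by eventually_elim (auto simp: F'_def indicator_def split: if_splits)
qed

section \<open>Vanishing time shift and holomorphy near a point\<close>

locale local_weighted_data = weighted_data s Y for s :: real and Y :: "'a::euclidean_space \<Rightarrow> complex" +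
  fixes x0 :: 'a and R K :: real
  assumes R: "R > 0"
    and bound: "\<And>t a b. 0 < t \<Longrightarrow> t \<le> 2 \<Longrightarrow> norm (a - x0) \<le> R \<Longrightarrow> norm b \<le> R \<Longrightarrow> cmod (heat_lap t a b) \<le> K"
begin

lemma K_nonneg: "K \<ge> 0"
  by (rule order.trans[OF norm_ge_zero bound[of 1 x0 0]]) (use R in auto)

definition weight :: "real \<Rightarrow> real" where
  "weight t = indicator {0..} t * t powr (s - 1)"

text \<open>Dominates the time integrand for all shifts up to one and all \<open>a\<close>,
  \<open>b\<close> within \<open>R\<close>: the local bound \<open>K\<close> serves for times up to
  one, the absolute integral beyond. It is an extended real because the inner integral is shown to
  be finite only for almost every \<open>t\<close>.\<close>

definition majorant :: "real \<Rightarrow> ennreal" where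
  "majorant t = ennreal K * ennreal (indicator {0..1} t * t powr (s - 1)) + ennreal (indicator {1..} t * t powr (s - 1)) *
      (\<integral>\<^sup>+\<xi>. ennreal (norm \<xi> powr (2 * s) * cmod (Y \<xi>) * exp (R * norm \<xi> - t * (norm \<xi>)\<^sup>2)) \<partial>lborel)"

lemma majorant_measurable [measurable]: "majorant \<in> borel_measurable borel"
  unfolding majorant_def by measurable

lemma weight_measurable [measurable]: "weight \<in> borel_measurable borel"
  unfolding weight_def by measurable

lemma heat_lap_measurable [measurable]: "(\<lambda>t. heat_lap (t + \<epsilon>) a b) \<in> borel_measurable borel"
  unfolding heat_lap_def by measurable

lemma majorant_finite: "(\<integral>\<^sup>+t. majorant t \<partial>lborel) < \<infinity>"
proof -
  have A: "(\<integral>\<^sup>+t. ennreal (indicator {0..1} t * t powr (s - 1)) \<partial>lborel) < \<infinity>"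
    using nn_integral_has_integral_lebesgue[OF _ has_integral_powr_from_0[of "s - 1" 1]] s by simp
  have "(\<integral>\<^sup>+t. majorant t \<partial>lborel) = ennreal K * (\<integral>\<^sup>+t. ennreal (indicator {0..1} t * t powr (s - 1)) \<partial>lborel)
    + (\<integral>\<^sup>+t. ennreal (indicator {1..} t * t powr (s - 1)) *
      (\<integral>\<^sup>+\<xi>. ennreal (norm \<xi> powr (2 * s) * cmod (Y \<xi>) * exp (R * norm \<xi> - t * (norm \<xi>)\<^sup>2)) \<partial>lborel) \<partial>lborel)"
    unfolding majorant_def by (subst nn_integral_add) (auto simp: nn_integral_cmult)
  also have "\<dots> < \<infinity>"
    using A heat_lap_tail[of R] by (simp add: ennreal_mult_less_top)
  finally show ?thesis .
qed

text \<open>For \<open>t \<le> 1\<close> and \<open>\<epsilon> \<le> 1\<close> the time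
  \<open>t + \<epsilon>\<close> is at most two, the range of the local bound; for larger
  \<open>t\<close> the shift only improves the Gaussian.\<close>

lemma norm_le_majorant:
  assumes \<epsilon>: "0 \<le> \<epsilon>" "\<epsilon> \<le> 1" and a: "norm (a - x0) \<le> R" and b: "norm b \<le> R"
  shows "ennreal (cmod (complex_of_real (weight t) * heat_lap (t + \<epsilon>) a b)) \<le> majorant t"
proof -
  consider "t \<le> 0" | "0 < t" "t \<le> 1" | "t > 1" by linarith
  then show ?thesis
  proof cases
    case 1
    then have "weight t = 0" by (cases "t = 0") (auto simp: weight_def)
    then show ?thesis by simp
  next
    case 2
    have "cmod (complex_of_real (weight t) * heat_lap (t + \<epsilon>) a b) \<le> t powr (s - 1) * K"
      unfolding norm_mult norm_of_real
      using 2 \<epsilon> by (intro mult_mono bound a b) (auto simp: weight_def)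
    then have "ennreal (cmod (complex_of_real (weight t) * heat_lap (t + \<epsilon>) a b)) \<le> ennreal K * ennreal (indicator {0..1} t * t powr (s - 1))"
      using 2 K_nonneg by (simp add: ennreal_mult[symmetric] ennreal_leI mult.commute)
    then show ?thesis unfolding majorant_def by (rule order.trans) simp
  next
    case 3
    have "ennreal (cmod (heat_lap (t + \<epsilon>) a b))
       \<le> (\<integral>\<^sup>+\<xi>. ennreal (cmod (complex_of_real (norm \<xi> powr (2 * s)) * Y \<xi> * gauss_exp (t + \<epsilon>) a b \<xi>)) \<partial>lborel)"
      unfolding heat_lap_def by (rule ennreal_norm_integral_le)
    also have "\<dots> \<le> (\<integral>\<^sup>+\<xi>. ennreal (norm \<xi> powr (2 * s) * cmod (Y \<xi>) * exp (R * norm \<xi> - t * (norm \<xi>)\<^sup>2)) \<partial>lborel)"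
    proof (intro nn_integral_mono ennreal_leI)
      fix \<xi> :: 'a
      have "exp (- (t + \<epsilon>) * (norm \<xi>)\<^sup>2 - b \<bullet> \<xi>) \<le> exp (R * norm \<xi> - (t + \<epsilon>) * (norm \<xi>)\<^sup>2)"
        by (rule gauss_exp_le[OF b])
      also have "\<dots> \<le> exp (R * norm \<xi> - t * (norm \<xi>)\<^sup>2)"
        using \<epsilon> by (simp add: algebra_simps)
      finally show "cmod (complex_of_real (norm \<xi> powr (2 * s)) * Y \<xi> * gauss_exp (t + \<epsilon>) a b \<xi>)
         \<le> norm \<xi> powr (2 * s) * cmod (Y \<xi>) * exp (R * norm \<xi> - t * (norm \<xi>)\<^sup>2)"
        unfolding norm_mult[of _ "gauss_exp _ _ _ _"] cmod_gauss_exp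
        unfolding norm_mult norm_of_real by (intro mult_mono) auto
    qed
    finally have "ennreal (indicator {1..} t * t powr (s - 1)) * ennreal (cmod (heat_lap (t + \<epsilon>) a b))
       \<le> ennreal (indicator {1..} t * t powr (s - 1)) *
          (\<integral>\<^sup>+\<xi>. ennreal (norm \<xi> powr (2 * s) * cmod (Y \<xi>) * exp (R * norm \<xi> - t * (norm \<xi>)\<^sup>2)) \<partial>lborel)"
      by (rule mult_left_mono) simp
    also have "\<dots> \<le> majorant t"
      unfolding majorant_def by simp
    finally have "ennreal (indicator {1..} t * t powr (s - 1)) * ennreal (cmod (heat_lap (t + \<epsilon>) a b)) \<le> majorant t" .
    then show ?thesis
      using 3 by (simp add: norm_mult weight_def flip: ennreal_mult)
  qed
qed

lemma majorant_integrable: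
  "integrable lborel (\<lambda>t. enn2real (majorant t))" and AE_majorant: "AE t in lborel. majorant t < \<infinity>"
proof -
  show ae: "AE t in lborel. majorant t < \<infinity>"
    using nn_integral_PInf_AE[of majorant lborel] majorant_finite by (auto simp: less_top)
  have "(\<integral>\<^sup>+t. ennreal (norm (enn2real (majorant t))) \<partial>lborel) = (\<integral>\<^sup>+t. majorant t \<partial>lborel)"
    using ae by (intro nn_integral_cong_AE) (auto elim!: eventually_mono)
  then show "integrable lborel (\<lambda>t. enn2real (majorant t))"
    using majorant_finite by (intro integrableI_bounded) auto
qed

lemma norm_le_majorant_AE:
  assumes "0 \<le> \<epsilon>" "\<epsilon> \<le> 1" "norm (a - x0) \<le> R" "norm b \<le> R"
  shows "AE t in lborel. norm (complex_of_real (weight t) * heat_lap (t + \<epsilon>) a b) \<le> enn2real (majorant t)"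
  using AE_majorant
proof eventually_elim
  case (elim t)
  have "ennreal (norm (complex_of_real (weight t) * heat_lap (t + \<epsilon>) a b)) \<le> ennreal (enn2real (majorant t))"
    using norm_le_majorant[OF assms, of t] elim by simp
  then show ?case by (subst (asm) ennreal_le_iff) auto
qed

text \<open>Half of the Gaussian at time \<open>t\<close> absorbs the weight; the other half,
  together with \<open>exp (R * norm \<xi>)\<close>, gives the dominating function.\<close>

lemma heat_lap_tendsto:
  assumes t: "t > 0" and \<epsilon>: "\<And>n. 0 \<le> \<epsilon> n" "\<epsilon> \<longlonglongrightarrow> 0"
    and a: "A \<longlonglongrightarrow> a" and b: "\<And>n. norm (B n) \<le> R" "B \<longlonglongrightarrow> b"
  shows "(\<lambda>n. heat_lap (t + \<epsilon> n) (A n) (B n)) \<longlonglongrightarrow> heat_lap t a b"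
  unfolding heat_lap_def
proof (rule integral_dominated_convergence)
  define C where "C = 1 + 2 / (t / 2)\<^sup>2"
  have C: "C \<ge> 0" by (simp add: C_def)
  show "integrable lborel (\<lambda>\<xi>. C * (cmod (Y \<xi>) * exp (R * norm \<xi> - (t / 2) * (norm \<xi>)\<^sup>2)))"
    using t by (intro integrable_mult_right heat_ext_integrable_exp) simp
  show "AE \<xi> in lborel. norm (complex_of_real (norm \<xi> powr (2 * s)) * Y \<xi> * gauss_exp (t + \<epsilon> n) (A n) (B n) \<xi>)
      \<le> C * (cmod (Y \<xi>) * exp (R * norm \<xi> - (t / 2) * (norm \<xi>)\<^sup>2))" for n
  proof (rule AE_I2)
    fix \<xi> :: 'a
    have "exp (- (t + \<epsilon> n) * (norm \<xi>)\<^sup>2 - B n \<bullet> \<xi>) \<le> exp (R * norm \<xi> - (t + \<epsilon> n) * (norm \<xi>)\<^sup>2)"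
      by (rule gauss_exp_le[OF b(1)])
    also have "\<dots> \<le> exp (R * norm \<xi> - t * (norm \<xi>)\<^sup>2)"
      using \<epsilon>(1)[of n] by (simp add: algebra_simps)
    finally have "norm \<xi> powr (2 * s) * cmod (Y \<xi>) * exp (- (t + \<epsilon> n) * (norm \<xi>)\<^sup>2 - B n \<bullet> \<xi>)
       \<le> (C * exp ((t / 2) * (norm \<xi>)\<^sup>2)) * cmod (Y \<xi>) * exp (R * norm \<xi> - t * (norm \<xi>)\<^sup>2)"
      unfolding C_def using t by (intro mult_mono norm_powr_le_exp s) auto
    also have "\<dots> = C * (cmod (Y \<xi>) * (exp ((t / 2) * (norm \<xi>)\<^sup>2) * exp (R * norm \<xi> - t * (norm \<xi>)\<^sup>2)))"
      by (simp only: mult_ac)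
    also have "exp ((t / 2) * (norm \<xi>)\<^sup>2) * exp (R * norm \<xi> - t * (norm \<xi>)\<^sup>2) = exp (R * norm \<xi> - (t / 2) * (norm \<xi>)\<^sup>2)"
      by (simp add: field_simps flip: exp_add)
    finally show "norm (complex_of_real (norm \<xi> powr (2 * s)) * Y \<xi> * gauss_exp (t + \<epsilon> n) (A n) (B n) \<xi>)
      \<le> C * (cmod (Y \<xi>) * exp (R * norm \<xi> - (t / 2) * (norm \<xi>)\<^sup>2))"
      unfolding norm_mult[of _ "gauss_exp _ _ _ _"] cmod_gauss_exp unfolding norm_mult norm_of_real by simp
  qed
  show "AE \<xi> in lborel. (\<lambda>n. complex_of_real (norm \<xi> powr (2 * s)) * Y \<xi> * gauss_exp (t + \<epsilon> n) (A n) (B n) \<xi>)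
     \<longlonglongrightarrow> complex_of_real (norm \<xi> powr (2 * s)) * Y \<xi> * gauss_exp t a b \<xi>"
  proof (intro AE_I2 tendsto_mult tendsto_const tendsto_of_real tendsto_exp tendsto_inner a)
    fix \<xi> :: 'a
    have "(\<lambda>n. - (t + \<epsilon> n) * (norm \<xi>)\<^sup>2 - B n \<bullet> \<xi>) \<longlonglongrightarrow> - (t + 0) * (norm \<xi>)\<^sup>2 - b \<bullet> \<xi>"
      by (intro tendsto_diff tendsto_mult tendsto_minus tendsto_add tendsto_const tendsto_inner \<epsilon>(2) b(2))
    then show "(\<lambda>n. - (t + \<epsilon> n) * (norm \<xi>)\<^sup>2 - B n \<bullet> \<xi>) \<longlonglongrightarrow> - t * (norm \<xi>)\<^sup>2 - b \<bullet> \<xi>" by simp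
  qed
qed measurable

text \<open>Time shift and point vary together so that one dominated convergence argument covers the
  vanishing shift at a fixed point and, with shift zero, the continuity of the limit.\<close>

lemma weighted_integral_tendsto:
  assumes \<epsilon>: "\<And>n. 0 \<le> \<epsilon> n" "\<And>n. \<epsilon> n \<le> 1" "\<epsilon> \<longlonglongrightarrow> 0"
    and a: "\<And>n. norm (A n - x0) \<le> R" "A \<longlonglongrightarrow> a" and b: "\<And>n. norm (B n) \<le> R" "B \<longlonglongrightarrow> b"
  shows "(\<lambda>n. LINT t|lborel. complex_of_real (weight t) * heat_lap (t + \<epsilon> n) (A n) (B n)) \<longlonglongrightarrow>
     (LINT t|lborel. complex_of_real (weight t) * heat_lap t a b)"
proof (rule integral_dominated_convergence)
  show "integrable lborel (\<lambda>t. enn2real (majorant t))" by (rule majorant_integrable)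
  show "AE t in lborel. norm (complex_of_real (weight t) * heat_lap (t + \<epsilon> n) (A n) (B n)) \<le> enn2real (majorant t)" for n
    by (rule norm_le_majorant_AE[OF \<epsilon>(1,2) a(1) b(1)])
  show "AE t in lborel. (\<lambda>n. complex_of_real (weight t) * heat_lap (t + \<epsilon> n) (A n) (B n)) \<longlonglongrightarrow> complex_of_real (weight t) * heat_lap t a b"
  proof (rule AE_I2)
    fix t :: real
    show "(\<lambda>n. complex_of_real (weight t) * heat_lap (t + \<epsilon> n) (A n) (B n)) \<longlonglongrightarrow> complex_of_real (weight t) * heat_lap t a b"
    proof (cases "t > 0")
      case True
      then show ?thesis by (intro tendsto_mult tendsto_const heat_lap_tendsto \<epsilon> a b)
    next
      case False
      then have "weight t = 0" by (cases "t = 0") (auto simp: weight_def)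
      then show ?thesis by simp
    qed
  qed
  show "(\<lambda>t. complex_of_real (weight t) * heat_lap t a b) \<in> borel_measurable lborel"
    using heat_lap_measurable[of 0] by simp
qed measurable

text \<open>The Gamma integral of the overview at \<open>\<epsilon> = 0\<close>. For
  \<open>b = 0\<close> it will turn out to be \<open>(2 * pi) ^ N * u\<close> almost everywhere near
  \<open>x0\<close>.\<close>

definition solution :: "'a \<Rightarrow> 'a \<Rightarrow> complex" where
  "solution a b = (LINT t|lborel. complex_of_real (weight t) * heat_lap t a b) / complex_of_real (Gamma s)"

lemma Gamma_pos: "Gamma s > 0" using s by (simp add: Gamma_real_pos)

lemma heat_ext_eq: "\<epsilon> > 0 \<Longrightarrow> heat_ext \<epsilon> a b = (LINT t|lborel. complex_of_real (weight t) * heat_lap (t + \<epsilon>) a b) / complex_of_real (Gamma s)"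
  using heat_ext_eq_integral[of \<epsilon> a b] Gamma_pos unfolding weight_def by simp

lemma heat_ext_tendsto:
  assumes "norm (a - x0) \<le> R" "norm b \<le> R"
  shows "(\<lambda>n. heat_ext (1 / real (Suc n)) a b) \<longlonglongrightarrow> solution a b"
proof -
  have "(\<lambda>n. LINT t|lborel. complex_of_real (weight t) * heat_lap (t + 1 / real (Suc n)) a b) \<longlonglongrightarrow> (LINT t|lborel. complex_of_real (weight t) * heat_lap t a b)"
    by (rule weighted_integral_tendsto) (use assms LIMSEQ_Suc[OF lim_1_over_n] in auto)
  then show ?thesis
    unfolding solution_def using Gamma_pos by (subst heat_ext_eq) (auto intro: tendsto_divide)
qed

text \<open>The bound depends neither on \<open>\<epsilon>\<close> nor on the point, which is the
  local boundedness that Montel's theorem asks for.\<close>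

lemma heat_ext_bounded:
  assumes "0 < \<epsilon>" "\<epsilon> \<le> 1" "norm (a - x0) \<le> R" "norm b \<le> R"
  shows "cmod (heat_ext \<epsilon> a b) \<le> (LINT t|lborel. enn2real (majorant t)) / Gamma s"
proof -
  have "cmod (LINT t|lborel. complex_of_real (weight t) * heat_lap (t + \<epsilon>) a b) \<le> (LINT t|lborel. cmod (complex_of_real (weight t) * heat_lap (t + \<epsilon>) a b))"
    by (rule integral_norm_bound)
  also have "\<dots> \<le> (LINT t|lborel. enn2real (majorant t))"
    by (rule integral_mono_AE'[OF majorant_integrable norm_le_majorant_AE]) (use assms in auto)
  finally show ?thesis
    using assms Gamma_pos by (simp add: heat_ext_eq norm_divide divide_right_mono)
qed

lemma solution_continuous: "continuous_on (cball x0 R) (\<lambda>a. solution a 0)"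
  unfolding continuous_on_sequentially
proof (intro allI ballI impI)
  fix A a assume a: "a \<in> cball x0 R" and A: "(\<forall>n. A n \<in> cball x0 R) \<and> A \<longlonglongrightarrow> a"
  have "(\<lambda>n. LINT t|lborel. complex_of_real (weight t) * heat_lap (t + 0) (A n) 0) \<longlonglongrightarrow> (LINT t|lborel. complex_of_real (weight t) * heat_lap t a 0)"
    by (rule weighted_integral_tendsto) (use A R in \<open>auto simp: dist_norm norm_minus_commute\<close>)
  then show "((\<lambda>a. solution a 0) \<circ> A) \<longlonglongrightarrow> solution a 0"
    unfolding solution_def o_def using Gamma_pos by (intro tendsto_divide tendsto_const) auto
qed

text \<open>Moving \<open>a\<close> by the real part and \<open>b\<close> by the imaginary part of
  \<open>\<zeta>\<close> along \<open>v\<close> multiplies the integrand by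
  \<open>exp (\<i> * \<zeta> * (v \<bullet> \<xi>))\<close>; the Gaussian keeps all these factors
  integrable.\<close>

lemma heat_ext_holomorphic:
  assumes "\<epsilon> > 0"
  shows "(\<lambda>\<zeta>. heat_ext \<epsilon> (x + Re \<zeta> *\<^sub>R v) (Im \<zeta> *\<^sub>R v)) holomorphic_on S"
proof -
  let ?f = "\<lambda>\<xi>. Y \<xi> * (complex_of_real (exp (- \<epsilon> * (norm \<xi>)\<^sup>2)) * iexp (x \<bullet> \<xi>))"
  have eq: "heat_ext \<epsilon> (x + Re \<zeta> *\<^sub>R v) (Im \<zeta> *\<^sub>R v) = (LINT \<xi>|lborel. ?f \<xi> * exp (\<i> * \<zeta> * complex_of_real (v \<bullet> \<xi>)))" for \<zeta>
    unfolding heat_ext_def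
  proof (intro Bochner_Integration.integral_cong refl)
    fix \<xi> :: 'a
    have "gauss_exp \<epsilon> (x + Re \<zeta> *\<^sub>R v) (Im \<zeta> *\<^sub>R v) \<xi>
       = exp (complex_of_real (- \<epsilon> * (norm \<xi>)\<^sup>2 - (Im \<zeta> *\<^sub>R v) \<bullet> \<xi>) + \<i> * complex_of_real ((x + Re \<zeta> *\<^sub>R v) \<bullet> \<xi>))"
      by (simp only: exp_of_real exp_add)
    also have "complex_of_real (- \<epsilon> * (norm \<xi>)\<^sup>2 - (Im \<zeta> *\<^sub>R v) \<bullet> \<xi>) + \<i> * complex_of_real ((x + Re \<zeta> *\<^sub>R v) \<bullet> \<xi>)
       = (complex_of_real (- \<epsilon> * (norm \<xi>)\<^sup>2) + \<i> * complex_of_real (x \<bullet> \<xi>)) + \<i> * \<zeta> * complex_of_real (v \<bullet> \<xi>)"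
      by (simp add: complex_eq_iff inner_add_left)
    also have "exp \<dots> = (complex_of_real (exp (- \<epsilon> * (norm \<xi>)\<^sup>2)) * iexp (x \<bullet> \<xi>)) * exp (\<i> * \<zeta> * complex_of_real (v \<bullet> \<xi>))"
      by (simp only: exp_of_real exp_add)
    finally show "Y \<xi> * gauss_exp \<epsilon> (x + Re \<zeta> *\<^sub>R v) (Im \<zeta> *\<^sub>R v) \<xi> = ?f \<xi> * exp (\<i> * \<zeta> * complex_of_real (v \<bullet> \<xi>))"
      by (simp only: mult.assoc)
  qed
  show ?thesis
    unfolding eq
  proof (rule holomorphic_exp_integral)
    fix r :: real
    show "integrable lborel (\<lambda>\<xi>. cmod (?f \<xi>) * exp (r * \<bar>v \<bullet> \<xi>\<bar>))"
    proof (rule Bochner_Integration.integrable_bound[OF heat_ext_integrable_exp[OF assms, of "\<bar>r\<bar> * norm v"]])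
      show "AE \<xi> in lborel. norm (cmod (?f \<xi>) * exp (r * \<bar>v \<bullet> \<xi>\<bar>)) \<le> norm (cmod (Y \<xi>) * exp (\<bar>r\<bar> * norm v * norm \<xi> - \<epsilon> * (norm \<xi>)\<^sup>2))"
      proof (rule AE_I2)
        fix \<xi> :: 'a
        have "r * \<bar>v \<bullet> \<xi>\<bar> \<le> \<bar>r\<bar> * (norm v * norm \<xi>)"
          by (intro mult_mono Cauchy_Schwarz_ineq2) auto
        then have "exp (- \<epsilon> * (norm \<xi>)\<^sup>2) * exp (r * \<bar>v \<bullet> \<xi>\<bar>) \<le> exp (\<bar>r\<bar> * norm v * norm \<xi> - \<epsilon> * (norm \<xi>)\<^sup>2)"
          by (simp add: mult.assoc flip: exp_add)
        then have "cmod (Y \<xi>) * (exp (- \<epsilon> * (norm \<xi>)\<^sup>2) * exp (r * \<bar>v \<bullet> \<xi>\<bar>)) \<le> cmod (Y \<xi>) * exp (\<bar>r\<bar> * norm v * norm \<xi> - \<epsilon> * (norm \<xi>)\<^sup>2)"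
          by (rule mult_left_mono) simp
        then show "norm (cmod (?f \<xi>) * exp (r * \<bar>v \<bullet> \<xi>\<bar>)) \<le> norm (cmod (Y \<xi>) * exp (\<bar>r\<bar> * norm v * norm \<xi> - \<epsilon> * (norm \<xi>)\<^sup>2))"
          by (simp add: norm_mult mult.assoc)
      qed
    qed measurable
  qed measurable
qed

text \<open>\<open>D\<close> consists of the parameters whose real and imaginary displacements stay
  within \<open>R\<close>; it is convex and contains \<open>0\<close> and \<open>1\<close>. Montel
  supplies a holomorphic limit of a subsequence of heat flows, and their pointwise convergence
  identifies it with \<open>solution\<close>.\<close>

lemma solution_line_zero:
  assumes x: "x \<in> ball x0 R" and xv: "x + v \<in> ball x0 R"
    and acc: "\<And>d. d > 0 \<Longrightarrow> \<exists>\<tau>. 0 < \<bar>\<tau>\<bar> \<and> \<bar>\<tau>\<bar> < d \<and> solution (x + \<tau> *\<^sub>R v) 0 = 0"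
  shows "solution (x + v) 0 = 0"
proof -
  define D where "D = {\<zeta>. x + Re \<zeta> *\<^sub>R v \<in> ball x0 R} \<inter> {\<zeta>. Im \<zeta> *\<^sub>R v \<in> ball 0 R}"
  have lin: "linear (\<lambda>\<zeta>. Re \<zeta> *\<^sub>R v)" "linear (\<lambda>\<zeta>. Im \<zeta> *\<^sub>R v)"
    by (simp_all add: linear_iff scaleR_add_left)
  have D_open: "open D"
    unfolding D_def ball_def mem_Collect_eq by (intro open_Int open_Collect_less continuous_intros)
  have D_conv: "convex D"
  proof -
    have "{\<zeta>. x + Re \<zeta> *\<^sub>R v \<in> ball x0 R} = (\<lambda>\<zeta>. Re \<zeta> *\<^sub>R v) -` ball (x0 - x) R"
      by (auto simp: dist_norm diff_diff_eq)
    then have "convex {\<zeta>. x + Re \<zeta> *\<^sub>R v \<in> ball x0 R}"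
      by (simp only: convex_linear_vimage lin convex_ball)
    moreover have "convex ((\<lambda>\<zeta>. Im \<zeta> *\<^sub>R v) -` ball 0 R)"
      by (intro convex_linear_vimage lin convex_ball)
    ultimately show ?thesis unfolding D_def by (intro convex_Int) (auto simp: vimage_def)
  qed
  define \<F> where "\<F> n \<zeta> = heat_ext (1 / real (Suc n)) (x + Re \<zeta> *\<^sub>R v) (Im \<zeta> *\<^sub>R v)" for n \<zeta>
  have D_norm: "norm (x + Re \<zeta> *\<^sub>R v - x0) \<le> R" "norm (Im \<zeta> *\<^sub>R v) \<le> R" if "\<zeta> \<in> D" for \<zeta>
    using that by (auto simp: D_def dist_norm norm_minus_commute)
  have holo: "h holomorphic_on D" if "h \<in> range \<F>" for h
  proof -
    from that obtain n where h: "h = \<F> n" by (rule imageE)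
    show "h holomorphic_on D"
      unfolding h \<F>_def by (rule heat_ext_holomorphic) simp
  qed
  have bdd: "\<exists>B. \<forall>h\<in>range \<F>. \<forall>z\<in>X. norm (h z) \<le> B" if "compact X" "X \<subseteq> D" for X
  proof (intro exI ballI)
    fix h z assume h: "h \<in> range \<F>" and zX: "z \<in> X"
    have z: "z \<in> D" by (rule subsetD[OF that(2) zX])
    from h obtain n where h: "h = \<F> n" by (rule imageE)
    show "norm (h z) \<le> (LINT t|lborel. enn2real (majorant t)) / Gamma s"
      unfolding h \<F>_def by (rule heat_ext_bounded[OF _ _ D_norm[OF z]]) auto
  qed
  have "\<exists>g r. g holomorphic_on D \<and> strict_mono (r :: nat \<Rightarrow> nat) \<and> (\<forall>\<zeta>\<in>D. (\<lambda>n. \<F> (r n) \<zeta>) \<longlonglongrightarrow> g \<zeta>)"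
  proof (rule Montel[OF D_open holo bdd order.refl])
    fix g and r :: "nat \<Rightarrow> nat"
    assume g: "g holomorphic_on D" "strict_mono r" "\<And>\<zeta>. \<zeta> \<in> D \<Longrightarrow> (\<lambda>n. \<F> (r n) \<zeta>) \<longlonglongrightarrow> g \<zeta>"
    show ?thesis
      by (rule exI[of _ g], rule exI[of _ r]) (intro conjI ballI g)
  qed
  then obtain g and r :: "nat \<Rightarrow> nat" where "g holomorphic_on D \<and> strict_mono r \<and> (\<forall>\<zeta>\<in>D. (\<lambda>n. \<F> (r n) \<zeta>) \<longlonglongrightarrow> g \<zeta>)"
    by (elim exE)
  then have g: "g holomorphic_on D" "strict_mono r" "\<And>\<zeta>. \<zeta> \<in> D \<Longrightarrow> (\<lambda>n. \<F> (r n) \<zeta>) \<longlonglongrightarrow> g \<zeta>"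
    by auto
  have g_eq: "g \<zeta> = solution (x + Re \<zeta> *\<^sub>R v) (Im \<zeta> *\<^sub>R v)" if "\<zeta> \<in> D" for \<zeta>
  proof (rule LIMSEQ_unique[OF g(3)[OF that]])
    have "(\<lambda>n. \<F> n \<zeta>) \<longlonglongrightarrow> solution (x + Re \<zeta> *\<^sub>R v) (Im \<zeta> *\<^sub>R v)"
      unfolding \<F>_def by (rule heat_ext_tendsto[OF D_norm[OF that]])
    from LIMSEQ_subseq_LIMSEQ[OF this g(2)]
    show "(\<lambda>n. \<F> (r n) \<zeta>) \<longlonglongrightarrow> solution (x + Re \<zeta> *\<^sub>R v) (Im \<zeta> *\<^sub>R v)"
      by (simp only: o_def)
  qed
  have "solution (x + 1 *\<^sub>R v) 0 = 0"
  proof (rule holomorphic_line_zero[where F="\<lambda>a. solution a 0", OF g(1) D_open convex_connected[OF D_conv]])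
    show "0 \<in> D" "complex_of_real 1 \<in> D" using x xv R by (auto simp: D_def)
    show "g (complex_of_real \<tau>) = solution (x + \<tau> *\<^sub>R v) 0" if "complex_of_real \<tau> \<in> D" for \<tau>
      using g_eq[OF that] by simp
  qed (rule acc)
  then show ?thesis by simp
qed

end

section \<open>Unique continuation\<close>

lemma AE_not_in_open_imp_empty:
  fixes S :: "'a::euclidean_space set"
  assumes "open S" "AE y in lborel. y \<notin> S"
  shows "S = {}"
proof (rule ccontr)
  assume "S \<noteq> {}"
  have "S \<in> null_sets lborel"
    using assms by (subst AE_iff_null_sets) auto
  then have "negligible S"
    unfolding negligible_iff_null_sets by (rule null_sets_completionI)
  then show False using open_not_negligible[OF assms(1) \<open>S \<noteq> {}\<close>] by blast
qed

text \<open>\<open>W\<close>, the points near which \<open>u\<close> vanishes almost everywhere, is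
  open, and so is its complement in \<open>\<Omega>\<close>: if a ball of radius at most
  \<open>R x\<close> around \<open>x\<close> met \<open>W\<close>, it would contain a nonempty open
  set of zeros up to a null set, and the alternative would put \<open>x\<close> into
  \<open>W\<close>. A countable subcover controls the exceptional null sets.\<close>

lemma unique_continuation_from_local:
  fixes u :: "'a::euclidean_space \<Rightarrow> real"
  assumes \<Omega>: "open \<Omega>" "connected \<Omega>" and u [measurable]: "u \<in> borel_measurable borel"
    and local: "\<And>x. x \<in> \<Omega> \<Longrightarrow> \<exists>R>0. emeasure lborel {y \<in> ball x R. u y = 0} \<noteq> 0 \<longrightarrow> (AE y in lborel. y \<in> ball x R \<longrightarrow> u y = 0)"
    and E: "E \<subseteq> \<Omega>" "E \<in> sets lebesgue" "emeasure lebesgue E > 0" "AE x in lebesgue. x \<in> E \<longrightarrow> u x = 0"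
  shows "AE x in lborel. x \<in> \<Omega> \<longrightarrow> u x = 0"
proof -
  have "\<forall>x\<in>\<Omega>. \<exists>R. R > 0 \<and> (emeasure lborel {y \<in> ball x R. u y = 0} \<noteq> 0 \<longrightarrow> (AE y in lborel. y \<in> ball x R \<longrightarrow> u y = 0))"
    using local by blast
  then obtain R where R': "\<forall>x\<in>\<Omega>. R x > 0 \<and> (emeasure lborel {y \<in> ball x (R x). u y = 0} \<noteq> 0 \<longrightarrow> (AE y in lborel. y \<in> ball x (R x) \<longrightarrow> u y = 0))"
    by (rule bchoice[THEN exE])
  have R: "\<And>x. x \<in> \<Omega> \<Longrightarrow> R x > 0"
    "\<And>x. x \<in> \<Omega> \<Longrightarrow> emeasure lborel {y \<in> ball x (R x). u y = 0} \<noteq> 0 \<Longrightarrow> AE y in lborel. y \<in> ball x (R x) \<longrightarrow> u y = 0"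
    using R' by auto
  have sets0 [measurable]: "{y \<in> ball x r. u y = 0} \<in> sets lborel" for x r
  proof -
    have "{y \<in> ball x r. u y = 0} = ball x r \<inter> (u -` {0} \<inter> space borel)" by auto
    then show ?thesis using measurable_sets[OF u, of "{0}"] by simp
  qed
  have null_AE: "AE y in lborel. \<not> (y \<in> ball x r \<and> u y = 0)" if "emeasure lborel {y \<in> ball x r. u y = 0} = 0" for x r
  proof -
    have "{y \<in> ball x r. u y = 0} \<in> null_sets lborel" using that sets0 by (simp add: null_sets_def)
    then show ?thesis by (rule AE_not_in[THEN eventually_mono]) auto
  qed
  obtain \<C> where \<C>: "\<C> \<subseteq> (\<lambda>x. ball x (R x)) ` \<Omega>" "countable \<C>" "\<Union>\<C> = \<Union>((\<lambda>x. ball x (R x)) ` \<Omega>)"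
    by (rule Lindelof[of "(\<lambda>x. ball x (R x)) ` \<Omega>"]) auto
  obtain X where X: "X \<subseteq> \<Omega>" "countable X" "\<C> = (\<lambda>x. ball x (R x)) ` X"
    using countable_subset_image[of \<C> "\<lambda>x. ball x (R x)" \<Omega>] \<C> by blast
  have cover: "\<exists>x\<in>X. y \<in> ball x (R x)" if "y \<in> \<Omega>" for y
  proof -
    have "y \<in> ball y (R y)" using R(1)[OF that] by simp
    then have "y \<in> \<Union>\<C>" unfolding \<C>(3) using that by blast
    then show ?thesis unfolding X(3) by blast
  qed
  define W where "W = {x \<in> \<Omega>. \<exists>r>0. AE y in lborel. y \<in> ball x r \<longrightarrow> u y = 0}"
  have W_open: "open W"
    unfolding open_contains_ball
  proof
    fix x assume "x \<in> W"
    then obtain r where r: "x \<in> \<Omega>" "r > 0" "AE y in lborel. y \<in> ball x r \<longrightarrow> u y = 0" unfolding W_def by blast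
    obtain e where e: "e > 0" "ball x e \<subseteq> \<Omega>" using \<Omega>(1) r(1) open_contains_ball by blast
    have "ball x (min r e) \<subseteq> W"
    proof
      fix y assume y: "y \<in> ball x (min r e)"
      have "AE z in lborel. z \<in> ball y (r - dist x y) \<longrightarrow> u z = 0"
        using r(3)
      proof eventually_elim
        case (elim z)
        have "z \<in> ball y (r - dist x y) \<Longrightarrow> z \<in> ball x r"
          using dist_triangle[of x z y] by simp
        then show ?case using elim by blast
      qed
      moreover have "r - dist x y > 0" "y \<in> \<Omega>" using y e by auto
      ultimately show "y \<in> W" unfolding W_def by blast
    qed
    then show "\<exists>e>0. ball x e \<subseteq> W" using r(2) e(1) by (intro exI[of _ "min r e"]) simp
  qed
  have V_open: "open (\<Omega> - W)"
    unfolding open_contains_ball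
  proof
    fix x assume x: "x \<in> \<Omega> - W"
    obtain e where e: "e > 0" "ball x e \<subseteq> \<Omega>" using \<Omega>(1) x open_contains_ball by blast
    have "y \<notin> W" if y: "y \<in> ball x (min (R x) e)" for y
    proof
      assume "y \<in> W"
      then obtain r where r: "r > 0" "AE z in lborel. z \<in> ball y r \<longrightarrow> u z = 0" unfolding W_def by blast
      have "emeasure lborel {z \<in> ball x (R x). u z = 0} \<noteq> 0"
      proof
        assume "emeasure lborel {z \<in> ball x (R x). u z = 0} = 0"
        from null_AE[OF this] r(2) have "AE z in lborel. z \<notin> ball x (R x) \<inter> ball y r"
          by eventually_elim blast
        then have "ball x (R x) \<inter> ball y r = {}"
          by (intro AE_not_in_open_imp_empty) auto
        moreover have "y \<in> ball x (R x) \<inter> ball y r" using y r by simp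
        ultimately show False by blast
      qed
      then have "AE z in lborel. z \<in> ball x (R x) \<longrightarrow> u z = 0" using R(2) x by blast
      then have "x \<in> W" unfolding W_def using R(1) x by blast
      then show False using x by blast
    qed
    then show "\<exists>e>0. ball x e \<subseteq> \<Omega> - W"
      using e R(1)[of x] x by (intro exI[of _ "min (R x) e"]) (auto simp: subset_iff)
  qed
  have "W \<noteq> {}"
  proof
    \<comment> \<open>Every ball of the subcover would then hold only a null set of zeros, and
      \<open>E\<close>, covered by these balls and made of zeros up to a null set, would be
      null.\<close>
    assume W: "W = {}"
    have "AE y in lborel. \<forall>x\<in>X. \<not> (y \<in> ball x (R x) \<and> u y = 0)"
    proof (rule AE_ball_countable[THEN iffD2, OF X(2)], intro ballI null_AE)
      fix x assume "x \<in> X"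
      then have x: "x \<in> \<Omega>" using X(1) by blast
      show "emeasure lborel {y \<in> ball x (R x). u y = 0} = 0"
      proof (rule ccontr)
        assume "emeasure lborel {y \<in> ball x (R x). u y = 0} \<noteq> 0"
        then have "x \<in> W" unfolding W_def using R(1)[OF x] R(2)[OF x] x by blast
        then show False using W by blast
      qed
    qed
    then have "AE y in lebesgue. \<forall>x\<in>X. \<not> (y \<in> ball x (R x) \<and> u y = 0)" by (rule AE_completion)
    then have "AE y in lebesgue. y \<notin> E"
      using E(4)
    proof eventually_elim
      case (elim y)
      show ?case
      proof
        assume "y \<in> E"
        then show False using elim cover E(1) by blast
      qed
    qed
    then have "E \<in> null_sets lebesgue" using E(2) by (subst AE_iff_null_sets)
    then have "emeasure lebesgue E = 0" by (rule null_setsD1)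
    from E(3)[unfolded this] show False by simp
  qed
  then have "\<Omega> - W = {}"
    using connectedD[OF \<Omega>(2) W_open V_open] unfolding W_def by blast
  have "AE y in lborel. \<forall>x\<in>X. y \<in> ball x (R x) \<longrightarrow> u y = 0"
  proof (rule AE_ball_countable[THEN iffD2, OF X(2)], intro ballI)
    fix x assume "x \<in> X"
    then have x: "x \<in> \<Omega>" "x \<in> W" using X(1) \<open>\<Omega> - W = {}\<close> by auto
    then obtain r where r: "r > 0" "AE y in lborel. y \<in> ball x r \<longrightarrow> u y = 0" unfolding W_def by blast
    show "AE y in lborel. y \<in> ball x (R x) \<longrightarrow> u y = 0"
    proof (rule R(2)[OF x(1)], rule notI)
      assume "emeasure lborel {y \<in> ball x (R x). u y = 0} = 0"
      from null_AE[OF this] r(2) have "AE z in lborel. z \<notin> ball x (R x) \<inter> ball x r"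
        by eventually_elim blast
      then have "ball x (R x) \<inter> ball x r = {}"
        by (intro AE_not_in_open_imp_empty) auto
      moreover have "x \<in> ball x (R x) \<inter> ball x r" using R(1)[OF x(1)] r by simp
      ultimately show False by blast
    qed
  qed
  then show ?thesis
    by eventually_elim (use cover in blast)
qed

text \<open>On a small ball \<open>u\<close> agrees almost everywhere with the continuous function
  \<open>solution x 0 / c\<close>, so positive measure of its zero set passes to
  \<open>solution\<close>, to which the dichotomy applies.\<close>

lemma frac_harmonic_local_alternative:
  fixes u :: "'a::euclidean_space \<Rightarrow> real"
  assumes s: "0 < s" "s < 2" "2 * s < real DIM('a)"
    and u [measurable]: "u \<in> borel_measurable borel" and Y [measurable]: "Y \<in> borel_measurable borel" and Y_fin: "weighted_sq s Y < \<infinity>"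
    and test: "\<And>n. \<phi> n \<in> test_functions UNIV"
    and Lp: "(\<lambda>n. \<integral>\<^sup>+x. ennreal (\<bar>\<phi> n x - u x\<bar> powr (2 * real DIM('a) / (real DIM('a) - 2 * s))) \<partial>lborel) \<longlonglongrightarrow> 0"
    and Y_lim: "(\<lambda>n. weighted_sq s (\<lambda>\<xi>. cnj (FT (\<lambda>x. complex_of_real (\<phi> n x)) \<xi>) - Y \<xi>)) \<longlonglongrightarrow> 0"
    and orth: "\<And>\<psi>. \<psi> \<in> test_functions \<Omega> \<Longrightarrow>
       (LINT \<xi>|lborel. complex_of_real (norm \<xi> powr (2 * s)) * Y \<xi> * FT (\<lambda>x. complex_of_real (\<psi> x)) \<xi>) = 0"
    and \<Omega>: "open \<Omega>" "x0 \<in> \<Omega>"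
  shows "\<exists>R>0. emeasure lborel {y \<in> ball x0 R. u y = 0} \<noteq> 0 \<longrightarrow> (AE y in lborel. y \<in> ball x0 R \<longrightarrow> u y = 0)"
proof -
  obtain e where e: "e > 0" "cball x0 e \<subseteq> \<Omega>" using \<Omega> open_contains_cball by blast
  \<comment> \<open>The cutoff is supported in the ball of radius \<open>2 * \<rho>\<close>, which
    has to lie in \<open>\<Omega>\<close>.\<close>
  define \<rho> where "\<rho> = e / 2"
  have \<rho>: "\<rho> > 0" "cball x0 (2 * \<rho>) \<subseteq> \<Omega>" using e by (auto simp: \<rho>_def)
  interpret weighted_data s Y by unfold_locales (fact s Y Y_fin)+
  obtain K where K: "\<And>t a b. 0 < t \<Longrightarrow> t \<le> 2 \<Longrightarrow> norm (a - x0) \<le> \<rho> / 4 \<Longrightarrow> norm b \<le> \<rho> / 4 \<Longrightarrow>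
     cmod (LINT \<xi>|lborel. complex_of_real (norm \<xi> powr (2 * s)) * Y \<xi> * gauss_exp t a b \<xi>) \<le> K"
    using local_heat_bound[OF s(1,2) Y Y_fin orth \<rho>] by blast
  interpret local_weighted_data s Y x0 "\<rho> / 4" K
    by unfold_locales (use \<rho>(1) K in \<open>simp_all add: heat_lap_def\<close>)
  define c where "c = complex_of_real ((2 * pi) ^ DIM('a))"
  have c: "c \<noteq> 0" by (simp add: c_def)
  note [measurable] = test_function_measurable[OF test]
  have U_meas: "(\<lambda>x. heat_ext (1 / real (Suc k)) x 0 / c) \<in> borel_measurable borel" for k
    unfolding heat_ext_def by measurable
  \<comment> \<open>The transforms of \<open>\<phi> n\<close> converge to \<open>Y\<close> in the
    weighted norm and the Gaussian lies in the dual space, so the heat flows converge at every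
    point. This ties \<open>Y\<close> to \<open>u\<close>, to which \<open>\<phi> n\<close>
    converges in \<open>L^p\<close>.\<close>
  have U_lim: "(\<lambda>n. complex_of_real (LINT y|lborel. heat_kernel (1 / real (Suc k)) (y - x) * \<phi> n y)) \<longlonglongrightarrow> heat_ext (1 / real (Suc k)) x 0 / c" for k x
  proof -
    define t where "t = 1 / real (Suc k)"
    have t: "t > 0" by (simp add: t_def)
    let ?f = "\<lambda>n \<xi>. cnj (FT (\<lambda>x. complex_of_real (\<phi> n x)) \<xi>)"
    have g_fin: "weighted_sq (- s) (gauss_exp t x 0) < \<infinity>"
      by (rule weighted_sq_gauss_exp(2)[OF s(1,3) t, of _ 0]) simp
    have f_fin: "weighted_sq s (?f n) < \<infinity>" for n
      using test_function_FT_finite[OF test s(1,2), of n] by (simp add: weighted_sq_cnj weighted_sq_def)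
    have f_int: "integrable lborel (\<lambda>\<xi>. ?f n \<xi> * gauss_exp t x 0 \<xi>)" for n
      by (rule weighted_pairing(1)[where s=s and A="enn2real (weighted_sq s (?f n))" and B="enn2real (weighted_sq (- s) (gauss_exp t x 0))"])
         (use f_fin[of n] g_fin in \<open>auto simp: less_top\<close>)
    have "(\<lambda>n. LINT \<xi>|lborel. (?f n \<xi> - Y \<xi>) * gauss_exp t x 0 \<xi>) \<longlonglongrightarrow> 0"
      by (rule weighted_pairing_tendsto[OF _ _ Y_lim g_fin]) measurable
    moreover have "(LINT \<xi>|lborel. (?f n \<xi> - Y \<xi>) * gauss_exp t x 0 \<xi>) = c * complex_of_real (LINT y|lborel. heat_kernel t (y - x) * \<phi> n y) - heat_ext t x 0" for n
    proof -
      have "(LINT \<xi>|lborel. (?f n \<xi> - Y \<xi>) * gauss_exp t x 0 \<xi>) = (LINT \<xi>|lborel. ?f n \<xi> * gauss_exp t x 0 \<xi>) - heat_ext t x 0"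
        unfolding left_diff_distrib heat_ext_def by (rule Bochner_Integration.integral_diff[OF f_int heat_ext_integrable[OF t]])
      then show ?thesis
        unfolding integral_cnj_FT_gaussian[OF test_function_integrable[OF test] t] by (simp add: c_def)
    qed
    ultimately have "(\<lambda>n. c * complex_of_real (LINT y|lborel. heat_kernel t (y - x) * \<phi> n y) - heat_ext t x 0) \<longlonglongrightarrow> 0"
      by simp
    then have "(\<lambda>n. c * complex_of_real (LINT y|lborel. heat_kernel t (y - x) * \<phi> n y)) \<longlonglongrightarrow> heat_ext t x 0"
      by (rule LIM_zero_cancel)
    then have "(\<lambda>n. c * complex_of_real (LINT y|lborel. heat_kernel t (y - x) * \<phi> n y) / c) \<longlonglongrightarrow> heat_ext t x 0 / c"
      using c by (intro tendsto_divide tendsto_const)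
    then show ?thesis using c by (simp add: t_def)
  qed
  define p where "p = 2 * real DIM('a) / (real DIM('a) - 2 * s)"
  have p: "p \<ge> 1" using s by (simp add: p_def)
  let ?B = "ball x0 (\<rho> / 4)"
  have ident: "AE x in lborel. x \<in> ?B \<longrightarrow> complex_of_real (u x) = solution x 0 / c"
  proof (rule L1_identification[OF test u p Lp[folded p_def] _ _ U_meas U_lim])
    show "emeasure lborel ?B < \<infinity>" using emeasure_bounded_finite[OF bounded_ball] by simp
    show "(\<lambda>k. heat_ext (1 / real (Suc k)) x 0 / c) \<longlonglongrightarrow> solution x 0 / c" if "x \<in> ?B" for x
    proof (intro tendsto_divide tendsto_const heat_ext_tendsto)
      show "norm (x - x0) \<le> \<rho> / 4" using that by (simp add: dist_norm norm_minus_commute)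
    qed (use c \<rho> in auto)
  qed simp
  show ?thesis
  proof (intro exI[of _ "\<rho> / 4"] conjI impI)
    show "\<rho> / 4 > 0" using \<rho> by simp
    assume pos: "emeasure lborel {y \<in> ?B. u y = 0} \<noteq> 0"
    let ?Z = "{x \<in> cball x0 (\<rho> / 4). solution x 0 = 0}"
    have Z_sets: "?Z \<in> sets lborel"
    proof -
      have "?Z = cball x0 (\<rho> / 4) \<inter> (\<lambda>x. solution x 0) -` {0}" by auto
      then show ?thesis using continuous_closed_preimage[OF solution_continuous closed_cball closed_singleton[of 0]] by simp
    qed
    have Zpos: "emeasure lborel ?Z \<noteq> 0"
    proof
      assume "emeasure lborel ?Z = 0"
      then have "AE x in lborel. x \<notin> ?Z" using Z_sets by (intro AE_not_in) (simp add: null_sets_def)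
      with ident have "AE x in lborel. x \<notin> {y \<in> ?B. u y = 0}"
        by eventually_elim (use c in auto)
      moreover have "{y \<in> ?B. u y = 0} \<in> sets lborel"
      proof -
        have "{y \<in> ?B. u y = 0} = ?B \<inter> (u -` {0} \<inter> space borel)" by auto
        then show ?thesis using measurable_sets[OF u, of "{0}"] by simp
      qed
      ultimately have "{y \<in> ?B. u y = 0} \<in> null_sets lborel" by (subst AE_iff_null_sets)
      from pos null_setsD1[OF this] show False by (rule notE)
    qed
    have zero: "solution x 0 = 0" if "x \<in> ?B" for x
      by (rule zero_set_dichotomy[where F="\<lambda>a. solution a 0", OF solution_continuous solution_line_zero Zpos that])
    show "AE y in lborel. y \<in> ?B \<longrightarrow> u y = 0"
      using ident by eventually_elim (use zero in simp)
  qed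
qed

lemma frac_harmonic_unique_continuation:
  fixes u :: "'a::euclidean_space \<Rightarrow> real"
  assumes s: "0 < s" "s < 2" "2 * s < real DIM('a)" and \<Omega>: "open \<Omega>" "connected \<Omega>"
    and harm: "frac_harmonic s \<Omega> u"
    and E: "E \<in> sets lebesgue" "E \<subseteq> \<Omega>" "emeasure lebesgue E > 0" "AE x in lebesgue. x \<in> E \<longrightarrow> u x = 0"
  shows "AE x in lebesgue. x \<in> \<Omega> \<longrightarrow> u x = 0"
proof (rule frac_harmonic_representation[OF s harm])
  fix u' Y \<phi>
  assume u': "u' \<in> borel_measurable borel" "AE x in lborel. u x = u' x"
    and Y: "Y \<in> borel_measurable borel" "weighted_sq s Y < \<infinity>" and \<phi>: "\<And>n. \<phi> n \<in> test_functions UNIV"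
    and Lp: "(\<lambda>n. \<integral>\<^sup>+x. ennreal (\<bar>\<phi> n x - u' x\<bar> powr (2 * real DIM('a) / (real DIM('a) - 2 * s))) \<partial>lborel) \<longlonglongrightarrow> 0"
    and lim: "(\<lambda>n. weighted_sq s (\<lambda>\<xi>. cnj (FT (\<lambda>x. complex_of_real (\<phi> n x)) \<xi>) - Y \<xi>)) \<longlonglongrightarrow> 0"
    and orth: "\<And>\<psi>. \<psi> \<in> test_functions \<Omega> \<Longrightarrow>
       (LINT \<xi>|lborel. complex_of_real (norm \<xi> powr (2 * s)) * Y \<xi> * FT (\<lambda>x. complex_of_real (\<psi> x)) \<xi>) = 0"
  have ae: "AE x in lebesgue. u x = u' x" using u'(2) by (rule AE_completion)
  have "AE x in lborel. x \<in> \<Omega> \<longrightarrow> u' x = 0"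
  proof (rule unique_continuation_from_local[OF \<Omega> u'(1) _ E(2,1,3)])
    show "\<exists>R>0. emeasure lborel {y \<in> ball x R. u' y = 0} \<noteq> 0 \<longrightarrow> (AE y in lborel. y \<in> ball x R \<longrightarrow> u' y = 0)" if "x \<in> \<Omega>" for x
      by (rule frac_harmonic_local_alternative[OF s u'(1) Y \<phi> Lp lim orth \<Omega>(1) that])
    show "AE x in lebesgue. x \<in> E \<longrightarrow> u' x = 0"
      using E(4) ae by eventually_elim simp
  qed
  then have "AE x in lebesgue. x \<in> \<Omega> \<longrightarrow> u' x = 0" by (rule AE_completion)
  with ae show ?thesis by eventually_elim simp
qed

text \<open>An element of the completion is a function up to null sets, hence vanishing is read
  almost everywhere.\<close>

theorem theorem1p2:
  fixes s :: real and \<Omega> E :: "(real ^ 'n) set" and u :: "real ^ 'n \<Rightarrow> real"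
  assumes "1 < s" and "s < 2" and "real CARD('n) > 2 * s"
    and "open \<Omega>" and "connected \<Omega>"
    and "frac_harmonic s \<Omega> u"
    and "\<not> (AE x in lebesgue. u x = 0)"
    and "continuous_wrt_D_norm (s - 1) (frac_laplacian_pairing s u)"
    and "E \<in> sets lebesgue" and "E \<subseteq> \<Omega>" and "emeasure lebesgue E > 0"
    and "AE x in lebesgue. x \<in> E \<longrightarrow> u x = 0"
  shows "AE x in lebesgue. x \<in> \<Omega> \<longrightarrow> u x = 0"
  using assms(1-6,9-12) by (intro frac_harmonic_unique_continuation[of s \<Omega> u E]) auto

end
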